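(* There exist an absolute constant $c>0$ and, for every $s,R>0$, a constant $N_{s,R}\ge 86$ depending only on $s$ and $R$ such that the following holds. For all $s,R>0$, all $n\ge N_{s,R}$ and all $\Delta\ge 0$, the classifier $\hat\Phi_{d_n}$ with $d_n=\lfloor (R^2 n)^{\frac{1}{2s+1}}\rfloor$ satisfies \[ \sup_{\substack{f,g\in\mathcal H_s(R)\\ \|f-g\|\ge\Delta}}\Big\{\mathcal R_{f,g}(\hat\Phi_{d_n})-\inf_{\Phi}\mathcal R_{f,g}(\Phi)\Big\}\le \begin{cases} c\,R^{\frac{1}{2s+1}}n^{-\frac{s}{2s+1}}\log(n) & \text{if } \Delta< R^{\frac{1}{2s+1}}n^{-\frac{s}{2s+1}}\log(n),\\[0.3em] \dfrac{c}{\Delta}R^{\frac{2}{2s+1}}n^{-\frac{2s}{2s+1}}\log^2(n) & \text{if } \Delta\ge R^{\frac{1}{2s+1}}n^{-\frac{s}{2s+1}}\log(n).\end{cases} \]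
   Context: Model: for $f,g\in\mathbb L^2([0,1])$, a pair $(X,Y)$ is generated by $Y\sim\mathrm{Bernoulli}(1/2)$ independent of a standard Brownian motion $(W(t))_{t\in[0,1]}$, and $dX(t)=Yf(t)\,dt+(1-Y)g(t)\,dt+dW(t)$, $t\in[0,1]$ (with $X(0)=0$). The learner observes $n$ i.i.d. copies $(X_1,Y_1),\dots,(X_n,Y_n)$ of $(X,Y)$. A classifier is a measurable map (possibly depending on the sample) from continuous trajectories to $\{0,1\}$; its risk is $\mathcal R_{f,g}(\Phi)=\mathbb P(\Phi(X)\ne Y)$, where the probability is over both the sample and an independent new pair $(X,Y)$; the infimum is over all classifiers. $\|\cdot\|$ and $\langle\cdot,\cdot\rangle$ are the $\mathbb L^2([0,1])$ norm and inner product, and for $\varphi\in\mathbb L^2$ one writes $\langle\varphi,X\rangle=\int_0^1\varphi(t)\,dX(t)$. Fix an orthonormal basis $(\varphi_j)_{j\ge1}$ of $\mathbb L^2([0,1])$ and set $c_j(h)=\langle\varphi_j,h\rangle$; the Sobolev-type class is $\mathcal H_s(R)=\{h\in\mathbb L^2([0,1]):\sum_{j\ge1}c_j(h)^2j^{2s}\le R^2\}$. Classifier $\hat\Phi_d$ ($d\in\mathbb N^*$): let $N_k=\#\{i:Y_i=k\}$, $k\in\{0,1\}$. For $1\le j\le d$ let $\hat\theta_j=\mathbf 1_{\{N_1>0\}}N_1^{-1}\sum_{i:Y_i=1}\langle\varphi_j,X_i\rangle$ and $\hat\mu_j=\mathbf 1_{\{N_0>0\}}N_0^{-1}\sum_{i:Y_i=0}\langle\varphi_j,X_i\rangle$,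 $\hat\theta=(\hat\theta_j)_{j\le d}$, $\hat\mu=(\hat\mu_j)_{j\le d}$. For a new trajectory $X$ let $\mathbf X_d=(\langle\varphi_1,X\rangle,\dots,\langle\varphi_d,X\rangle)\in\mathbb R^d$ and set $\hat\Phi_d(X)=1$ if $\|\mathbf X_d-\hat\theta\|_d\le\|\mathbf X_d-\hat\mu\|_d$ and $\hat\Phi_d(X)=0$ otherwise, where $\|\cdot\|_d$ is the Euclidean norm of $\mathbb R^d$. *)

theory Defs
  imports "HOL-Probability.Probability"
begin

definition L2_01 :: "(real \<Rightarrow> real) set" where
  "L2_01 = {h. h \<in> borel_measurable lborel \<and> set_integrable lborel {0..1} (\<lambda>t. (h t)^2)}"

definition l2_inner :: "(real \<Rightarrow> real) \<Rightarrow> (real \<Rightarrow> real) \<Rightarrow> real" where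
  "l2_inner f g = (LINT t:{0..1}|lborel. f t * g t)"

definition l2_norm :: "(real \<Rightarrow> real) \<Rightarrow> real" where
  "l2_norm h = sqrt (l2_inner h h)"

text \<open>Orthonormal (Hilbert) basis \<open>(\<phi>_j)_{j\<ge>1}\<close> of L2([0,1]); the value \<open>\<phi> 0\<close> is unused.\<close>
definition orthonormal_basis_L2 :: "(nat \<Rightarrow> real \<Rightarrow> real) \<Rightarrow> bool" where
  "orthonormal_basis_L2 \<phi> \<longleftrightarrow>
     (\<forall>j\<ge>1. \<phi> j \<in> L2_01) \<and>
     (\<forall>i\<ge>1. \<forall>j\<ge>1. l2_inner (\<phi> i) (\<phi> j) = (if i = j then 1 else 0)) \<and>
     (\<forall>h\<in>L2_01. (\<forall>j\<ge>1. l2_inner (\<phi> j) h = 0) \<longrightarrow> l2_norm h = 0)"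

definition sobolev_class :: "(nat \<Rightarrow> real \<Rightarrow> real) \<Rightarrow> real \<Rightarrow> real \<Rightarrow> (real \<Rightarrow> real) set" where
  "sobolev_class \<phi> s R = {h \<in> L2_01.
     (\<lambda>j. (l2_inner (\<phi> j) h)^2 * real j powr (2 * s)) summable_on {1..} \<and>
     (\<Sum>\<^sub>\<infinity>j\<in>{1..}. (l2_inner (\<phi> j) h)^2 * real j powr (2 * s)) \<le> R^2}"

definition traj_space :: "(real \<Rightarrow> real) measure" where
  "traj_space = (\<Pi>\<^sub>M t\<in>{0..1}. borel)"

definition standard_BM :: "'a measure \<Rightarrow> ('a \<Rightarrow> real \<Rightarrow> real) \<Rightarrow> bool" where
  "standard_BM M W \<longleftrightarrow>
     prob_space M \<and>
     (\<forall>t\<in>{0..1}. (\<lambda>\<omega>. W \<omega> t) \<in> borel_measurable M) \<and>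
     (AE \<omega> in M. W \<omega> 0 = 0 \<and> continuous_on {0..1} (W \<omega>)) \<and>
     (\<forall>(k::nat) (t::nat \<Rightarrow> real). 0 \<le> t 0 \<and> t k \<le> 1 \<and> (\<forall>i<k. t i < t (Suc i)) \<longrightarrow>
        prob_space.indep_vars M (\<lambda>_. borel) (\<lambda>i \<omega>. W \<omega> (t (Suc i)) - W \<omega> (t i)) {..<k} \<and>
        (\<forall>i<k. distributed M lborel (\<lambda>\<omega>. W \<omega> (t (Suc i)) - W \<omega> (t i))
                 (normal_density 0 (sqrt (t (Suc i) - t i)))))"

text \<open>The sample \<open>(W_i,Y_i)\<close>, \<open>i = 1..n\<close>, together with the new pair \<open>(W_0,Y_0)\<close>:
  independent copies, \<open>W_i\<close> standard BM, \<open>Y_i ~ Bernoulli(1/2)\<close> (True = label 1),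
  \<open>Y_i\<close> independent of \<open>W_i\<close> (independence of the generated sigma-algebras;
  the library's \<open>indep_var\<close> requires both variables to have the same type).\<close>
definition bm_model :: "'a measure \<Rightarrow> nat \<Rightarrow> (nat \<Rightarrow> 'a \<Rightarrow> real \<Rightarrow> real) \<Rightarrow> (nat \<Rightarrow> 'a \<Rightarrow> bool) \<Rightarrow> bool" where
  "bm_model M n W Y \<longleftrightarrow>
     prob_space M \<and>
     (\<forall>i\<le>n. standard_BM M (W i) \<and>
        Y i \<in> measurable M (count_space UNIV) \<and>
        measure M {\<omega> \<in> space M. Y i \<omega>} = 1/2 \<and>
        prob_space.indep_sets M (case_bool
           {(\<lambda>\<omega>. restrict (W i \<omega>) {0..1}) -` A \<inter> space M | A. A \<in> sets traj_space}
           {Y i -` B \<inter> space M | B. B \<in> sets (count_space (UNIV::bool set))}) UNIV) \<and>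
     prob_space.indep_vars M (\<lambda>_. traj_space \<Otimes>\<^sub>M count_space UNIV)
        (\<lambda>i \<omega>. (restrict (W i \<omega>) {0..1}, Y i \<omega>)) {..n}"

definition drift :: "(real \<Rightarrow> real) \<Rightarrow> real \<Rightarrow> real" where
  "drift h t = (LINT u:{0..t}|lborel. h u)"

text \<open>\<open>X(t) = Y \<int>_0^t f + (1-Y) \<int>_0^t g + W(t)\<close>, i.e. \<open>dX = Yf dt + (1-Y)g dt + dW\<close>, \<open>X(0)=0\<close>.\<close>
definition obs_path :: "(real \<Rightarrow> real) \<Rightarrow> (real \<Rightarrow> real) \<Rightarrow> ('a \<Rightarrow> real \<Rightarrow> real) \<Rightarrow> ('a \<Rightarrow> bool)
    \<Rightarrow> 'a \<Rightarrow> real \<Rightarrow> real" where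
  "obs_path f g W Y \<omega> = restrict (\<lambda>t. (if Y \<omega> then drift f t else drift g t) + W \<omega> t) {0..1}"

definition dyadic_coef :: "(real \<Rightarrow> real) \<Rightarrow> nat \<Rightarrow> nat \<Rightarrow> real" where
  "dyadic_coef \<phi> k m = 2^k * (LINT u:{real m / 2^k .. real (Suc m) / 2^k}|lborel. \<phi> u)"

definition dyadic_sum :: "(real \<Rightarrow> real) \<Rightarrow> (real \<Rightarrow> real) \<Rightarrow> nat \<Rightarrow> real" where
  "dyadic_sum \<phi> x k = (\<Sum>m<2^k. dyadic_coef \<phi> k m * (x (real (Suc m) / 2^k) - x (real m / 2^k)))"

text \<open>The integral is the \<open>L^2(M)\<close>-limit of the step-function integrals (defined up to null sets).\<close>
definition stoch_int :: "'a measure \<Rightarrow> (real \<Rightarrow> real) \<Rightarrow> ('a \<Rightarrow> real \<Rightarrow> real) \<Rightarrow> 'a \<Rightarrow> real" where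
  "stoch_int M \<phi> X = (SOME Z. Z \<in> borel_measurable M \<and>
      (\<lambda>k. \<integral>\<^sup>+\<omega>. ennreal ((Z \<omega> - dyadic_sum \<phi> (X \<omega>) k)^2) \<partial>M) \<longlonglongrightarrow> 0)"

text \<open>\<open>Z i j \<omega> = \<langle>\<phi>_j, X_i\<rangle>\<close>; index 0 is the new observation, 1..n the sample.
  Value True means the classifier outputs 1.\<close>
definition hat_Phi :: "nat \<Rightarrow> nat \<Rightarrow> (nat \<Rightarrow> 'a \<Rightarrow> bool) \<Rightarrow> (nat \<Rightarrow> nat \<Rightarrow> 'a \<Rightarrow> real) \<Rightarrow> 'a \<Rightarrow> bool" where
  "hat_Phi d n Y Z \<omega> =
    (let N1 = card {i\<in>{1..n}. Y i \<omega>};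
         N0 = card {i\<in>{1..n}. \<not> Y i \<omega>};
         \<theta> = (\<lambda>j. if N1 > 0 then (\<Sum>i\<in>{i\<in>{1..n}. Y i \<omega>}. Z i j \<omega>) / real N1 else 0);
         \<mu> = (\<lambda>j. if N0 > 0 then (\<Sum>i\<in>{i\<in>{1..n}. \<not> Y i \<omega>}. Z i j \<omega>) / real N0 else 0)
     in L2_set (\<lambda>j. Z 0 j \<omega> - \<theta> j) {1..d} \<le> L2_set (\<lambda>j. Z 0 j \<omega> - \<mu> j) {1..d})"

definition classifier_space :: "nat \<Rightarrow> ((nat \<Rightarrow> (real \<Rightarrow> real) \<times> bool) \<times> (real \<Rightarrow> real)) measure" where
  "classifier_space n = (\<Pi>\<^sub>M i\<in>{1..n}. traj_space \<Otimes>\<^sub>M count_space UNIV) \<Otimes>\<^sub>M traj_space"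

definition sample_data :: "nat \<Rightarrow> (nat \<Rightarrow> 'a \<Rightarrow> real \<Rightarrow> real) \<Rightarrow> (nat \<Rightarrow> 'a \<Rightarrow> bool) \<Rightarrow> 'a
    \<Rightarrow> (nat \<Rightarrow> (real \<Rightarrow> real) \<times> bool) \<times> (real \<Rightarrow> real)" where
  "sample_data n X Y \<omega> = ((\<lambda>i\<in>{1..n}. (X i \<omega>, Y i \<omega>)), X 0 \<omega>)"

definition opt_risk :: "'a measure \<Rightarrow> nat \<Rightarrow> (nat \<Rightarrow> 'a \<Rightarrow> real \<Rightarrow> real) \<Rightarrow> (nat \<Rightarrow> 'a \<Rightarrow> bool) \<Rightarrow> real" where
  "opt_risk M n X Y = (INF \<Phi> \<in> measurable (classifier_space n) (count_space UNIV).
      measure M {\<omega> \<in> space M. \<Phi> (sample_data n X Y \<omega>) \<noteq> Y 0 \<omega>})"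

end

theory Submission
  imports Defs
begin

text \<open>
  Write \<open>\<delta> = \<parallel>f - g\<parallel>\<close> and let \<open>Q\<close> be the upper tail of the standard normal law.

  Lower bound: any classifier has risk at least \<open>Q (\<delta>/2)\<close>. Given the sample it is a measurable set of paths,
  which is approximated by a cylinder set; on cylinders the two laws of the new path are Gaussian products, the
  Neyman-Pearson test is linear, and the shift has length at most \<open>\<delta>\<close> by Bessel's inequality for interval indicators.

  Upper bound: given the sample, the classifier compares a linear functional of a Gaussian vector with a threshold,
  so its risk is \<open>(Q a + Q a') / 2\<close> for explicit \<open>a\<close>, \<open>a'\<close>. The sum \<open>a + a'\<close> differs from the norm \<open>D\<close> of the first
  \<open>d\<close> coefficients of \<open>f - g\<close> only to second order in the estimation error \<open>E\<close>, and \<open>a - a'\<close> is at most \<open>E\<close>; a second-order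
  expansion of \<open>Q\<close> bounds the conditional excess risk by a constant times \<open>(\<rho>\<^sup>2 + E\<^sup>2) / max \<delta> \<rho>\<close>, where
  \<open>\<rho> = R\<^bsup>1/(2s+1)\<^esup> n\<^bsup>-s/(2s+1)\<^esup>\<close> dominates both the bias and \<open>sqrt (d/n)\<close>. When both labels occur at
  least \<open>n/4\<close> times the mean of \<open>E\<^sup>2\<close> is of order \<open>\<rho>\<^sup>2\<close>; otherwise the risk is bounded by 1, and by Chebyshev's inequality
  this has probability at most \<open>4/n\<close>. Averaging yields the rate even without the logarithms.
\<close>

section \<open>Square-integrable functions\<close>

definition sq_integrable :: "'a measure \<Rightarrow> ('a \<Rightarrow> real) \<Rightarrow> bool" where
  "sq_integrable M f \<longleftrightarrow> f \<in> borel_measurable M \<and> integrable M (\<lambda>x. (f x)\<^sup>2)"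

abbreviation sq_inner :: "'a measure \<Rightarrow> ('a \<Rightarrow> real) \<Rightarrow> ('a \<Rightarrow> real) \<Rightarrow> real" where
  "sq_inner M f g \<equiv> \<integral>x. f x * g x \<partial>M"

abbreviation sq_norm :: "'a measure \<Rightarrow> ('a \<Rightarrow> real) \<Rightarrow> real" where
  "sq_norm M f \<equiv> \<integral>x. (f x)\<^sup>2 \<partial>M"

lemma square_add_le: "(x + y)\<^sup>2 \<le> 2 * x\<^sup>2 + 2 * y\<^sup>2" for x y :: real
  using zero_le_power2[of "x - y"] by (simp add: power2_eq_square algebra_simps)

lemma sq_integrable_measurable: "sq_integrable M f \<Longrightarrow> f \<in> borel_measurable M"
  by (simp add: sq_integrable_def)

lemma sq_integrable_square: "sq_integrable M f \<Longrightarrow> integrable M (\<lambda>x. (f x)\<^sup>2)"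
  by (simp add: sq_integrable_def)

lemma sq_integrable_mult:
  assumes "sq_integrable M f" "sq_integrable M g"
  shows "integrable M (\<lambda>x. f x * g x)"
proof (rule Bochner_Integration.integrable_bound)
  show "integrable M (\<lambda>x. (f x)\<^sup>2 + (g x)\<^sup>2)" "(\<lambda>x. f x * g x) \<in> borel_measurable M"
    using assms by (auto simp: sq_integrable_def)
  have "\<bar>f x\<bar> * \<bar>g x\<bar> \<le> (f x)\<^sup>2 + (g x)\<^sup>2" for x
    using sum_squares_bound[of "\<bar>f x\<bar>" "\<bar>g x\<bar>"] mult_nonneg_nonneg[OF abs_ge_zero[of "f x"] abs_ge_zero[of "g x"]]
    unfolding power2_abs by linarith
  then show "AE x in M. norm (f x * g x) \<le> norm ((f x)\<^sup>2 + (g x)\<^sup>2)"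
    by (simp add: abs_mult)
qed

lemma sq_integrable_add:
  assumes "sq_integrable M f" "sq_integrable M g"
  shows "sq_integrable M (\<lambda>x. f x + g x)"
proof -
  have "integrable M (\<lambda>x. (f x)\<^sup>2 + (g x)\<^sup>2 + 2 * (f x * g x))"
    using assms sq_integrable_mult[OF assms] by (auto simp: sq_integrable_def)
  then show ?thesis
    using assms by (auto simp: sq_integrable_def power2_sum mult.assoc)
qed

lemma sq_integrable_cmult: "sq_integrable M f \<Longrightarrow> sq_integrable M (\<lambda>x. c * f x)"
  by (auto simp: sq_integrable_def power_mult_distrib)

lemma sq_integrable_diff:
  "sq_integrable M f \<Longrightarrow> sq_integrable M g \<Longrightarrow> sq_integrable M (\<lambda>x. f x - g x)"
  using sq_integrable_add[of M f "\<lambda>x. (-1) * g x"] sq_integrable_cmult[of M g "-1"] by simp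

lemma sq_integrable_zero: "sq_integrable M (\<lambda>x. 0)"
  by (simp add: sq_integrable_def)

lemma sq_integrable_sum:
  "(\<And>i. i \<in> I \<Longrightarrow> sq_integrable M (f i)) \<Longrightarrow> sq_integrable M (\<lambda>x. \<Sum>i\<in>I. f i x)"
  by (induction I rule: infinite_finite_induct) (auto intro: sq_integrable_add sq_integrable_zero)

lemma sq_integrable_abs: "sq_integrable M f \<Longrightarrow> sq_integrable M (\<lambda>x. \<bar>f x\<bar>)"
  by (auto simp: sq_integrable_def)

lemma (in finite_measure) sq_integrable_bounded:
  assumes "f \<in> borel_measurable M" "\<And>x. \<bar>f x\<bar> \<le> K"
  shows "sq_integrable M f"
  unfolding sq_integrable_def
proof (intro conjI integrable_const_bound[where B="K\<^sup>2"])
  show "AE x in M. norm ((f x)\<^sup>2) \<le> K\<^sup>2"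
    using assms(2) by (auto intro!: AE_I2 power2_le_iff_abs_le[THEN iffD2] order_trans[OF abs_ge_zero])
qed (use assms in auto)

lemma (in finite_measure) sq_integrable_const: "sq_integrable M (\<lambda>_. c)"
  by (rule sq_integrable_bounded[where K="\<bar>c\<bar>"]) auto

lemma (in finite_measure) sq_integrable_imp_integrable: "sq_integrable M f \<Longrightarrow> integrable M f"
  using sq_integrable_mult[OF _ sq_integrable_const, of f 1] by simp

lemma sq_Cauchy_Schwarz:
  assumes f: "sq_integrable M f" and g: "sq_integrable M g"
  shows "(sq_inner M f g)\<^sup>2 \<le> sq_norm M f * sq_norm M g"
proof -
  note [measurable] = sq_integrable_measurable[OF f] sq_integrable_measurable[OF g]
  have nn_integral_square: "(\<integral>\<^sup>+x. ennreal \<bar>h x\<bar> ^ 2 \<partial>M) = ennreal (sq_norm M h)" if "sq_integrable M h" for h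
    using sq_integrable_square[OF that] by (simp add: ennreal_power nn_integral_eq_integral)
  have "(\<integral>x. \<bar>f x * g x\<bar> \<partial>M) \<ge> 0" by simp
  then have "ennreal ((\<integral>x. \<bar>f x * g x\<bar> \<partial>M)\<^sup>2) = (\<integral>\<^sup>+x. ennreal \<bar>f x * g x\<bar> \<partial>M)\<^sup>2"
    using sq_integrable_mult[OF f g]
    by (subst nn_integral_eq_integral) (auto simp: ennreal_power)
  also have "\<dots> = (\<integral>\<^sup>+x. ennreal \<bar>f x\<bar> * ennreal \<bar>g x\<bar> \<partial>M)\<^sup>2"
    by (simp add: abs_mult ennreal_mult)
  also have "\<dots> \<le> (\<integral>\<^sup>+x. ennreal \<bar>f x\<bar> ^ 2 \<partial>M) * (\<integral>\<^sup>+x. ennreal \<bar>g x\<bar> ^ 2 \<partial>M)"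
    by (rule Cauchy_Schwarz_nn_integral) auto
  also have "\<dots> = ennreal (sq_norm M f * sq_norm M g)"
    by (simp add: nn_integral_square f g ennreal_mult)
  finally have "(\<integral>x. \<bar>f x * g x\<bar> \<partial>M)\<^sup>2 \<le> sq_norm M f * sq_norm M g"
    by (simp add: ennreal_le_iff)
  moreover have "\<bar>sq_inner M f g\<bar> \<le> (\<integral>x. \<bar>f x * g x\<bar> \<partial>M)"
    by (rule integral_abs_bound)
  then have "\<bar>sq_inner M f g\<bar>\<^sup>2 \<le> (\<integral>x. \<bar>f x * g x\<bar> \<partial>M)\<^sup>2"
    by (intro power_mono) auto
  ultimately show ?thesis by simp
qed

lemma (in prob_space) integral_abs_sq_le:
  assumes "sq_integrable M f"
  shows "(\<integral>x. \<bar>f x\<bar> \<partial>M)\<^sup>2 \<le> sq_norm M f"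
  using sq_Cauchy_Schwarz[OF sq_integrable_abs[OF assms] sq_integrable_const, of 1]
  by (simp add: prob_space)

lemma sq_norm_diff_triangle:
  assumes "sq_integrable M f" "sq_integrable M g" "sq_integrable M h"
  shows "sq_norm M (\<lambda>x. f x - h x) \<le> 2 * sq_norm M (\<lambda>x. f x - g x) + 2 * sq_norm M (\<lambda>x. g x - h x)"
proof -
  have diffs: "integrable M (\<lambda>x. (f x - g x)\<^sup>2)" "integrable M (\<lambda>x. (g x - h x)\<^sup>2)" "integrable M (\<lambda>x. (f x - h x)\<^sup>2)"
    using assms by (auto intro!: sq_integrable_square sq_integrable_diff)
  have "sq_norm M (\<lambda>x. f x - h x) \<le> (\<integral>x. 2 * (f x - g x)\<^sup>2 + 2 * (g x - h x)\<^sup>2 \<partial>M)"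
  proof (rule integral_mono)
    show "(f x - h x)\<^sup>2 \<le> 2 * (f x - g x)\<^sup>2 + 2 * (g x - h x)\<^sup>2" for x
      using square_add_le[of "f x - g x" "g x - h x"] by simp
  qed (use diffs in auto)
  then show ?thesis using diffs by simp
qed

lemma sq_norm_add_le:
  assumes "sq_integrable M f" "sq_integrable M g"
  shows "sq_norm M (\<lambda>x. f x + g x) \<le> 2 * sq_norm M f + 2 * sq_norm M g"
  using sq_norm_diff_triangle[OF assms(1) sq_integrable_zero sq_integrable_cmult[OF assms(2), of "-1"]] by simp

lemma sq_norm_eq_0_AE:
  assumes "sq_integrable M f" "sq_norm M f = 0"
  shows "AE x in M. f x = 0"
  using assms by (subst (asm) integral_nonneg_eq_0_iff_AE) (auto simp: sq_integrable_def)

subsection \<open>Convergence in \<open>L\<^sup>2\<close>\<close>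

definition L2_tendsto :: "'a measure \<Rightarrow> (nat \<Rightarrow> 'a \<Rightarrow> real) \<Rightarrow> ('a \<Rightarrow> real) \<Rightarrow> bool" where
  "L2_tendsto M F f \<longleftrightarrow> (\<forall>k. sq_integrable M (F k)) \<and> sq_integrable M f \<and>
     (\<lambda>k. sq_norm M (\<lambda>x. F k x - f x)) \<longlonglongrightarrow> 0"

lemma L2_tendstoD:
  assumes "L2_tendsto M F f"
  shows "sq_integrable M (F k)" "sq_integrable M f" "(\<lambda>k. sq_norm M (\<lambda>x. F k x - f x)) \<longlonglongrightarrow> 0"
  using assms by (auto simp: L2_tendsto_def)

lemma L2_tendsto_small:
  assumes "L2_tendsto M F f" "e > 0"
  obtains N where "\<And>k. k \<ge> N \<Longrightarrow> sq_norm M (\<lambda>x. F k x - f x) < e"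
  using order_tendstoD(2)[OF L2_tendstoD(3)[OF assms(1)] assms(2)] by (auto simp: eventually_sequentially)

lemma L2_tendsto_add:
  assumes F: "L2_tendsto M F f" and G: "L2_tendsto M G g"
  shows "L2_tendsto M (\<lambda>k x. F k x + G k x) (\<lambda>x. f x + g x)"
  unfolding L2_tendsto_def
proof (intro conjI allI sq_integrable_add L2_tendstoD[OF F] L2_tendstoD[OF G])
  let ?B = "\<lambda>k. 2 * sq_norm M (\<lambda>x. F k x - f x) + 2 * sq_norm M (\<lambda>x. G k x - g x)"
  have "?B \<longlonglongrightarrow> 2 * 0 + 2 * 0" by (intro tendsto_intros L2_tendstoD(3)[OF F] L2_tendstoD(3)[OF G])
  then have B_lim: "?B \<longlonglongrightarrow> 0" by simp
  have "sq_norm M (\<lambda>x. F k x + G k x - (f x + g x)) \<le> ?B k" for k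
    unfolding add_diff_add by (intro sq_norm_add_le sq_integrable_diff L2_tendstoD(1,2)[OF F] L2_tendstoD(1,2)[OF G])
  then show "(\<lambda>k. sq_norm M (\<lambda>x. F k x + G k x - (f x + g x))) \<longlonglongrightarrow> 0"
    by (intro Lim_null_comparison[OF _ B_lim]) simp
qed

lemma L2_tendsto_cmult:
  assumes F: "L2_tendsto M F f"
  shows "L2_tendsto M (\<lambda>k x. c * F k x) (\<lambda>x. c * f x)"
proof -
  have "sq_norm M (\<lambda>x. c * F k x - c * f x) = c\<^sup>2 * sq_norm M (\<lambda>x. F k x - f x)" for k
    unfolding right_diff_distrib[symmetric] power_mult_distrib by simp
  then show ?thesis
    using F tendsto_mult_left[OF L2_tendstoD(3)[OF F], of "c\<^sup>2"] by (simp add: L2_tendsto_def sq_integrable_cmult)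
qed

lemma L2_tendsto_mult_const:
  assumes h: "sq_integrable M h" and c: "c \<longlonglongrightarrow> l"
  shows "L2_tendsto M (\<lambda>k x. c k * h x) (\<lambda>x. l * h x)"
proof -
  have "(\<lambda>k. (c k - l)\<^sup>2 * sq_norm M h) \<longlonglongrightarrow> (l - l)\<^sup>2 * sq_norm M h"
    by (intro tendsto_intros c)
  moreover have "sq_norm M (\<lambda>x. c k * h x - l * h x) = (c k - l)\<^sup>2 * sq_norm M h" for k
    unfolding left_diff_distrib[symmetric] power_mult_distrib by simp
  ultimately show ?thesis using h by (simp add: L2_tendsto_def sq_integrable_cmult)
qed

lemma L2_tendsto_sum:
  assumes "\<And>i. i \<in> I \<Longrightarrow> L2_tendsto M (F i) (f i)"
  shows "L2_tendsto M (\<lambda>k x. \<Sum>i\<in>I. F i k x) (\<lambda>x. \<Sum>i\<in>I. f i x)"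
  using assms
proof (induction I rule: infinite_finite_induct)
  case (insert i I)
  then show ?case using L2_tendsto_add[of M "F i" "f i"] by simp
qed (auto simp: L2_tendsto_def sq_integrable_zero)

lemma L2_tendsto_inner:
  assumes F: "L2_tendsto M F f" and g: "sq_integrable M g"
  shows "(\<lambda>k. sq_inner M (F k) g) \<longlonglongrightarrow> sq_inner M f g"
proof (rule LIM_zero_cancel, rule Lim_null_comparison[OF always_eventually])
  show "\<forall>k. norm (sq_inner M (F k) g - sq_inner M f g) \<le> sqrt (sq_norm M (\<lambda>x. F k x - f x) * sq_norm M g)"
  proof
    fix k
    have "sq_inner M (F k) g - sq_inner M f g = sq_inner M (\<lambda>x. F k x - f x) g"
      using sq_integrable_mult[OF L2_tendstoD(1)[OF F] g] sq_integrable_mult[OF L2_tendstoD(2)[OF F] g]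
      by (simp add: left_diff_distrib)
    moreover have "(sq_inner M (\<lambda>x. F k x - f x) g)\<^sup>2 \<le> sq_norm M (\<lambda>x. F k x - f x) * sq_norm M g"
      by (intro sq_Cauchy_Schwarz sq_integrable_diff L2_tendstoD[OF F] g)
    ultimately show "norm (sq_inner M (F k) g - sq_inner M f g) \<le> sqrt (sq_norm M (\<lambda>x. F k x - f x) * sq_norm M g)"
      by (simp add: real_le_rsqrt)
  qed
  have "(\<lambda>k. sqrt (sq_norm M (\<lambda>x. F k x - f x) * sq_norm M g)) \<longlonglongrightarrow> sqrt (0 * sq_norm M g)"
    by (intro tendsto_intros L2_tendstoD[OF F])
  then show "(\<lambda>k. sqrt (sq_norm M (\<lambda>x. F k x - f x) * sq_norm M g)) \<longlonglongrightarrow> 0"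
    by (simp only: mult_zero_left real_sqrt_zero)
qed

lemma L2_tendsto_sq_norm:
  assumes F: "L2_tendsto M F f"
  shows "(\<lambda>k. sq_norm M (F k)) \<longlonglongrightarrow> sq_norm M f"
proof -
  note sq = L2_tendstoD(1,2)[OF F]
  have "sq_norm M (F k) = sq_norm M (\<lambda>x. F k x - f x) + 2 * sq_inner M (F k) f - sq_norm M f" for k
    using sq_integrable_square[OF sq(1)[of k]] sq_integrable_square[OF sq(2)] sq_integrable_mult[OF sq(1)[of k] sq(2)]
    by (simp add: power2_diff mult.assoc)
  moreover have "(\<lambda>k. sq_norm M (\<lambda>x. F k x - f x) + 2 * sq_inner M (F k) f - sq_norm M f)
     \<longlonglongrightarrow> 0 + 2 * sq_inner M f f - sq_norm M f"
    by (intro tendsto_intros L2_tendstoD(3)[OF F] L2_tendsto_inner[OF F sq(2)])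
  ultimately show ?thesis by (simp add: power2_eq_square)
qed

lemma L2_tendsto_unique:
  assumes lim_f: "L2_tendsto M F f" and lim_g: "L2_tendsto M F g"
  shows "AE x in M. f x = g x"
proof -
  have "(\<lambda>k. 2 * sq_norm M (\<lambda>x. F k x - f x) + 2 * sq_norm M (\<lambda>x. F k x - g x)) \<longlonglongrightarrow> 2 * 0 + 2 * 0"
    by (intro tendsto_intros L2_tendstoD[OF lim_f] L2_tendstoD[OF lim_g])
  then have "sq_norm M (\<lambda>x. f x - g x) \<le> 2 * 0 + 2 * 0"
  proof (rule LIMSEQ_le_const, intro exI allI impI)
    show "sq_norm M (\<lambda>x. f x - g x) \<le> 2 * sq_norm M (\<lambda>x. F k x - f x) + 2 * sq_norm M (\<lambda>x. F k x - g x)" for k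
      using sq_norm_diff_triangle[of M f "F k" g] L2_tendstoD[OF lim_f] L2_tendstoD[OF lim_g]
      by (simp add: power2_commute)
  qed
  then have "sq_norm M (\<lambda>x. f x - g x) = 0" by (simp add: order.eq_iff)
  from sq_norm_eq_0_AE[OF _ this] show ?thesis
    using L2_tendstoD(2)[OF lim_f] L2_tendstoD(2)[OF lim_g] by (simp add: sq_integrable_diff)
qed

lemma L2_tendsto_dominated:
  assumes F: "\<And>n. sq_integrable M (F n)" and f: "sq_integrable M f" and b: "sq_integrable M b"
    and lim: "AE x in M. (\<lambda>n. F n x) \<longlonglongrightarrow> f x" and bound: "\<And>n. AE x in M. \<bar>F n x - f x\<bar> \<le> b x"
  shows "L2_tendsto M F f"
proof -
  have "(\<lambda>n. sq_norm M (\<lambda>x. F n x - f x)) \<longlonglongrightarrow> (\<integral>x. 0 \<partial>M)"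
  proof (rule integral_dominated_convergence[where w="\<lambda>x. (b x)\<^sup>2"])
    show "AE x in M. (\<lambda>n. (F n x - f x)\<^sup>2) \<longlonglongrightarrow> 0"
      using lim
    proof eventually_elim
      case (elim x)
      then have "(\<lambda>n. (F n x - f x)\<^sup>2) \<longlonglongrightarrow> (f x - f x)\<^sup>2" by (intro tendsto_intros)
      then show ?case by simp
    qed
    show "AE x in M. norm ((F n x - f x)\<^sup>2) \<le> (b x)\<^sup>2" for n
      using bound[of n] by eventually_elim (auto simp: abs_le_square_iff[symmetric])
    show "(\<lambda>x. (F n x - f x)\<^sup>2) \<in> borel_measurable M" for n
      using sq_integrable_diff[OF F f] by (intro sq_integrable_measurable[THEN borel_measurable_power])
  qed (use b in \<open>auto simp: sq_integrable_def\<close>)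
  then show ?thesis using F f by (simp add: L2_tendsto_def)
qed

subsection \<open>Completeness\<close>

definition L2_Cauchy :: "'a measure \<Rightarrow> (nat \<Rightarrow> 'a \<Rightarrow> real) \<Rightarrow> bool" where
  "L2_Cauchy M F \<longleftrightarrow> (\<forall>k. sq_integrable M (F k)) \<and>
     (\<forall>e>0. \<exists>N. \<forall>k\<ge>N. \<forall>l\<ge>N. sq_norm M (\<lambda>x. F k x - F l x) < e)"

definition fast_L2_Cauchy_subseq :: "'a measure \<Rightarrow> (nat \<Rightarrow> 'a \<Rightarrow> real) \<Rightarrow> (nat \<Rightarrow> nat) \<Rightarrow> bool" where
  "fast_L2_Cauchy_subseq M F r \<longleftrightarrow> strict_mono r \<and>
     (\<forall>m. \<forall>k\<ge>r m. sq_norm M (\<lambda>x. F k x - F (r m) x) \<le> (1/4)^m)"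

lemma L2_tendsto_imp_Cauchy:
  assumes F: "L2_tendsto M F f"
  shows "L2_Cauchy M F"
  unfolding L2_Cauchy_def
proof (intro conjI allI impI L2_tendstoD(1)[OF F])
  fix e :: real assume "e > 0"
  then obtain N where N: "\<And>k. k \<ge> N \<Longrightarrow> sq_norm M (\<lambda>x. F k x - f x) < e / 4"
    using L2_tendsto_small[OF F, of "e/4"] by auto
  have "sq_norm M (\<lambda>x. F k x - F l x) < e" if "k \<ge> N" "l \<ge> N" for k l
    using sq_norm_diff_triangle[of M "F k" f "F l"] L2_tendstoD(1,2)[OF F] N[OF that(1)] N[OF that(2)]
    by (simp add: power2_commute[of "f _"])
  then show "\<exists>N. \<forall>k\<ge>N. \<forall>l\<ge>N. sq_norm M (\<lambda>x. F k x - F l x) < e" by blast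
qed

lemma L2_Cauchy_fast_subseq:
  assumes "L2_Cauchy M F"
  obtains r where "fast_L2_Cauchy_subseq M F r"
proof -
  have "\<forall>m. \<exists>N. \<forall>k\<ge>N. \<forall>l\<ge>N. sq_norm M (\<lambda>x. F k x - F l x) < (1/4)^m"
    using assms by (simp add: L2_Cauchy_def)
  then obtain N where N: "\<And>m k l. k \<ge> N m \<Longrightarrow> l \<ge> N m \<Longrightarrow> sq_norm M (\<lambda>x. F k x - F l x) < (1/4)^m"
    by metis
  define r where "r m = (\<Sum>i\<le>m. N i) + m" for m
  have "N m \<le> r m" for m unfolding r_def by (intro trans_le_add1 member_le_sum) auto
  then have "sq_norm M (\<lambda>x. F k x - F (r m) x) \<le> (1/4)^m" if "k \<ge> r m" for k m
    using N that by (meson less_imp_le order_trans)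
  moreover have "strict_mono r" by (intro strict_mono_Suc_iff[THEN iffD2]) (simp add: r_def)
  ultimately show thesis by (intro that[of r]) (simp add: fast_L2_Cauchy_subseq_def)
qed

lemma AE_summable_of_summable_integral_abs:
  fixes f :: "nat \<Rightarrow> 'a \<Rightarrow> real"
  assumes f: "\<And>m. integrable M (f m)" and sum: "summable (\<lambda>m. \<integral>x. \<bar>f m x\<bar> \<partial>M)"
  shows "AE x in M. summable (\<lambda>m. f m x)"
proof -
  have [measurable]: "f m \<in> borel_measurable M" for m using f by auto
  have "(\<integral>\<^sup>+x. (\<Sum>m. ennreal \<bar>f m x\<bar>) \<partial>M) = (\<Sum>m. \<integral>\<^sup>+x. ennreal \<bar>f m x\<bar> \<partial>M)"
    by (intro nn_integral_suminf) auto
  also have "\<dots> = (\<Sum>m. ennreal (\<integral>x. \<bar>f m x\<bar> \<partial>M))"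
    using f by (intro suminf_cong nn_integral_eq_integral) auto
  also have "\<dots> = ennreal (\<Sum>m. \<integral>x. \<bar>f m x\<bar> \<partial>M)"
    using sum by (intro suminf_ennreal2) auto
  finally have "AE x in M. (\<Sum>m. ennreal \<bar>f m x\<bar>) \<noteq> \<infinity>"
    by (intro nn_integral_PInf_AE) auto
  then show ?thesis
    by eventually_elim (rule summable_rabs_cancel, rule summable_suminf_not_top, auto)
qed

lemma (in prob_space) fast_L2_Cauchy_subseq_AE_convergent:
  assumes F: "\<And>k. sq_integrable M (F k)" and r: "fast_L2_Cauchy_subseq M F r"
  shows "AE x in M. convergent (\<lambda>m. F (r m) x)"
proof -
  let ?D = "\<lambda>m x. F (r (Suc m)) x - F (r m) x"
  have D: "sq_integrable M (?D m)" for m by (intro sq_integrable_diff F)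
  have "(\<integral>x. \<bar>?D m x\<bar> \<partial>M) \<le> (1/2)^m" for m
  proof (rule power2_le_imp_le)
    have "(\<integral>x. \<bar>?D m x\<bar> \<partial>M)\<^sup>2 \<le> sq_norm M (?D m)" by (rule integral_abs_sq_le[OF D])
    also have "\<dots> \<le> (1/4)^m" using r by (simp add: fast_L2_Cauchy_subseq_def strict_mono_less_eq)
    finally show "(\<integral>x. \<bar>?D m x\<bar> \<partial>M)\<^sup>2 \<le> ((1/2)^m)\<^sup>2"
      by (simp add: power2_eq_square flip: power_mult_distrib)
  qed simp
  then have "summable (\<lambda>m. \<integral>x. \<bar>?D m x\<bar> \<partial>M)"
    by (intro summable_comparison_test[OF _ summable_geometric[of "1/2::real"]]) auto
  then have "AE x in M. summable (\<lambda>m. ?D m x)"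
    by (intro AE_summable_of_summable_integral_abs sq_integrable_imp_integrable D)
  then show ?thesis
  proof eventually_elim
    case (elim x)
    then have "convergent (\<lambda>n. (\<Sum>m<n. ?D m x) + F (r 0) x)"
      by (intro convergent_add convergent_const) (simp add: summable_iff_convergent)
    then show ?case by (simp add: sum_lessThan_telescope[of "\<lambda>m. F (r m) x"])
  qed
qed

lemma L2_Fatou:
  assumes F: "\<And>m. sq_integrable M (F m)" and f: "f \<in> borel_measurable M" and g: "sq_integrable M g"
    and lim: "AE x in M. (\<lambda>m. F m x) \<longlonglongrightarrow> f x"
    and sq_norm_le: "eventually (\<lambda>m. sq_norm M (\<lambda>x. F m x - g x) \<le> C) sequentially"
  shows "sq_integrable M f" and "sq_norm M (\<lambda>x. f x - g x) \<le> C"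
proof -
  note [measurable] = sq_integrable_measurable[OF F] sq_integrable_measurable[OF g] f
  have "(\<integral>\<^sup>+x. ennreal ((f x - g x)\<^sup>2) \<partial>M) = (\<integral>\<^sup>+x. liminf (\<lambda>m. ennreal ((F m x - g x)\<^sup>2)) \<partial>M)"
  proof (rule nn_integral_cong_AE)
    show "AE x in M. ennreal ((f x - g x)\<^sup>2) = liminf (\<lambda>m. ennreal ((F m x - g x)\<^sup>2))"
      using lim
    proof eventually_elim
      case (elim x)
      then have "(\<lambda>m. ennreal ((F m x - g x)\<^sup>2)) \<longlonglongrightarrow> ennreal ((f x - g x)\<^sup>2)"
        by (intro tendsto_ennrealI tendsto_intros)
      then show ?case by (metis lim_imp_Liminf sequentially_bot)
    qed
  qed
  also have "\<dots> \<le> liminf (\<lambda>m. \<integral>\<^sup>+x. ennreal ((F m x - g x)\<^sup>2) \<partial>M)"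
    by (intro nn_integral_liminf) auto
  also have "\<dots> \<le> ennreal C"
  proof (intro Liminf_le)
    show "\<forall>\<^sub>F m in sequentially. (\<integral>\<^sup>+x. ennreal ((F m x - g x)\<^sup>2) \<partial>M) \<le> ennreal C"
      using sq_norm_le by eventually_elim
        (use sq_integrable_square[OF sq_integrable_diff[OF F g]] in
          \<open>subst nn_integral_eq_integral, auto intro: ennreal_leI\<close>)
  qed simp
  finally have nn_integral_le: "(\<integral>\<^sup>+x. ennreal ((f x - g x)\<^sup>2) \<partial>M) \<le> ennreal C" .
  have diff: "integrable M (\<lambda>x. (f x - g x)\<^sup>2)"
    using nn_integral_le by (intro integrableI_bounded) (auto intro: le_less_trans)
  then have "sq_integrable M (\<lambda>x. f x - g x)" by (simp add: sq_integrable_def)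
  from sq_integrable_add[OF this g] show "sq_integrable M f" by simp
  from sq_norm_le obtain m where "sq_norm M (\<lambda>x. F m x - g x) \<le> C" by (auto simp: eventually_sequentially)
  then have "0 \<le> C" by (rule order_trans[rotated]) simp
  then show "sq_norm M (\<lambda>x. f x - g x) \<le> C"
    using nn_integral_le diff by (subst (asm) nn_integral_eq_integral) auto
qed

lemma (in prob_space) L2_tendsto_lim_fast_subseq:
  assumes F: "\<And>k. sq_integrable M (F k)" and r: "fast_L2_Cauchy_subseq M F r"
  shows "L2_tendsto M F (\<lambda>x. lim (\<lambda>m. F (r m) x))"
proof -
  let ?f = "\<lambda>x. lim (\<lambda>m. F (r m) x)"
  note [measurable] = sq_integrable_measurable[OF F]
  have mono: "r m \<le> r n \<longleftrightarrow> m \<le> n" for m n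
    using r by (simp add: fast_L2_Cauchy_subseq_def strict_mono_less_eq)
  have fast: "sq_norm M (\<lambda>x. F k x - F (r m) x) \<le> (1/4)^m" if "k \<ge> r m" for k m
    using r that by (simp add: fast_L2_Cauchy_subseq_def)
  have f: "?f \<in> borel_measurable M" by measurable
  have lim: "AE x in M. (\<lambda>m. F (r m) x) \<longlonglongrightarrow> ?f x"
    using fast_L2_Cauchy_subseq_AE_convergent[OF F r] by eventually_elim (simp add: convergent_LIMSEQ_iff)
  have near: "\<forall>\<^sub>F m in sequentially. sq_norm M (\<lambda>x. F (r m) x - F k x) \<le> 4 * (1/4)^p" if "k \<ge> r p" for k p
  proof (rule eventually_sequentiallyI)
    fix m assume "p \<le> m"
    then show "sq_norm M (\<lambda>x. F (r m) x - F k x) \<le> 4 * (1/4)^p"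
      using sq_norm_diff_triangle[OF F[of "r m"] F[of "r p"] F[of k]] fast[OF that] fast[of p "r m"] mono[of p m]
      by (simp add: power2_commute[of "F k x" "F (r p) x" for x])
  qed
  show ?thesis
    unfolding L2_tendsto_def
  proof (intro conjI allI F)
    show "sq_integrable M ?f" by (rule L2_Fatou(1)[OF F f F lim near[OF order_refl]])
    show "(\<lambda>k. sq_norm M (\<lambda>x. F k x - ?f x)) \<longlonglongrightarrow> 0"
    proof (rule LIMSEQ_I)
      fix e :: real assume "0 < e"
      then obtain p where p: "(1/4::real)^p < e / 4" using real_arch_pow_inv[of "e/4" "1/4"] by auto
      have "norm (sq_norm M (\<lambda>x. F k x - ?f x) - 0) < e" if "k \<ge> r p" for k
        using L2_Fatou(2)[OF F f F lim near[OF that]] p by (simp add: power2_commute[of "F k _"])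
      then show "\<exists>N. \<forall>k\<ge>N. norm (sq_norm M (\<lambda>x. F k x - ?f x) - 0) < e" by blast
    qed
  qed
qed

lemma (in prob_space) L2_complete:
  assumes F: "L2_Cauchy M F"
  obtains f where "L2_tendsto M F f"
proof -
  obtain r where "fast_L2_Cauchy_subseq M F r" using L2_Cauchy_fast_subseq[OF F] .
  with F show thesis by (intro that[OF L2_tendsto_lim_fast_subseq]) (auto simp: L2_Cauchy_def)
qed

subsection \<open>Orthogonal families\<close>

definition orthogonal_family :: "'a measure \<Rightarrow> 'i set \<Rightarrow> ('i \<Rightarrow> 'a \<Rightarrow> real) \<Rightarrow> ('i \<Rightarrow> real) \<Rightarrow> bool" where
  "orthogonal_family M I e w \<longleftrightarrow> (\<forall>i\<in>I. sq_integrable M (e i)) \<and>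
     (\<forall>i\<in>I. \<forall>j\<in>I. sq_inner M (e i) (e j) = (if i = j then w i else 0))"

lemma orthogonal_familyD:
  assumes "orthogonal_family M I e w"
  shows "i \<in> I \<Longrightarrow> sq_integrable M (e i)"
    "i \<in> I \<Longrightarrow> j \<in> I \<Longrightarrow> sq_inner M (e i) (e j) = (if i = j then w i else 0)"
  using assms by (auto simp: orthogonal_family_def)

lemma orthogonal_family_subset: "orthogonal_family M I e w \<Longrightarrow> J \<subseteq> I \<Longrightarrow> orthogonal_family M J e w"
  unfolding orthogonal_family_def by blast

lemma sq_inner_sum_left:
  assumes "\<And>i. i \<in> I \<Longrightarrow> sq_integrable M (e i)" "sq_integrable M g"
  shows "sq_inner M (\<lambda>x. \<Sum>i\<in>I. a i * e i x) g = (\<Sum>i\<in>I. a i * sq_inner M (e i) g)"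
proof -
  have "sq_inner M (\<lambda>x. \<Sum>i\<in>I. a i * e i x) g = (\<integral>x. (\<Sum>i\<in>I. a i * (e i x * g x)) \<partial>M)"
    by (simp add: sum_distrib_right mult.assoc)
  also have "\<dots> = (\<Sum>i\<in>I. a i * sq_inner M (e i) g)"
    using sq_integrable_mult[OF assms] by (subst Bochner_Integration.integral_sum) auto
  finally show ?thesis .
qed

lemma sq_norm_sum:
  assumes e: "\<And>i. i \<in> I \<Longrightarrow> sq_integrable M (e i)"
  shows "sq_norm M (\<lambda>x. \<Sum>i\<in>I. c i * e i x) = (\<Sum>i\<in>I. \<Sum>j\<in>I. c i * (c j * sq_inner M (e j) (e i)))"
proof -
  let ?s = "\<lambda>x. \<Sum>i\<in>I. c i * e i x"
  have "sq_norm M ?s = sq_inner M ?s ?s" by (simp add: power2_eq_square)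
  also have "\<dots> = (\<Sum>i\<in>I. c i * sq_inner M (e i) ?s)"
    by (intro sq_inner_sum_left sq_integrable_sum sq_integrable_cmult e)
  also have "\<dots> = (\<Sum>i\<in>I. c i * sq_inner M ?s (e i))" by (simp only: mult.commute[of "e _ _"])
  also have "\<dots> = (\<Sum>i\<in>I. \<Sum>j\<in>I. c i * (c j * sq_inner M (e j) (e i)))"
    by (intro sum.cong refl) (simp only: sq_inner_sum_left[OF e e] sum_distrib_left)
  finally show ?thesis .
qed

lemma sq_inner_orthogonal_sum:
  assumes I: "finite I" and e: "orthogonal_family M I e w" and j: "j \<in> I"
  shows "sq_inner M (\<lambda>x. \<Sum>i\<in>I. a i * e i x) (e j) = w j * a j"
proof -
  have "sq_inner M (\<lambda>x. \<Sum>i\<in>I. a i * e i x) (e j) = (\<Sum>i\<in>I. a i * sq_inner M (e i) (e j))"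
    by (intro sq_inner_sum_left orthogonal_familyD(1)[OF e] j)
  also have "\<dots> = (\<Sum>i\<in>I. if i = j then w j * a j else 0)"
    using j by (intro sum.cong refl) (auto simp: orthogonal_familyD(2)[OF e])
  finally show ?thesis using I j by simp
qed

lemma sq_norm_orthogonal_sum:
  assumes I: "finite I" and e: "orthogonal_family M I e w"
  shows "sq_norm M (\<lambda>x. \<Sum>i\<in>I. a i * e i x) = (\<Sum>i\<in>I. w i * (a i)\<^sup>2)"
proof -
  have "sq_norm M (\<lambda>x. \<Sum>i\<in>I. a i * e i x) = (\<Sum>i\<in>I. \<Sum>j\<in>I. a i * (a j * sq_inner M (e j) (e i)))"
    by (intro sq_norm_sum orthogonal_familyD(1)[OF e])
  also have "\<dots> = (\<Sum>i\<in>I. \<Sum>j\<in>I. if j = i then w i * (a i)\<^sup>2 else 0)"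
    by (intro sum.cong refl) (auto simp: orthogonal_familyD(2)[OF e] power2_eq_square)
  finally show ?thesis using I by simp
qed

lemma sq_norm_diff_orthogonal_sum:
  assumes I: "finite I" and f: "sq_integrable M f" and e: "orthogonal_family M I e w"
  shows "sq_norm M (\<lambda>x. f x - (\<Sum>i\<in>I. a i * e i x)) =
    sq_norm M f - 2 * (\<Sum>i\<in>I. a i * sq_inner M (e i) f) + (\<Sum>i\<in>I. w i * (a i)\<^sup>2)"
proof -
  let ?s = "\<lambda>x. \<Sum>i\<in>I. a i * e i x"
  have s: "sq_integrable M ?s" by (intro sq_integrable_sum sq_integrable_cmult orthogonal_familyD(1)[OF e])
  have "sq_norm M (\<lambda>x. f x - ?s x) = sq_norm M f - 2 * sq_inner M ?s f + sq_norm M ?s"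
    using sq_integrable_square[OF f] sq_integrable_square[OF s] sq_integrable_mult[OF s f]
    by (simp add: power2_diff mult.assoc mult.commute[of "f _"])
  also have "sq_inner M ?s f = (\<Sum>i\<in>I. a i * sq_inner M (e i) f)"
    by (intro sq_inner_sum_left orthogonal_familyD(1)[OF e] f)
  finally show ?thesis by (simp only: sq_norm_orthogonal_sum[OF I e])
qed

text \<open>Members of norm 0 are covered because \<open>x / 0 = 0\<close>.\<close>

lemma Bessel_inequality:
  assumes I: "finite I" and f: "sq_integrable M f" and e: "orthogonal_family M I e w"
  shows "(\<Sum>i\<in>I. (sq_inner M (e i) f)\<^sup>2 / w i) \<le> sq_norm M f"
proof -
  let ?a = "\<lambda>i. sq_inner M (e i) f / w i"
  have "0 \<le> sq_norm M (\<lambda>x. f x - (\<Sum>i\<in>I. ?a i * e i x))" by simp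
  also have "\<dots> = sq_norm M f - 2 * (\<Sum>i\<in>I. ?a i * sq_inner M (e i) f) + (\<Sum>i\<in>I. w i * (?a i)\<^sup>2)"
    by (rule sq_norm_diff_orthogonal_sum[OF I f e])
  also have "(\<Sum>i\<in>I. ?a i * sq_inner M (e i) f) = (\<Sum>i\<in>I. (sq_inner M (e i) f)\<^sup>2 / w i)"
    by (simp add: power2_eq_square)
  also have "(\<Sum>i\<in>I. w i * (?a i)\<^sup>2) = (\<Sum>i\<in>I. (sq_inner M (e i) f)\<^sup>2 / w i)"
    by (intro sum.cong refl) (simp add: power2_eq_square)
  finally show ?thesis by simp
qed

lemma orthogonal_projection_minimal:
  assumes I: "finite I" and f: "sq_integrable M f" and e: "orthogonal_family M I e w" and w: "\<And>i. i \<in> I \<Longrightarrow> w i > 0"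
  shows "sq_norm M (\<lambda>x. f x - (\<Sum>i\<in>I. sq_inner M (e i) f / w i * e i x)) \<le> sq_norm M (\<lambda>x. f x - (\<Sum>i\<in>I. a i * e i x))"
proof -
  let ?c = "\<lambda>i. sq_inner M (e i) f"
  let ?b = "\<lambda>i. ?c i / w i"
  have "sq_norm M (\<lambda>x. f x - (\<Sum>i\<in>I. a i * e i x)) - sq_norm M (\<lambda>x. f x - (\<Sum>i\<in>I. ?b i * e i x))
     = (\<Sum>i\<in>I. w i * (a i)\<^sup>2 - 2 * (a i * ?c i) - (w i * (?b i)\<^sup>2 - 2 * (?b i * ?c i)))"
    unfolding sq_norm_diff_orthogonal_sum[OF I f e] by (simp add: sum_subtractf sum_distrib_left)
  also have "\<dots> = (\<Sum>i\<in>I. w i * (a i - ?b i)\<^sup>2)"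
    by (intro sum.cong refl, drule w) (auto simp: power2_eq_square field_simps)
  also have "\<dots> \<ge> 0" using w by (intro sum_nonneg mult_nonneg_nonneg) (auto intro: less_imp_le)
  finally show ?thesis by simp
qed

lemma L2_Cauchy_orthonormal_sums:
  fixes e :: "nat \<Rightarrow> 'a \<Rightarrow> real"
  assumes e: "orthogonal_family M {1..} e (\<lambda>_. 1)" and c: "summable (\<lambda>j. (c (Suc j))\<^sup>2)"
  shows "L2_Cauchy M (\<lambda>d x. \<Sum>j=1..d. c j * e j x)"
proof -
  define S where "S d x = (\<Sum>j=1..d. c j * e j x)" for d :: nat and x
  have S_diff: "sq_norm M (\<lambda>x. S k x - S l x) = (\<Sum>j=l..<k. (c (Suc j))\<^sup>2)" if "l \<le> k" for k l
  proof -
    have split: "{1..k} = {1..l} \<union> {Suc l..k}" using that by auto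
    have "S k x - S l x = (\<Sum>j=Suc l..k. c j * e j x)" for x
      unfolding S_def split by (subst sum.union_disjoint) auto
    then have "sq_norm M (\<lambda>x. S k x - S l x) = (\<Sum>j=Suc l..k. (c j)\<^sup>2)"
      using sq_norm_orthogonal_sum[OF _ orthogonal_family_subset[OF e], of "{Suc l..k}" c] by auto
    then show ?thesis
      unfolding atLeastLessThanSuc_atLeastAtMost[symmetric] by (simp only: sum.shift_bounds_Suc_ivl)
  qed
  have "\<exists>N. \<forall>k\<ge>N. \<forall>l\<ge>N. sq_norm M (\<lambda>x. S k x - S l x) < \<epsilon>" if "\<epsilon> > 0" for \<epsilon>
  proof -
    obtain N where N: "\<And>m n. m \<ge> N \<Longrightarrow> norm (\<Sum>j=m..<n. (c (Suc j))\<^sup>2) < \<epsilon>"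
      using c \<open>\<epsilon> > 0\<close> unfolding summable_Cauchy by blast
    have ordered: "sq_norm M (\<lambda>x. S k x - S l x) < \<epsilon>" if "l \<le> k" "N \<le> l" for k l
      using N[OF that(2), of k] by (simp add: S_diff[OF that(1)])
    have "sq_norm M (\<lambda>x. S k x - S l x) < \<epsilon>" if "N \<le> k" "N \<le> l" for k l
      using that ordered[of l k] ordered[of k l]
      unfolding power2_commute[of "S l x" "S k x" for x] by (cases "l \<le> k") auto
    then show ?thesis by blast
  qed
  moreover have "sq_integrable M (S d)" for d
    unfolding S_def by (intro sq_integrable_sum sq_integrable_cmult orthogonal_familyD(1)[OF e]) auto
  ultimately have "L2_Cauchy M S" by (simp add: L2_Cauchy_def)
  then show ?thesis by (simp add: S_def[abs_def])
qed

text \<open>By completeness the Fourier series has a limit; it has the coefficients of \<open>h\<close> and hence equals \<open>h\<close>.\<close>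

lemma (in prob_space) L2_tendsto_Fourier_series:
  fixes e :: "nat \<Rightarrow> 'a \<Rightarrow> real"
  assumes e: "orthogonal_family M {1..} e (\<lambda>_. 1)" and h: "sq_integrable M h"
    and total: "\<And>g. sq_integrable M g \<Longrightarrow> (\<And>j. j \<ge> 1 \<Longrightarrow> sq_inner M (e j) g = 0) \<Longrightarrow> sq_norm M g = 0"
  shows "L2_tendsto M (\<lambda>d x. \<Sum>j=1..d. sq_inner M (e j) h * e j x) h"
proof -
  define c where "c j = sq_inner M (e j) h" for j
  define S where "S d x = (\<Sum>j=1..d. c j * e j x)" for d :: nat and x
  have orth: "orthogonal_family M {1..d} e (\<lambda>_. 1)" for d by (rule orthogonal_family_subset[OF e]) auto
  have e_sq: "sq_integrable M (e j)" if "j \<ge> 1" for j using orthogonal_familyD(1)[OF e] that by simp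
  have "summable (\<lambda>j. (c (Suc j))\<^sup>2)"
  proof (rule summableI_nonneg_bounded)
    show "(\<Sum>j<d. (c (Suc j))\<^sup>2) \<le> sq_norm M h" for d
      using Bessel_inequality[OF _ h orth, of d] by (simp add: c_def sum.atLeast1_atMost_eq)
  qed simp
  then have "L2_Cauchy M S"
    unfolding S_def[abs_def] by (rule L2_Cauchy_orthonormal_sums[OF e])
  then obtain s where s: "L2_tendsto M S s" by (rule L2_complete)
  note S_sq = L2_tendstoD(1)[OF s] and s_sq = L2_tendstoD(2)[OF s]
  note [measurable] = S_sq[THEN sq_integrable_measurable] s_sq[THEN sq_integrable_measurable] h[THEN sq_integrable_measurable]
  have "sq_norm M (\<lambda>x. h x - s x) = 0"
  proof (rule total)
    fix j :: nat assume j: "j \<ge> 1"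
    have "(\<lambda>d. sq_inner M (S d) (e j)) \<longlonglongrightarrow> c j"
    proof (rule tendsto_eventually, rule eventually_sequentiallyI)
      show "sq_inner M (S d) (e j) = c j" if "j \<le> d" for d
        unfolding S_def using sq_inner_orthogonal_sum[OF _ orth, of d j c] that j by simp
    qed
    then have "sq_inner M s (e j) = c j" using LIMSEQ_unique L2_tendsto_inner[OF s e_sq[OF j]] by blast
    then show "sq_inner M (e j) (\<lambda>x. h x - s x) = 0"
      using sq_integrable_mult[OF e_sq[OF j] h] sq_integrable_mult[OF e_sq[OF j] s_sq]
      by (simp add: right_diff_distrib c_def mult.commute)
  qed (intro sq_integrable_diff h s_sq)
  then have "AE x in M. h x - s x = 0"
    by (intro sq_norm_eq_0_AE sq_integrable_diff h s_sq)
  then have "sq_norm M (\<lambda>x. S d x - h x) = sq_norm M (\<lambda>x. S d x - s x)" for d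
    by (intro integral_cong_AE) auto
  then have "L2_tendsto M S h" using s h by (simp add: L2_tendsto_def)
  then show ?thesis by (simp add: S_def[abs_def] c_def)
qed

lemma (in prob_space) Parseval_identity:
  fixes e :: "nat \<Rightarrow> 'a \<Rightarrow> real"
  assumes e: "orthogonal_family M {1..} e (\<lambda>_. 1)" and h: "sq_integrable M h"
    and total: "\<And>g. sq_integrable M g \<Longrightarrow> (\<And>j. j \<ge> 1 \<Longrightarrow> sq_inner M (e j) g = 0) \<Longrightarrow> sq_norm M g = 0"
  shows "(\<lambda>d. \<Sum>j=1..d. (sq_inner M (e j) h)\<^sup>2) \<longlonglongrightarrow> sq_norm M h"
  using L2_tendsto_sq_norm[OF L2_tendsto_Fourier_series[OF e h total]]
  by (simp add: sq_norm_orthogonal_sum[OF _ orthogonal_family_subset[OF e]])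

section \<open>Dyadic projections on the unit interval\<close>

definition unit_leb :: "real measure" where
  "unit_leb = density lborel (\<lambda>x. ennreal (indicat_real {0..1} x))"

lemma sets_unit_leb [measurable_cong, simp]: "sets unit_leb = sets borel"
  by (simp add: unit_leb_def)

lemma space_unit_leb [simp]: "space unit_leb = UNIV"
  by (simp add: unit_leb_def)

interpretation unit_leb: prob_space unit_leb
proof
  have "emeasure unit_leb (space unit_leb) = (\<integral>\<^sup>+x. ennreal (indicat_real {0..1::real} x) \<partial>lborel)"
    by (simp add: unit_leb_def emeasure_density)
  also have "\<dots> = emeasure lborel {0..1::real}"
    by (subst nn_integral_indicator[symmetric]) (auto simp: ennreal_indicator)
  finally show "emeasure unit_leb (space unit_leb) = 1" by simp
qed

lemma measurable_unit_leb: "borel_measurable unit_leb = borel_measurable borel"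
  by (rule measurable_cong_sets) auto

lemma sq_integrable_unit_leb_borel: "sq_integrable unit_leb h \<Longrightarrow> h \<in> borel_measurable borel"
  by (simp add: sq_integrable_def measurable_unit_leb)

lemma integral_unit_leb:
  "f \<in> borel_measurable borel \<Longrightarrow> (\<integral>x. f x \<partial>unit_leb) = (LINT t:{0..1}|lborel. f t)" for f :: "real \<Rightarrow> real"
  unfolding unit_leb_def set_lebesgue_integral_def by (subst integral_density) auto

lemma integrable_unit_leb:
  "f \<in> borel_measurable borel \<Longrightarrow> integrable unit_leb f \<longleftrightarrow> set_integrable lborel {0..1} f" for f :: "real \<Rightarrow> real"
  unfolding unit_leb_def set_integrable_def by (subst integrable_density) auto

lemma L2_01_iff: "h \<in> L2_01 \<longleftrightarrow> sq_integrable unit_leb h"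
  by (auto simp: L2_01_def sq_integrable_def measurable_unit_leb integrable_unit_leb)

lemma l2_inner_eq:
  "sq_integrable unit_leb f \<Longrightarrow> sq_integrable unit_leb g \<Longrightarrow> l2_inner f g = sq_inner unit_leb f g"
  unfolding l2_inner_def
  by (intro integral_unit_leb[symmetric] borel_measurable_times sq_integrable_unit_leb_borel)

lemma l2_norm_eq: "sq_integrable unit_leb h \<Longrightarrow> l2_norm h = sqrt (sq_norm unit_leb h)"
  by (simp add: l2_norm_def l2_inner_eq power2_eq_square)

lemma AE_unit_leb: "(AE x in lborel. P x) \<Longrightarrow> (AE x in unit_leb. P x)"
  unfolding unit_leb_def by (subst AE_density) (auto elim: eventually_mono)

lemma AE_unit_leb_mem: "AE x in unit_leb. 0 \<le> x \<and> x < 1"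
proof -
  have "AE x in lborel. x \<noteq> (1::real)" by (rule AE_lborel_singleton)
  then have "AE x in lborel. 0 < ennreal (indicat_real {0..1} x) \<longrightarrow> 0 \<le> x \<and> x < (1::real)"
    by eventually_elim (auto simp: indicator_def split: if_splits)
  then show ?thesis unfolding unit_leb_def by (subst AE_density) auto
qed

subsection \<open>Indicators of intervals and the drift\<close>

lemma sq_integrable_indicator_Ico: "sq_integrable unit_leb (indicat_real {a..<b::real})"
  by (rule unit_leb.sq_integrable_bounded[where K=1]) (auto simp: indicator_def)

lemma set_integral_Icc_eq:
  fixes h :: "real \<Rightarrow> real"
  assumes h: "h \<in> borel_measurable borel" and ab: "0 \<le> a" "b \<le> 1"
  shows "(LINT u:{a..b}|lborel. h u) = sq_inner unit_leb (indicat_real {a..<b}) h"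
proof -
  have "sq_inner unit_leb (indicat_real {a..<b}) h = (LINT t:{0..1}|lborel. indicat_real {a..<b} t * h t)"
    using h by (intro integral_unit_leb) auto
  also have "\<dots> = (LINT u:{a..b}|lborel. h u)"
    unfolding set_lebesgue_integral_def
  proof (rule integral_cong_AE)
    have "AE x in lborel. x \<noteq> b" by (rule AE_lborel_singleton)
    then show "AE x in lborel. indicat_real {0..1} x *\<^sub>R (indicat_real {a..<b} x * h x) = indicat_real {a..b} x *\<^sub>R h x"
      by eventually_elim (use ab in \<open>auto simp: indicator_def\<close>)
  qed (use h in auto)
  finally show ?thesis ..
qed

lemma sq_inner_indicator_Ico:
  assumes "0 \<le> a" "a \<le> b" "b \<le> 1" "0 \<le> c" "c \<le> d" "d \<le> 1"
  shows "sq_inner unit_leb (indicat_real {a..<b}) (indicat_real {c..<d}) = max 0 (min b d - max a c)"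
proof -
  have "sq_inner unit_leb (indicat_real {a..<b}) (indicat_real {c..<d}) =
      (LINT t:{0..1}|lborel. indicat_real {a..<b} t * indicat_real {c..<d} t)"
    by (rule integral_unit_leb) auto
  also have "\<dots> = (\<integral>x. indicat_real {max a c..<min b d} x \<partial>lborel)"
    unfolding set_lebesgue_integral_def using assms
    by (intro Bochner_Integration.integral_cong) (auto simp: indicator_def)
  also have "\<dots> = measure lborel {max a c..<min b d}" by simp
  also have "\<dots> = max 0 (min b d - max a c)"
    by (cases "max a c \<le> min b d") (subst measure_lborel_Ico, auto simp: max_def min_def split: if_splits)
  finally show ?thesis .
qed

definition unit_grid :: "nat \<Rightarrow> (nat \<Rightarrow> real) \<Rightarrow> bool" where
  "unit_grid K t \<longleftrightarrow> 0 \<le> t 0 \<and> t K \<le> 1 \<and> (\<forall>i<K. t i < t (Suc i))"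

lemma unit_grid_mono:
  assumes "unit_grid K t" "i \<le> j" "j \<le> K"
  shows "t i \<le> t j"
  using assms(2,3) by (induction j rule: dec_induct)
    (use assms(1) in \<open>auto simp: unit_grid_def Suc_le_eq intro: order_trans less_imp_le\<close>)

lemma unit_grid_mem: "unit_grid K t \<Longrightarrow> i \<le> K \<Longrightarrow> t i \<in> {0..1}"
  using unit_grid_mono[of K t 0 i] unit_grid_mono[of K t i K] by (auto simp: unit_grid_def)

lemma orthogonal_family_grid:
  assumes t: "unit_grid K t"
  shows "orthogonal_family unit_leb {..<K} (\<lambda>i. indicat_real {t i..<t (Suc i)}) (\<lambda>i. t (Suc i) - t i)"
  unfolding orthogonal_family_def
proof (intro conjI ballI sq_integrable_indicator_Ico)
  fix i j assume ij: "i \<in> {..<K}" "j \<in> {..<K}"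
  have "sq_inner unit_leb (indicat_real {t i..<t (Suc i)}) (indicat_real {t j..<t (Suc j)}) =
      max 0 (min (t (Suc i)) (t (Suc j)) - max (t i) (t j))"
    using ij unit_grid_mem[OF t] unit_grid_mono[OF t] by (intro sq_inner_indicator_Ico) auto
  also have "\<dots> = (if i = j then t (Suc i) - t i else 0)"
    using unit_grid_mono[OF t, of i "Suc i"] unit_grid_mono[OF t, of j "Suc j"]
      unit_grid_mono[OF t, of "Suc i" j] unit_grid_mono[OF t, of "Suc j" i] ij
    by (cases i j rule: linorder_cases) auto
  finally show "sq_inner unit_leb (indicat_real {t i..<t (Suc i)}) (indicat_real {t j..<t (Suc j)}) =
      (if i = j then t (Suc i) - t i else 0)" .
qed

lemma drift_increment:
  assumes h: "sq_integrable unit_leb h" and ab: "0 \<le> a" "a \<le> b" "b \<le> 1"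
  shows "drift h b - drift h a = sq_inner unit_leb (indicat_real {a..<b}) h"
proof -
  note int = sq_integrable_mult[OF sq_integrable_indicator_Ico h]
  have "drift h b - drift h a = (\<integral>x. indicat_real {0..<b} x * h x - indicat_real {0..<a} x * h x \<partial>unit_leb)"
    unfolding drift_def using ab int by (simp add: set_integral_Icc_eq sq_integrable_unit_leb_borel[OF h])
  also have "(\<lambda>x. indicat_real {0..<b} x * h x - indicat_real {0..<a} x * h x) = (\<lambda>x. indicat_real {a..<b} x * h x)"
    using ab by (auto simp: indicator_def fun_eq_iff)
  finally show ?thesis .
qed

lemma drift_0: "sq_integrable unit_leb h \<Longrightarrow> drift h 0 = 0"
  unfolding drift_def by (subst set_integral_Icc_eq) (auto simp: sq_integrable_unit_leb_borel)

lemma drift_minus: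
  assumes f: "sq_integrable unit_leb f" and g: "sq_integrable unit_leb g" and "0 \<le> t" "t \<le> 1"
  shows "drift (\<lambda>x. f x - g x) t = drift f t - drift g t"
  unfolding drift_def
  using assms sq_integrable_mult[OF sq_integrable_indicator_Ico f] sq_integrable_mult[OF sq_integrable_indicator_Ico g]
  by (simp add: set_integral_Icc_eq right_diff_distrib sq_integrable_unit_leb_borel borel_measurable_diff)

lemma sum_sq_drift_increments_le:
  assumes h: "sq_integrable unit_leb h" and t: "unit_grid K t"
  shows "(\<Sum>i<K. (drift h (t (Suc i)) - drift h (t i))\<^sup>2 / (t (Suc i) - t i)) \<le> sq_norm unit_leb h"
proof -
  have "drift h (t (Suc i)) - drift h (t i) = sq_inner unit_leb (indicat_real {t i..<t (Suc i)}) h" if "i < K" for i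
    using unit_grid_mem[OF t, of i] unit_grid_mem[OF t, of "Suc i"] unit_grid_mono[OF t, of i "Suc i"] that
    by (intro drift_increment h) auto
  then show ?thesis using Bessel_inequality[OF _ h orthogonal_family_grid[OF t]] by simp
qed

subsection \<open>Dyadic step functions\<close>

definition dyadic_interval :: "nat \<Rightarrow> nat \<Rightarrow> real set" where
  "dyadic_interval k m = {real m / 2^k..<real (Suc m) / 2^k}"

definition dyadic_combination :: "(nat \<Rightarrow> real) \<Rightarrow> nat \<Rightarrow> real \<Rightarrow> real" where
  "dyadic_combination a k x = (\<Sum>m<2^k. a m * indicat_real (dyadic_interval k m) x)"

definition dyadic_step :: "(real \<Rightarrow> real) \<Rightarrow> nat \<Rightarrow> real \<Rightarrow> real" where
  "dyadic_step \<phi> k = dyadic_combination (dyadic_coef \<phi> k) k"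

lemma unit_grid_dyadic: "unit_grid (2^k) (\<lambda>m. real m / 2^k)"
  by (auto simp: unit_grid_def divide_strict_right_mono)

lemma dyadic_mem:
  assumes "m < 2^k"
  shows "real m / 2^k \<in> {0..1}" "real (Suc m) / 2^k \<in> {0..1}"
  using unit_grid_mem[OF unit_grid_dyadic, of m k] unit_grid_mem[OF unit_grid_dyadic, of "Suc m" k] assms by auto

lemma dyadic_endpoints:
  "m < 2^k \<Longrightarrow> 0 \<le> real m / 2^k \<and> real m / 2^k \<le> real (Suc m) / 2^k \<and> real (Suc m) / 2^k \<le> 1"
  using dyadic_mem(2)[of m k] by (auto simp: divide_right_mono simp del: of_nat_Suc)

lemma orthogonal_family_dyadic:
  "orthogonal_family unit_leb {..<2^k} (\<lambda>m. indicat_real (dyadic_interval k m)) (\<lambda>_. 1 / 2^k)"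
  using orthogonal_family_grid[OF unit_grid_dyadic, of k]
  by (simp add: dyadic_interval_def diff_divide_distrib[symmetric])

lemma sq_integrable_dyadic_combination:
  "sq_integrable unit_leb (dyadic_combination a k)"
  unfolding dyadic_combination_def[abs_def] dyadic_interval_def
  by (intro sq_integrable_sum sq_integrable_cmult sq_integrable_indicator_Ico)

lemma sq_integrable_dyadic_step: "sq_integrable unit_leb (dyadic_step \<phi> k)"
  unfolding dyadic_step_def by (rule sq_integrable_dyadic_combination)

lemma sq_norm_dyadic_step: "sq_norm unit_leb (dyadic_step \<phi> k) = (\<Sum>m<2^k. (dyadic_coef \<phi> k m)\<^sup>2 / 2^k)"
  using sq_norm_orthogonal_sum[OF finite_lessThan orthogonal_family_dyadic, of "dyadic_coef \<phi> k" k]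
  by (simp only: dyadic_step_def dyadic_combination_def[abs_def] times_divide_eq_left mult_1_left)

lemma dyadic_coef_eq:
  assumes "sq_integrable unit_leb \<phi>" "m < 2^k"
  shows "dyadic_coef \<phi> k m = sq_inner unit_leb (indicat_real (dyadic_interval k m)) \<phi> / (1 / 2^k)"
  unfolding dyadic_coef_def dyadic_interval_def using dyadic_endpoints[OF assms(2)]
  by (subst set_integral_Icc_eq) (auto simp: sq_integrable_unit_leb_borel[OF assms(1)])

lemma dyadic_step_minimal:
  assumes \<phi>: "sq_integrable unit_leb \<phi>"
  shows "sq_norm unit_leb (\<lambda>x. \<phi> x - dyadic_step \<phi> k x) \<le>
    sq_norm unit_leb (\<lambda>x. \<phi> x - dyadic_combination a k x)"
proof -
  have "dyadic_step \<phi> k x = (\<Sum>m<2^k. sq_inner unit_leb (indicat_real (dyadic_interval k m)) \<phi> / (1 / 2^k)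
      * indicat_real (dyadic_interval k m) x)" for x
    unfolding dyadic_step_def dyadic_combination_def
    by (intro sum.cong refl arg_cong2[where f="(*)"] dyadic_coef_eq[OF \<phi>]) simp
  then show ?thesis
    using orthogonal_projection_minimal[OF finite_lessThan \<phi> orthogonal_family_dyadic, where a=a]
    by (simp add: dyadic_combination_def del: sum_mult_indicator)
qed

lemma dyadic_combination_floor:
  fixes x :: real
  assumes "0 \<le> x" "x < 1"
  shows "dyadic_combination a k x = a (nat \<lfloor>2^k * x\<rfloor>)"
proof -
  have "indicat_real (dyadic_interval k m) x = (if m = nat \<lfloor>2^k * x\<rfloor> then 1 else 0)" for m
  proof -
    have "x \<in> dyadic_interval k m \<longleftrightarrow> real m \<le> 2^k * x \<and> 2^k * x < real m + 1"
      by (auto simp: dyadic_interval_def field_simps)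
    also have "\<dots> \<longleftrightarrow> \<lfloor>2^k * x\<rfloor> = int m" by (subst floor_eq_iff) auto
    also have "\<dots> \<longleftrightarrow> m = nat \<lfloor>2^k * x\<rfloor>" using assms by auto
    finally show ?thesis by (simp add: indicator_def)
  qed
  moreover have "nat \<lfloor>2^k * x\<rfloor> < 2^k" using assms by (simp add: nat_less_iff floor_less_iff)
  ultimately show ?thesis by (simp add: dyadic_combination_def if_distrib[of "\<lambda>y. _ * y"] cong: if_cong)
qed

lemma dyadic_floor_tendsto: "(\<lambda>k. of_int \<lfloor>2^k * x\<rfloor> / 2^k) \<longlonglongrightarrow> x" for x :: real
proof (rule LIM_zero_cancel, rule Lim_null_comparison)
  show "(\<lambda>k. (1/2)^k :: real) \<longlonglongrightarrow> 0" by (intro LIMSEQ_power_zero) simp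
  have "\<bar>of_int \<lfloor>2^k * x\<rfloor> / 2^k - x\<bar> = \<bar>of_int \<lfloor>2^k * x\<rfloor> - 2^k * x\<bar> * (1/2)^k" for k
    by (simp add: field_simps abs_divide flip: abs_mult)
  also have "\<dots> k \<le> 1 * (1/2)^k" for k by (intro mult_right_mono) (auto, linarith+)
  finally show "\<forall>\<^sub>F k in sequentially. norm (of_int \<lfloor>2^k * x\<rfloor> / 2^k - x) \<le> (1/2)^k"
    by simp
qed

lemma L2_tendsto_dyadic_sampling:
  assumes g: "continuous_on UNIV g" and bound: "\<And>x. \<bar>g x\<bar> \<le> K"
  shows "L2_tendsto unit_leb (\<lambda>k. dyadic_combination (\<lambda>m. g (real m / 2^k)) k) g"
    (is "L2_tendsto _ ?q _")
proof -
  have q: "?q k x = g (of_int \<lfloor>2^k * x\<rfloor> / 2^k)" if "0 \<le> x" "x < 1" for k x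
    using dyadic_combination_floor[OF that, of "\<lambda>m. g (real m / 2^k)" k] that by simp
  show ?thesis
  proof (rule L2_tendsto_dominated[where b="\<lambda>_. 2 * K"])
    show "sq_integrable unit_leb g"
      using g by (intro unit_leb.sq_integrable_bounded[OF _ bound]) (simp add: measurable_unit_leb borel_measurable_continuous_onI)
    show "AE x in unit_leb. (\<lambda>k. ?q k x) \<longlonglongrightarrow> g x"
      using AE_unit_leb_mem
    proof eventually_elim
      case (elim x)
      have "(\<lambda>k. g (of_int \<lfloor>2^k * x\<rfloor> / 2^k)) \<longlonglongrightarrow> g x"
        using g by (intro isCont_tendsto_compose[of x g] dyadic_floor_tendsto) (auto simp: continuous_on_eq_continuous_at)
      then show ?case using elim by (simp add: q)
    qed
    show "AE x in unit_leb. \<bar>?q k x - g x\<bar> \<le> 2 * K" for k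
      using AE_unit_leb_mem
    proof eventually_elim
      case (elim x)
      then show ?case using bound[of x] bound[of "of_int \<lfloor>2^k * x\<rfloor> / 2^k"] by (simp add: q)
    qed
  qed (rule sq_integrable_dyadic_combination unit_leb.sq_integrable_const)+
qed

definition clamp :: "real \<Rightarrow> real \<Rightarrow> real" where
  "clamp K y = max (- K) (min K y)"

lemma clamp_measurable [measurable]: "clamp K \<in> borel_measurable borel"
  unfolding clamp_def by measurable

lemma abs_clamp_le: "0 \<le> K \<Longrightarrow> \<bar>clamp K y\<bar> \<le> K"
  by (auto simp: clamp_def)

lemma abs_clamp_le_abs: "0 \<le> K \<Longrightarrow> \<bar>clamp K y\<bar> \<le> \<bar>y\<bar>"
  by (auto simp: clamp_def)

lemma clamp_eq: "\<bar>y\<bar> \<le> K \<Longrightarrow> clamp K y = y"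
  by (auto simp: clamp_def)

lemma L2_tendsto_clamp:
  assumes \<phi>: "sq_integrable M \<phi>"
  shows "L2_tendsto M (\<lambda>n x. clamp (real n) (\<phi> x)) \<phi>"
proof (rule L2_tendsto_dominated[OF _ \<phi> sq_integrable_abs[OF \<phi>]])
  note [measurable] = sq_integrable_measurable[OF \<phi>]
  show "sq_integrable M (\<lambda>x. clamp (real n) (\<phi> x))" for n
    unfolding sq_integrable_def
  proof (intro conjI Bochner_Integration.integrable_bound[OF sq_integrable_square[OF \<phi>]])
    show "AE x in M. norm ((clamp (real n) (\<phi> x))\<^sup>2) \<le> norm ((\<phi> x)\<^sup>2)"
      by (intro AE_I2) (simp add: abs_clamp_le_abs abs_le_square_iff[symmetric])
  qed measurable
  show "AE x in M. (\<lambda>n. clamp (real n) (\<phi> x)) \<longlonglongrightarrow> \<phi> x"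
  proof (intro AE_I2 tendsto_eventually)
    fix x
    obtain N :: nat where "\<bar>\<phi> x\<bar> \<le> real N" using real_arch_simple by blast
    then show "\<forall>\<^sub>F n in sequentially. clamp (real n) (\<phi> x) = \<phi> x"
      by (intro eventually_sequentiallyI[of N] clamp_eq) simp
  qed
  show "AE x in M. \<bar>clamp (real n) (\<phi> x) - \<phi> x\<bar> \<le> \<bar>\<phi> x\<bar>" for n
    by (rule AE_I2) (auto simp: clamp_def)
qed

lemma L2_tendsto_continuous_bounded:
  assumes \<phi>: "\<phi> \<in> borel_measurable borel" and bound: "\<And>x. \<bar>\<phi> x\<bar> \<le> K"
  obtains G where "\<And>m. continuous_on UNIV (G m)" "\<And>m x. \<bar>G m x\<bar> \<le> K" "L2_tendsto unit_leb G \<phi>"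
proof -
  have K: "0 \<le> K" using bound[of 0] by linarith
  have "\<phi> measurable_on UNIV"
    using \<phi> by (intro lebesgue_measurable_imp_measurable_on measurable_completion) auto
  then obtain N G where N: "negligible N" and G: "\<And>n. continuous_on UNIV (G n)"
    and lim: "\<And>x. x \<notin> N \<Longrightarrow> (\<lambda>n. G n x) \<longlonglongrightarrow> \<phi> x"
    unfolding measurable_on_def by auto
  have "AE x in lebesgue. x \<notin> N" using N by (simp add: negligible_iff_null_sets AE_not_in)
  then have "AE x in unit_leb. x \<notin> N" by (intro AE_unit_leb) (simp add: AE_completion_iff)
  then have clamp_lim: "AE x in unit_leb. (\<lambda>m. clamp K (G m x)) \<longlonglongrightarrow> clamp K (\<phi> x)"
    unfolding clamp_def by eventually_elim (intro tendsto_intros lim)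
  have cont: "continuous_on UNIV (\<lambda>x. clamp K (G m x))" for m
    unfolding clamp_def by (intro continuous_intros G)
  have "L2_tendsto unit_leb (\<lambda>m x. clamp K (G m x)) \<phi>"
  proof (rule L2_tendsto_dominated[where b="\<lambda>_. 2 * K"])
    show "sq_integrable unit_leb (\<lambda>x. clamp K (G m x))" for m
      using cont by (intro unit_leb.sq_integrable_bounded[OF _ abs_clamp_le[OF K]])
        (simp add: measurable_unit_leb borel_measurable_continuous_onI)
    show "sq_integrable unit_leb \<phi>"
      using \<phi> by (intro unit_leb.sq_integrable_bounded[OF _ bound]) (simp add: measurable_unit_leb)
    show "AE x in unit_leb. (\<lambda>m. clamp K (G m x)) \<longlonglongrightarrow> \<phi> x"
      using clamp_lim by (simp add: clamp_eq[OF bound])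
    show "AE x in unit_leb. \<bar>clamp K (G m x) - \<phi> x\<bar> \<le> 2 * K" for m
    proof (rule AE_I2)
      show "\<bar>clamp K (G m x) - \<phi> x\<bar> \<le> 2 * K" for x
        using bound[of x] abs_clamp_le[OF K, of "G m x"] by linarith
    qed
  qed (rule unit_leb.sq_integrable_const)
  then show thesis using cont abs_clamp_le[OF K] by (intro that) auto
qed

lemma continuous_L2_approximation:
  assumes \<phi>: "sq_integrable unit_leb \<phi>" and e: "e > 0"
  obtains g K where "continuous_on UNIV g" "\<And>x. \<bar>g x\<bar> \<le> K" "sq_norm unit_leb (\<lambda>x. \<phi> x - g x) < e"
proof -
  note [measurable] = sq_integrable_unit_leb_borel[OF \<phi>]
  obtain n where n: "sq_norm unit_leb (\<lambda>x. clamp (real n) (\<phi> x) - \<phi> x) < e / 4"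
    using L2_tendsto_small[OF L2_tendsto_clamp[OF \<phi>], of "e/4"] e by auto
  obtain G where G: "\<And>m. continuous_on UNIV (G m)" "\<And>m x. \<bar>G m x\<bar> \<le> real n"
    and lim: "L2_tendsto unit_leb G (\<lambda>x. clamp (real n) (\<phi> x))"
    using L2_tendsto_continuous_bounded[of "\<lambda>x. clamp (real n) (\<phi> x)" "real n"] by (auto simp: abs_clamp_le)
  obtain m where m: "sq_norm unit_leb (\<lambda>x. G m x - clamp (real n) (\<phi> x)) < e / 4"
    using L2_tendsto_small[OF lim, of "e/4"] e by auto
  have "sq_norm unit_leb (\<lambda>x. \<phi> x - G m x) < e"
    using sq_norm_diff_triangle[OF \<phi> L2_tendstoD(2)[OF lim] L2_tendstoD(1)[OF lim], of m] n m
    by (simp add: power2_commute[of "\<phi> x" for x] power2_commute[of "clamp (real n) (\<phi> x)" "G m x" for x])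
  then show thesis by (rule that[OF G])
qed

text \<open>The step function of \<open>\<phi>\<close> is its best approximation, hence no worse than sampling a continuous approximation.\<close>

lemma L2_tendsto_dyadic_step:
  assumes \<phi>: "sq_integrable unit_leb \<phi>"
  shows "L2_tendsto unit_leb (dyadic_step \<phi>) \<phi>"
  unfolding L2_tendsto_def
proof (intro conjI allI sq_integrable_dyadic_step \<phi> LIMSEQ_I)
  fix e :: real assume "0 < e"
  then obtain g K where g: "continuous_on UNIV g" "\<And>x. \<bar>g x\<bar> \<le> K"
    and \<phi>_g: "sq_norm unit_leb (\<lambda>x. \<phi> x - g x) < e / 4"
    using continuous_L2_approximation[OF \<phi>, of "e/4"] by auto
  let ?q = "\<lambda>k. dyadic_combination (\<lambda>m. g (real m / 2^k)) k"
  have q: "L2_tendsto unit_leb ?q g" by (rule L2_tendsto_dyadic_sampling[OF g])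
  obtain N where N: "\<And>k. k \<ge> N \<Longrightarrow> sq_norm unit_leb (\<lambda>x. ?q k x - g x) < e / 4"
    using L2_tendsto_small[OF q, of "e/4"] \<open>0 < e\<close> by auto
  have "norm (sq_norm unit_leb (\<lambda>x. dyadic_step \<phi> k x - \<phi> x) - 0) < e" if "k \<ge> N" for k
  proof -
    have "sq_norm unit_leb (\<lambda>x. dyadic_step \<phi> k x - \<phi> x) = sq_norm unit_leb (\<lambda>x. \<phi> x - dyadic_step \<phi> k x)"
      by (simp only: power2_commute)
    also have "\<dots> \<le> sq_norm unit_leb (\<lambda>x. \<phi> x - ?q k x)" by (rule dyadic_step_minimal[OF \<phi>])
    also have "\<dots> \<le> 2 * sq_norm unit_leb (\<lambda>x. \<phi> x - g x) + 2 * sq_norm unit_leb (\<lambda>x. g x - ?q k x)"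
      by (intro sq_norm_diff_triangle \<phi> L2_tendstoD(1,2)[OF q])
    also have "\<dots> < e" using \<phi>_g N[OF that] by (simp add: power2_commute[of "g x" "?q k x" for x])
    finally show ?thesis by simp
  qed
  then show "\<exists>N. \<forall>k\<ge>N. norm (sq_norm unit_leb (\<lambda>x. dyadic_step \<phi> k x - \<phi> x) - 0) < e" by blast
qed

lemma dyadic_coef_combination:
  assumes e: "\<And>j. j \<in> J \<Longrightarrow> sq_integrable unit_leb (e j)" and m: "m < 2^k"
  shows "dyadic_coef (\<lambda>x. \<Sum>j\<in>J. v j * e j x) k m = (\<Sum>j\<in>J. v j * dyadic_coef (e j) k m)"
proof -
  let ?i = "indicat_real (dyadic_interval k m)"
  have i: "sq_integrable unit_leb ?i" by (simp add: dyadic_interval_def sq_integrable_indicator_Ico del: of_nat_Suc)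
  have "sq_inner unit_leb ?i (\<lambda>x. \<Sum>j\<in>J. v j * e j x) = (\<Sum>j\<in>J. v j * sq_inner unit_leb ?i (e j))"
    using sq_inner_sum_left[OF e i] by (simp add: mult.commute[of "?i _"])
  then show ?thesis
    using e m by (simp add: dyadic_coef_eq sq_integrable_sum sq_integrable_cmult sum_distrib_right mult.assoc)
qed

subsection \<open>Dyadic sums along a path\<close>

lemma dyadic_sum_cong:
  assumes "\<And>t. t \<in> {0..1} \<Longrightarrow> x t = y t"
  shows "dyadic_sum \<phi> x k = dyadic_sum \<phi> y k"
  unfolding dyadic_sum_def using dyadic_mem[of _ k]
  by (intro sum.cong refl) (simp add: assms del: of_nat_Suc)

lemma dyadic_sum_add: "dyadic_sum \<phi> (\<lambda>t. x t + y t) k = dyadic_sum \<phi> x k + dyadic_sum \<phi> y k"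
  by (simp add: dyadic_sum_def sum.distrib[symmetric] algebra_simps)

lemma dyadic_sum_combination:
  assumes "\<And>j. j \<in> J \<Longrightarrow> sq_integrable unit_leb (e j)"
  shows "dyadic_sum (\<lambda>u. \<Sum>j\<in>J. v j * e j u) x k = (\<Sum>j\<in>J. v j * dyadic_sum (e j) x k)"
proof -
  have "dyadic_sum (\<lambda>u. \<Sum>j\<in>J. v j * e j u) x k =
      (\<Sum>m<2^k. \<Sum>j\<in>J. v j * (dyadic_coef (e j) k m * (x (real (Suc m) / 2^k) - x (real m / 2^k))))"
    unfolding dyadic_sum_def
    by (intro sum.cong refl) (simp add: dyadic_coef_combination[OF assms] sum_distrib_right mult.assoc)
  also have "\<dots> = (\<Sum>j\<in>J. v j * dyadic_sum (e j) x k)"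
    unfolding dyadic_sum_def sum_distrib_left by (rule sum.swap)
  finally show ?thesis .
qed

lemma dyadic_sum_drift:
  assumes h: "sq_integrable unit_leb h"
  shows "dyadic_sum \<phi> (drift h) k = sq_inner unit_leb (dyadic_step \<phi> k) h"
proof -
  have "sq_inner unit_leb (dyadic_step \<phi> k) h =
      (\<Sum>m<2^k. dyadic_coef \<phi> k m * sq_inner unit_leb (indicat_real (dyadic_interval k m)) h)"
    unfolding dyadic_step_def dyadic_combination_def
    by (intro sq_inner_sum_left h) (simp add: dyadic_interval_def sq_integrable_indicator_Ico del: of_nat_Suc)
  also have "\<dots> = dyadic_sum \<phi> (drift h) k"
    unfolding dyadic_sum_def dyadic_interval_def using dyadic_endpoints[of _ k]
    by (intro sum.cong refl) (simp add: drift_increment[OF h] del: of_nat_Suc)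
  finally show ?thesis ..
qed

lemma dyadic_sum_measurable: "(\<lambda>x. dyadic_sum \<phi> x k) \<in> borel_measurable traj_space"
proof -
  have "(\<lambda>x. x t) \<in> borel_measurable traj_space" if "t \<in> {0..1}" for t
    unfolding traj_space_def using that by (rule measurable_component_singleton)
  then show ?thesis unfolding dyadic_sum_def
    using dyadic_mem by (intro borel_measurable_sum borel_measurable_times borel_measurable_diff) (auto simp del: of_nat_Suc)
qed

text \<open>The Wiener integral is taken along a subsequence that depends on the integrand only, so that it is one
  measurable functional of the path and inherits the independence of the paths. Where the limit does not
  exist, \<open>lim\<close> is an arbitrary value.\<close>

definition dyadic_subseq :: "(real \<Rightarrow> real) \<Rightarrow> nat \<Rightarrow> nat" where
  "dyadic_subseq \<phi> = (SOME r. fast_L2_Cauchy_subseq unit_leb (dyadic_step \<phi>) r)"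

definition wiener_int :: "(real \<Rightarrow> real) \<Rightarrow> (real \<Rightarrow> real) \<Rightarrow> real" where
  "wiener_int \<phi> x = lim (\<lambda>m. dyadic_sum \<phi> x (dyadic_subseq \<phi> m))"

lemma fast_L2_Cauchy_dyadic_subseq:
  assumes "sq_integrable unit_leb \<phi>"
  shows "fast_L2_Cauchy_subseq unit_leb (dyadic_step \<phi>) (dyadic_subseq \<phi>)"
  using L2_Cauchy_fast_subseq[OF L2_tendsto_imp_Cauchy[OF L2_tendsto_dyadic_step[OF assms]]]
  unfolding dyadic_subseq_def by (metis someI)

lemma wiener_int_restrict: "wiener_int \<phi> (restrict x {0..1}) = wiener_int \<phi> x"
  unfolding wiener_int_def by (intro arg_cong[where f=lim] ext dyadic_sum_cong) auto

lemma wiener_int_measurable [measurable]: "wiener_int \<phi> \<in> borel_measurable traj_space"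
  unfolding wiener_int_def[abs_def] by (intro borel_measurable_lim_metric dyadic_sum_measurable)

section \<open>Gaussian tails and characteristic functions\<close>

definition normal_tail :: "real \<Rightarrow> real" where
  "normal_tail x = measure std_normal_distribution {x..}"

lemma normal_tail_eq_integral: "normal_tail x = (\<integral>y. std_normal_density y * indicat_real {x..} y \<partial>lborel)"
proof -
  interpret prob_space std_normal_distribution by (rule prob_space_normal_density) simp
  have "normal_tail x = (\<integral>y. indicat_real {x..} y \<partial>std_normal_distribution)"
    by (simp add: normal_tail_def)
  also have "\<dots> = (\<integral>y. std_normal_density y *\<^sub>R indicat_real {x..} y \<partial>lborel)"
    by (rule integral_density) auto
  finally show ?thesis by simp
qed

lemma normal_tail_nonneg: "0 \<le> normal_tail x"
  by (simp add: normal_tail_def)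

lemma normal_tail_antimono: "x \<le> y \<Longrightarrow> normal_tail y \<le> normal_tail x"
proof -
  interpret prob_space std_normal_distribution by (rule prob_space_normal_density) simp
  assume "x \<le> y"
  then show ?thesis unfolding normal_tail_def by (intro finite_measure_mono) auto
qed

lemma integrable_std_normal_indicator:
  "A \<in> sets borel \<Longrightarrow> integrable lborel (\<lambda>y. std_normal_density y * indicat_real A y)"
  using integrable_mult_indicator[of A lborel std_normal_density] by (simp add: mult.commute)

lemma normal_tail_minus: "normal_tail (- x) = 1 - normal_tail x"
proof -
  have "normal_tail (- x) = (\<integral>y. std_normal_density y * indicat_real {..x} y \<partial>lborel)"
    unfolding normal_tail_eq_integral
    by (subst lborel_integral_real_affine[where c="-1" and t=0])
       (auto simp: std_normal_density_def indicator_def intro!: Bochner_Integration.integral_cong)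
  then have "normal_tail (- x) + normal_tail x =
    (\<integral>y. std_normal_density y * indicat_real {..x} y + std_normal_density y * indicat_real {x..} y \<partial>lborel)"
    by (simp add: normal_tail_eq_integral integrable_std_normal_indicator)
  also have "\<dots> = (\<integral>y. std_normal_density y \<partial>lborel)"
  proof (rule integral_cong_AE)
    have "AE y in lborel. y \<noteq> x" by (rule AE_lborel_singleton)
    then show "AE y in lborel. std_normal_density y * indicat_real {..x} y + std_normal_density y * indicat_real {x..} y
        = std_normal_density y"
      by eventually_elim (auto simp: indicator_def)
  qed auto
  finally show ?thesis by simp
qed

lemma normal_tail_0: "normal_tail 0 = 1 / 2"
  using normal_tail_minus[of 0] by simp

lemma continuous_on_std_normal_density: "continuous_on A std_normal_density"
  unfolding std_normal_density_def by (intro continuous_intros) auto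

lemma normal_tail_eq_add_integral:
  assumes "x \<le> b"
  shows "normal_tail x = normal_tail b + integral {x..b} std_normal_density"
proof -
  have "normal_tail x = (\<integral>y. std_normal_density y * indicat_real {b..} y + std_normal_density y * indicat_real {x..b} y \<partial>lborel)"
    unfolding normal_tail_eq_integral
  proof (rule integral_cong_AE)
    have "AE y in lborel. y \<noteq> b" by (rule AE_lborel_singleton)
    then show "AE y in lborel. std_normal_density y * indicat_real {x..} y =
        std_normal_density y * indicat_real {b..} y + std_normal_density y * indicat_real {x..b} y"
      by eventually_elim (use assms in \<open>auto simp: indicator_def\<close>)
  qed auto
  also have "\<dots> = normal_tail b + (LINT y:{x..b}|lborel. std_normal_density y)"
    by (simp add: normal_tail_eq_integral integrable_std_normal_indicator set_lebesgue_integral_def mult.commute)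
  also have "(LINT y:{x..b}|lborel. std_normal_density y) = integral {x..b} std_normal_density"
    by (rule set_borel_integral_eq_integral)
       (use integrable_std_normal_indicator[of "{x..b}"] in \<open>simp add: set_integrable_def mult.commute\<close>)
  finally show ?thesis .
qed

lemma DERIV_normal_tail: "(normal_tail has_real_derivative - std_normal_density x) (at x)"
proof -
  let ?a = "x - 1" and ?b = "x + 1"
  have "((\<lambda>y. normal_tail ?b + integral {y..?b} std_normal_density) has_real_derivative (0 + - std_normal_density x))
      (at x within {?a..?b})"
    by (intro DERIV_add DERIV_const integral_has_real_derivative' continuous_on_std_normal_density) auto
  then have "((\<lambda>y. normal_tail ?b + integral {y..?b} std_normal_density) has_real_derivative - std_normal_density x) (at x)"
    by (subst (asm) at_within_Icc_at) auto
  then show ?thesis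
  proof (rule has_field_derivative_transform_within_open[where S="{?a<..<?b}"])
    show "normal_tail ?b + integral {y..?b} std_normal_density = normal_tail y" if "y \<in> {?a<..<?b}" for y
      using normal_tail_eq_add_integral[of y ?b] that by auto
  qed auto
qed

declare DERIV_normal_tail[THEN DERIV_chain2, derivative_intros]

lemma DERIV_std_normal_density: "(std_normal_density has_real_derivative - (x * std_normal_density x)) (at x)"
proof -
  define c where "c = 1 / sqrt (2 * pi)"
  have "std_normal_density = (\<lambda>x. c * exp (- x\<^sup>2 / 2))" by (auto simp: c_def std_normal_density_def)
  then show ?thesis by (auto intro!: derivative_eq_intros)
qed

lemma std_normal_density_le_1: "std_normal_density x \<le> 1"
proof -
  have "1 \<le> sqrt (2 * pi)" using pi_ge_two by simp
  then have "1 / sqrt (2 * pi) * exp (- x\<^sup>2 / 2) \<le> 1 * 1" by (intro mult_mono) auto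
  then show ?thesis by (simp add: std_normal_density_def)
qed

lemma normal_tail_le_add: "normal_tail x \<le> normal_tail y + \<bar>y - x\<bar>"
proof (cases "x < y")
  case True
  then obtain z where "normal_tail y - normal_tail x = (y - x) * (- std_normal_density z)"
    using MVT2[of x y normal_tail "\<lambda>x. - std_normal_density x"] DERIV_normal_tail by auto
  moreover have "(y - x) * std_normal_density z \<le> (y - x) * 1"
    using True std_normal_density_le_1 by (intro mult_left_mono) auto
  ultimately show ?thesis using True unfolding mult_minus_right mult_1_right by linarith
next
  case False
  then show ?thesis using normal_tail_antimono[of y x] by simp
qed

lemma std_normal_density_mult_le:
  assumes "0 < b" "b \<le> x"
  shows "x * std_normal_density x \<le> 1 / b"
proof -
  have "x\<^sup>2 / 2 \<le> exp (x\<^sup>2 / 2) - 1" using exp_ge_add_one_self[of "x\<^sup>2/2"] by linarith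
  then have exp_bound: "x\<^sup>2 * exp (- x\<^sup>2 / 2) \<le> 2" by (simp add: exp_minus field_simps)
  have "2 \<le> sqrt (2 * pi)" using pi_ge_two by (intro real_le_rsqrt) simp
  then have "1 / sqrt (2 * pi) * (x\<^sup>2 * exp (- x\<^sup>2 / 2)) \<le> (1 / 2) * 2"
    using exp_bound by (intro mult_mono divide_left_mono) auto
  then have "x * (x * std_normal_density x) \<le> 1"
    by (simp add: std_normal_density_def power2_eq_square mult.left_commute)
  then have "x * std_normal_density x \<le> 1 / x" using assms by (simp add: field_simps)
  also have "\<dots> \<le> 1 / b" using assms by (intro divide_left_mono) auto
  finally show ?thesis .
qed

lemma normal_tail_second_order:
  assumes m: "0 < m" and t: "\<bar>t\<bar> \<le> m / 2"
  shows "(normal_tail (m + t) + normal_tail (m - t)) / 2 \<le> normal_tail m + 2 * t\<^sup>2 / m"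
proof (cases "t = 0")
  case False
  define u where "u = \<bar>t\<bar>"
  have u: "0 < u" "u \<le> m / 2" using False t by (auto simp: u_def)
  let ?h = "\<lambda>u. normal_tail (m + u) + normal_tail (m - u)"
  let ?h' = "\<lambda>u. std_normal_density (m - u) - std_normal_density (m + u)"
  have "(?h has_real_derivative ?h' \<xi>) (at \<xi>)" for \<xi>
    by (auto intro!: derivative_eq_intros)
  then obtain \<xi> where \<xi>: "0 < \<xi>" "\<xi> < u"
    and h: "?h u - ?h 0 = (u - 0) * ?h' \<xi>"
    using MVT2[OF u(1), of ?h ?h'] by auto
  obtain y where y: "m - \<xi> < y"
    and diff: "std_normal_density (m + \<xi>) - std_normal_density (m - \<xi>) = (m + \<xi> - (m - \<xi>)) * - (y * std_normal_density y)"
    using MVT2[of "m - \<xi>" "m + \<xi>" std_normal_density "\<lambda>y. - (y * std_normal_density y)"]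
      DERIV_std_normal_density \<xi> by auto
  have "y * std_normal_density y \<le> 1 / (m / 2)"
    using y \<xi> u m by (intro std_normal_density_mult_le) auto
  then have "2 * \<xi> * (y * std_normal_density y) \<le> 2 * u * (1 / (m / 2))"
    using \<xi> m y u by (intro mult_mono) auto
  then have "u * ?h' \<xi> \<le> u * (4 * u / m)"
    using diff u by (intro mult_left_mono) auto
  moreover have "u * (4 * u / m) = 4 * t\<^sup>2 / m" by (simp add: u_def power2_eq_square)
  ultimately have "?h u \<le> 2 * normal_tail m + 4 * t\<^sup>2 / m" using h by (simp only: diff_zero add_0_right)
  moreover have "?h u = ?h t" by (cases "t \<ge> 0") (auto simp: u_def)
  ultimately show ?thesis by simp
qed simp

subsection \<open>The excess risk as a function of the margins\<close>

lemma normal_tail_average_le: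
  assumes "\<bar>a - a'\<bar> \<le> E" "\<bar>a + a'\<bar> \<le> \<delta>"
  shows "(normal_tail a + normal_tail a') / 2 \<le> normal_tail (\<delta> / 2) + (\<delta> + E)"
proof -
  have "\<bar>\<delta> / 2 - a\<bar> + \<bar>\<delta> / 2 - a'\<bar> \<le> 2 * (\<delta> + E)" using assms by (auto simp: abs_if split: if_splits)
  then show ?thesis
    using normal_tail_le_add[of a "\<delta> / 2"] normal_tail_le_add[of a' "\<delta> / 2"] by (simp add: field_simps)
qed

lemma normal_tail_average_le_second_order:
  assumes \<delta>: "0 < \<delta>" and diff: "\<bar>a - a'\<bar> \<le> E" "E \<le> \<delta> / 8" and sum: "\<delta> / 2 \<le> a + a'" "a + a' \<le> \<delta>"
  shows "(normal_tail a + normal_tail a') / 2 \<le> normal_tail (\<delta> / 2) + (\<delta> - (a + a')) / 2 + 2 * E\<^sup>2 / \<delta>"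
proof -
  define m where "m = (a + a') / 2"
  define t where "t = (a - a') / 2"
  have m: "\<delta> / 4 \<le> m" "0 < m" using sum \<delta> by (auto simp: m_def)
  have t: "\<bar>t\<bar> \<le> E / 2" using diff by (simp add: t_def)
  have "(normal_tail a + normal_tail a') / 2 = (normal_tail (m + t) + normal_tail (m - t)) / 2"
    by (simp add: m_def t_def add_divide_distrib diff_divide_distrib)
  also have "\<dots> \<le> normal_tail m + 2 * t\<^sup>2 / m"
    using m t diff by (intro normal_tail_second_order) auto
  also have "normal_tail m \<le> normal_tail (\<delta> / 2) + (\<delta> - (a + a')) / 2"
    using normal_tail_le_add[of m "\<delta> / 2"] sum by (simp add: m_def diff_divide_distrib)
  also have "2 * t\<^sup>2 / m \<le> 2 * E\<^sup>2 / \<delta>"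
  proof -
    have "t\<^sup>2 \<le> (E / 2)\<^sup>2" using t by (subst abs_le_square_iff[symmetric]) auto
    then have "2 * t\<^sup>2 / m \<le> 2 * (E / 2)\<^sup>2 / (\<delta> / 4)" using m \<delta> by (intro frac_le) auto
    then show ?thesis by (simp add: power2_eq_square)
  qed
  finally show ?thesis by simp
qed

text \<open>\<open>\<delta>\<close> is the distance of the drifts, \<open>D\<close> its truncation to finitely many coefficients, \<open>p\<close> the length of the true
  difference along the estimated direction, \<open>E\<close> the estimation error and \<open>\<rho>\<close> the bias level.\<close>

lemma margin_deficit_le:
  fixes \<delta> D p E \<rho> :: real
  assumes \<delta>: "0 < \<delta>" and D: "0 \<le> D" "D \<le> \<delta>" "\<bar>p\<bar> \<le> D" and bias: "\<delta>\<^sup>2 - D\<^sup>2 \<le> 4 * \<rho>\<^sup>2"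
    and estimation: "D * (D - p) \<le> 2 * E\<^sup>2" and small: "64 * (\<rho>\<^sup>2 + E\<^sup>2) < \<delta>\<^sup>2"
  shows "\<delta> / 2 \<le> p" "\<delta> - p \<le> 4 * ((\<rho>\<^sup>2 + E\<^sup>2) / \<delta>)"
proof -
  have squares: "0 \<le> \<rho>\<^sup>2" "0 \<le> E\<^sup>2" by auto
  have "(\<delta> * 3 / 4)\<^sup>2 = 9 / 16 * \<delta>\<^sup>2" by (simp add: power2_eq_square)
  then have "(\<delta> * 3 / 4)\<^sup>2 \<le> D\<^sup>2" using bias small squares zero_le_power2[of \<delta>] unfolding distrib_left by linarith
  then have D_lower: "\<delta> * 3 / 4 \<le> D" using D(1) power2_le_imp_le by blast
  have "(\<delta> * 3 / 4) * (D - p) \<le> D * (D - p)" using D_lower D by (intro mult_right_mono) auto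
  then have estimation': "\<delta> * (D - p) \<le> 8 / 3 * E\<^sup>2" using estimation by simp
  moreover have "64 * E\<^sup>2 \<le> \<delta>\<^sup>2" using small squares unfolding distrib_left by linarith
  ultimately have "\<delta> * (D - p) \<le> \<delta> * (\<delta> / 24)" by (simp add: power2_eq_square)
  then have "D - p \<le> \<delta> / 24" using \<delta> by simp
  then show "\<delta> / 2 \<le> p" using D_lower \<delta> by simp
  have "\<delta> * (\<delta> - D) \<le> (\<delta> + D) * (\<delta> - D)" using D by (intro mult_right_mono) auto
  also have "\<dots> \<le> 4 * \<rho>\<^sup>2" using bias by (simp add: power2_eq_square algebra_simps)
  finally have "\<delta> * (\<delta> - p) \<le> 4 * \<rho>\<^sup>2 + 8 / 3 * E\<^sup>2" using estimation' by (simp add: algebra_simps)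
  also have "\<dots> \<le> 4 * (\<rho>\<^sup>2 + E\<^sup>2)" by simp
  finally have "\<delta> * (\<delta> - p) \<le> 4 * (\<rho>\<^sup>2 + E\<^sup>2)" .
  then show "\<delta> - p \<le> 4 * ((\<rho>\<^sup>2 + E\<^sup>2) / \<delta>)" using \<delta> by (simp add: field_simps)
qed

text \<open>The Lipschitz bound for the tail suffices unless \<open>\<rho>\<close> and \<open>E\<close> are small compared with \<open>\<delta>\<close>; in that case
  the margins are of order \<open>\<delta>\<close> and the first-order effect of their difference cancels in the average.\<close>

lemma normal_tail_average_excess_le:
  fixes a a' \<delta> D E \<rho> :: real
  assumes diff: "\<bar>a - a'\<bar> \<le> E" and sum: "\<bar>a + a'\<bar> \<le> D" and D: "D \<le> \<delta>"
    and bias: "\<delta>\<^sup>2 - D\<^sup>2 \<le> 4 * \<rho>\<^sup>2" and estimation: "D * (D - (a + a')) \<le> 2 * E\<^sup>2" and \<rho>: "\<rho> > 0"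
  shows "(normal_tail a + normal_tail a') / 2 \<le> normal_tail (\<delta> / 2) + 100 * ((\<rho>\<^sup>2 + E\<^sup>2) / max \<delta> \<rho>)"
proof -
  define z where "z = \<rho>\<^sup>2 + E\<^sup>2"
  have z: "0 < z" "\<rho>\<^sup>2 \<le> z" "E\<^sup>2 \<le> z" using \<rho> by (auto simp: z_def add_pos_nonneg)
  have E: "0 \<le> E" using diff by linarith
  have lipschitz: "(normal_tail a + normal_tail a') / 2 \<le> normal_tail (\<delta> / 2) + (\<delta> + E)"
    using diff sum D by (intro normal_tail_average_le) auto
  consider "\<delta> \<le> \<rho>" | "\<rho> < \<delta>" "\<delta>\<^sup>2 \<le> 64 * z" | "\<rho> < \<delta>" "64 * z < \<delta>\<^sup>2" by linarith
  then have "(normal_tail a + normal_tail a') / 2 \<le> normal_tail (\<delta> / 2) + 100 * (z / max \<delta> \<rho>)"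
  proof cases
    case 1
    have "2 * (\<rho> * E) \<le> z" using sum_squares_bound[of \<rho> E] by (simp add: z_def)
    then have "\<rho> * (\<rho> + E) \<le> 2 * z" using z by (simp add: power2_eq_square distrib_left)
    then have "\<rho> + E \<le> 100 * (z / \<rho>)" using \<rho> z by (simp add: field_simps)
    then show ?thesis using lipschitz 1 by (simp add: max_absorb2)
  next
    case 2
    have "\<delta> * (\<delta> + E) \<le> 100 * z"
      using sum_squares_bound[of \<delta> E] z 2 by (simp add: power2_eq_square algebra_simps)
    then have "\<delta> + E \<le> 100 * (z / \<delta>)" using \<rho> 2 by (simp add: field_simps)
    then show ?thesis using lipschitz 2 by (simp add: max_absorb1)
  next
    case 3
    then have \<delta>: "0 < \<delta>" using \<rho> by simp
    have "E\<^sup>2 \<le> (\<delta> / 8)\<^sup>2" using 3 z by (simp add: power2_eq_square)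
    then have E_small: "E \<le> \<delta> / 8" by (rule power2_le_imp_le) (use \<delta> in simp)
    note deficit = margin_deficit_le[OF \<delta> _ D sum bias estimation 3(2)[unfolded z_def]]
    have "(normal_tail a + normal_tail a') / 2 \<le> normal_tail (\<delta> / 2) + (\<delta> - (a + a')) / 2 + 2 * E\<^sup>2 / \<delta>"
      using deficit(1) sum D by (intro normal_tail_average_le_second_order \<delta> diff E_small) auto
    also have "(\<delta> - (a + a')) / 2 \<le> 2 * (z / \<delta>)" using deficit(2) sum by (simp add: z_def)
    also have "2 * E\<^sup>2 / \<delta> \<le> 2 * (z / \<delta>)" using z \<delta> by (simp add: divide_right_mono)
    also have "normal_tail (\<delta> / 2) + 2 * (z / \<delta>) + 2 * (z / \<delta>) \<le> normal_tail (\<delta> / 2) + 100 * (z / \<delta>)"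
      using divide_pos_pos[OF z(1) \<delta>] by simp
    finally show ?thesis using 3 by (simp add: max_absorb1)
  qed
  then show ?thesis by (simp add: z_def)
qed

subsection \<open>Characteristic functions\<close>

definition normal_char :: "real \<Rightarrow> real \<Rightarrow> complex" where
  "normal_char v t = complex_of_real (exp (- (t\<^sup>2 * v) / 2))"

context prob_space
begin

lemma distributed_normal_moments:
  assumes X: "distributed M lborel X (normal_density 0 \<sigma>)" and \<sigma>: "\<sigma> > 0"
  shows "sq_integrable M X" "expectation X = 0" "sq_norm M X = \<sigma>\<^sup>2"
proof -
  have [measurable]: "X \<in> borel_measurable M" using distributed_measurable[OF X] by simp
  have "integrable lborel (\<lambda>x. normal_density 0 \<sigma> x * x\<^sup>2)"
    using integrable_normal_moment[OF \<sigma>, of 0 2] by simp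
  then have "integrable M (\<lambda>x. (X x)\<^sup>2)"
    by (subst distributed_integrable[OF X, symmetric]) auto
  then show "sq_integrable M X" by (simp add: sq_integrable_def)
  show mean: "expectation X = 0" by (rule normal_distributed_expectation[OF \<sigma> X])
  show "sq_norm M X = \<sigma>\<^sup>2"
    using normal_distributed_variance[OF \<sigma> X] by (simp add: mean)
qed

lemma char_scaled_normal:
  assumes X: "distributed M lborel X (normal_density 0 \<sigma>)" and \<sigma>: "\<sigma> > 0"
  shows "char (distr M borel (\<lambda>\<omega>. c * X \<omega>)) t = normal_char (c\<^sup>2 * \<sigma>\<^sup>2) t"
proof -
  have [measurable]: "X \<in> borel_measurable M" using distributed_measurable[OF X] by simp
  have std: "distr M lborel (\<lambda>x. X x / \<sigma>) = std_normal_distribution"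
    using X normal_standard_normal_convert[OF \<sigma>, of X 0] unfolding distributed_def by simp
  have "char (distr M borel (\<lambda>\<omega>. c * X \<omega>)) t = (CLINT x|M. iexp ((t * c * \<sigma>) * (X x / \<sigma>)))"
    using \<sigma> by (simp add: char_def integral_distr mult.assoc)
  also have "\<dots> = char (distr M lborel (\<lambda>x. X x / \<sigma>)) (t * c * \<sigma>)"
    unfolding char_def by (subst integral_distr) simp_all
  also have "\<dots> = complex_of_real (exp (- ((t * c * \<sigma>)\<^sup>2) / 2))"
    unfolding std char_std_normal_distribution ..
  finally show ?thesis by (simp add: normal_char_def power_mult_distrib mult.assoc)
qed

lemma char_sum_indep_normal:
  assumes indep: "indep_vars (\<lambda>_. borel) X I" and I: "finite I"
    and X: "\<And>i. i \<in> I \<Longrightarrow> distributed M lborel (X i) (normal_density 0 (\<sigma> i))" and \<sigma>: "\<And>i. i \<in> I \<Longrightarrow> \<sigma> i > 0"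
  shows "char (distr M borel (\<lambda>\<omega>. \<Sum>i\<in>I. c i * X i \<omega>)) t = normal_char (\<Sum>i\<in>I. (c i)\<^sup>2 * (\<sigma> i)\<^sup>2) t"
proof -
  have "indep_vars (\<lambda>_. borel) (\<lambda>i \<omega>. c i * X i \<omega>) I"
    by (rule indep_vars_compose2[OF indep, of "\<lambda>i x. c i * x"]) auto
  then have "char (distr M borel (\<lambda>\<omega>. \<Sum>i\<in>I. c i * X i \<omega>)) t = (\<Prod>i\<in>I. char (distr M borel (\<lambda>\<omega>. c i * X i \<omega>)) t)"
    by (rule char_distr_sum)
  also have "\<dots> = (\<Prod>i\<in>I. normal_char ((c i)\<^sup>2 * (\<sigma> i)\<^sup>2) t)"
    by (intro prod.cong refl char_scaled_normal X \<sigma>)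
  also have "\<dots> = complex_of_real (exp (\<Sum>i\<in>I. - (t\<^sup>2 * ((c i)\<^sup>2 * (\<sigma> i)\<^sup>2)) / 2))"
    using I by (simp add: normal_char_def exp_sum)
  also have "(\<Sum>i\<in>I. - (t\<^sup>2 * ((c i)\<^sup>2 * (\<sigma> i)\<^sup>2)) / 2) = - (t\<^sup>2 * (\<Sum>i\<in>I. (c i)\<^sup>2 * (\<sigma> i)\<^sup>2)) / 2"
    by (simp add: sum_distrib_left sum_negf sum_divide_distrib)
  finally show ?thesis by (simp add: normal_char_def)
qed

lemma prob_ge_of_normal_char:
  assumes Z[measurable]: "Z \<in> borel_measurable M" and v: "v > 0"
    and char_Z: "\<And>t. char (distr M borel Z) t = normal_char v t"
  shows "prob {\<omega> \<in> space M. x \<le> Z \<omega>} = normal_tail (x / sqrt v)"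
proof -
  have "distr M borel (\<lambda>\<omega>. Z \<omega> / sqrt v) = std_normal_distribution"
  proof (rule Levy_uniqueness)
    show "char (distr M borel (\<lambda>\<omega>. Z \<omega> / sqrt v)) = char std_normal_distribution"
    proof
      fix t
      have "char (distr M borel (\<lambda>\<omega>. Z \<omega> / sqrt v)) t = char (distr M borel Z) (t / sqrt v)"
        by (simp add: char_def integral_distr)
      then show "char (distr M borel (\<lambda>\<omega>. Z \<omega> / sqrt v)) t = char std_normal_distribution t"
        using v by (simp add: char_Z normal_char_def power_divide char_std_normal_distribution)
    qed
  qed (auto intro: real_distribution_distr real_dist_normal_dist)
  then have "normal_tail (x / sqrt v) = measure (distr M borel (\<lambda>\<omega>. Z \<omega> / sqrt v)) {x / sqrt v..}"
    by (simp add: normal_tail_def)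
  also have "\<dots> = prob ((\<lambda>\<omega>. Z \<omega> / sqrt v) -` {x / sqrt v..} \<inter> space M)"
    by (rule measure_distr) auto
  also have "(\<lambda>\<omega>. Z \<omega> / sqrt v) -` {x / sqrt v..} \<inter> space M = {\<omega> \<in> space M. x \<le> Z \<omega>}"
    using v by (auto simp: divide_le_cancel)
  finally show ?thesis ..
qed

lemma norm_char_diff_le:
  assumes [measurable]: "X \<in> borel_measurable M" "Z \<in> borel_measurable M" and int: "integrable M (\<lambda>x. X x - Z x)"
  shows "norm (char (distr M borel X) t - char (distr M borel Z) t) \<le> \<bar>t\<bar> * (\<integral>x. \<bar>X x - Z x\<bar> \<partial>M)"
proof -
  have iexp_int: "integrable M (\<lambda>x. iexp (t * X x))" "integrable M (\<lambda>x. iexp (t * Z x))"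
    by (intro integrable_iexp; simp)+
  have "char (distr M borel X) t - char (distr M borel Z) t = (CLINT x|M. iexp (t * X x) - iexp (t * Z x))"
    using iexp_int by (simp add: char_def integral_distr)
  then have "norm (char (distr M borel X) t - char (distr M borel Z) t) \<le> (\<integral>x. norm (iexp (t * X x) - iexp (t * Z x)) \<partial>M)"
    by simp
  also have "\<dots> \<le> (\<integral>x. \<bar>t\<bar> * \<bar>X x - Z x\<bar> \<partial>M)"
  proof (rule integral_mono)
    show "integrable M (\<lambda>x. norm (iexp (t * X x) - iexp (t * Z x)))"
      using iexp_int by (intro integrable_norm Bochner_Integration.integrable_diff)
    show "integrable M (\<lambda>x. \<bar>t\<bar> * \<bar>X x - Z x\<bar>)" using int by simp
    fix x
    have "iexp (t * X x) - iexp (t * Z x) = iexp (t * Z x) * (iexp (t * (X x - Z x)) - 1)"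
      by (simp add: algebra_simps flip: exp_add)
    then have "norm (iexp (t * X x) - iexp (t * Z x)) = norm (iexp (t * (X x - Z x)) - 1)"
      by (simp add: norm_mult)
    also have "\<dots> \<le> \<bar>t * (X x - Z x)\<bar>" using iexp_approx1[of "t * (X x - Z x)" 0] by simp
    finally show "norm (iexp (t * X x) - iexp (t * Z x)) \<le> \<bar>t\<bar> * \<bar>X x - Z x\<bar>" by (simp only: abs_mult)
  qed
  finally show ?thesis by simp
qed

lemma L2_tendsto_char:
  assumes S: "L2_tendsto M S Z"
  shows "(\<lambda>k. char (distr M borel (S k)) t) \<longlonglongrightarrow> char (distr M borel Z) t"
proof (rule LIM_zero_cancel, rule Lim_null_comparison)
  let ?B = "\<lambda>k. \<bar>t\<bar> * sqrt (sq_norm M (\<lambda>x. S k x - Z x))"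
  have "?B \<longlonglongrightarrow> \<bar>t\<bar> * sqrt 0" by (intro tendsto_intros L2_tendstoD[OF S])
  then show "?B \<longlonglongrightarrow> 0" by simp
  have "norm (char (distr M borel (S k)) t - char (distr M borel Z) t) \<le> ?B k" for k
  proof -
    note sq = L2_tendstoD(1)[OF S, of k] L2_tendstoD(2)[OF S]
    have "norm (char (distr M borel (S k)) t - char (distr M borel Z) t) \<le> \<bar>t\<bar> * (\<integral>x. \<bar>S k x - Z x\<bar> \<partial>M)"
      using sq by (intro norm_char_diff_le sq_integrable_measurable sq_integrable_imp_integrable sq_integrable_diff)
    also have "\<dots> \<le> ?B k"
      using integral_abs_sq_le[OF sq_integrable_diff[OF sq]] by (intro mult_left_mono real_le_rsqrt) auto
    finally show ?thesis .
  qed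
  then show "\<forall>\<^sub>F k in sequentially. norm (char (distr M borel (S k)) t - char (distr M borel Z) t) \<le> ?B k"
    by simp
qed

lemma sq_inner_indep_vars:
  fixes X :: "'i \<Rightarrow> 'a \<Rightarrow> real"
  assumes indep: "indep_vars (\<lambda>_. borel) X I" and ij: "i \<in> I" "j \<in> I" "i \<noteq> j"
    and int: "integrable M (X i)" "integrable M (X j)"
  shows "sq_inner M (X i) (X j) = expectation (X i) * expectation (X j)"
proof -
  have "indep_vars (\<lambda>_. borel) X {i, j}" using ij by (intro indep_vars_subset[OF indep]) auto
  then have "expectation (\<lambda>\<omega>. \<Prod>i\<in>{i,j}. X i \<omega>) = (\<Prod>i\<in>{i,j}. expectation (X i))"
    using int by (intro indep_vars_lebesgue_integral) auto
  then show ?thesis using ij by simp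
qed

lemma orthogonal_family_indep_vars:
  fixes X :: "'i \<Rightarrow> 'a \<Rightarrow> real"
  assumes indep: "indep_vars (\<lambda>_. borel) X I"
    and sq: "\<And>i. i \<in> I \<Longrightarrow> sq_integrable M (X i)" and mean: "\<And>i. i \<in> I \<Longrightarrow> expectation (X i) = 0"
  shows "orthogonal_family M I X (\<lambda>i. sq_norm M (X i))"
  unfolding orthogonal_family_def
proof (intro conjI ballI sq)
  fix i j assume ij: "i \<in> I" "j \<in> I"
  show "sq_inner M (X i) (X j) = (if i = j then sq_norm M (X i) else 0)"
  proof (cases "i = j")
    case False
    then show ?thesis
      using sq_inner_indep_vars[OF indep ij False] mean[OF ij(1)] sq_integrable_imp_integrable sq ij by simp
  qed (simp add: power2_eq_square)
qed

end

section \<open>Wiener integrals\<close>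

lemma stoch_int_eq_L2_limit:
  assumes Z: "L2_tendsto M (\<lambda>k \<omega>. dyadic_sum \<phi> (X \<omega>) k) Z"
  shows "stoch_int M \<phi> X \<in> borel_measurable M" "AE \<omega> in M. stoch_int M \<phi> X \<omega> = Z \<omega>"
proof -
  let ?S = "\<lambda>k \<omega>. dyadic_sum \<phi> (X \<omega>) k"
  let ?I = "stoch_int M \<phi> X"
  let ?limit = "\<lambda>Z. Z \<in> borel_measurable M \<and> (\<lambda>k. \<integral>\<^sup>+\<omega>. ennreal ((Z \<omega> - ?S k \<omega>)\<^sup>2) \<partial>M) \<longlonglongrightarrow> 0"
  note S_sq = L2_tendstoD(1)[OF Z]
  note [measurable] = S_sq[THEN sq_integrable_measurable]
  have nn_integral_square: "(\<integral>\<^sup>+\<omega>. ennreal ((Z' \<omega> - ?S k \<omega>)\<^sup>2) \<partial>M) = ennreal (sq_norm M (\<lambda>\<omega>. ?S k \<omega> - Z' \<omega>))"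
    if "sq_integrable M Z'" for Z' k
    using sq_integrable_square[OF sq_integrable_diff[OF that S_sq]]
    by (subst nn_integral_eq_integral) (auto simp: power2_commute)
  have "?limit Z"
    unfolding nn_integral_square[OF L2_tendstoD(2)[OF Z]]
    using L2_tendstoD(2)[OF Z] tendsto_ennrealI[OF L2_tendstoD(3)[OF Z]] by (simp add: sq_integrable_measurable)
  then have "?limit (SOME Z. ?limit Z)" by (rule someI[of ?limit])
  then have limit: "?limit ?I" by (simp add: stoch_int_def)
  then show I_meas [measurable]: "?I \<in> borel_measurable M" by blast
  have "\<forall>\<^sub>F k in sequentially. (\<integral>\<^sup>+\<omega>. ennreal ((?I \<omega> - ?S k \<omega>)\<^sup>2) \<partial>M) < 1"
    using limit by (intro order_tendstoD(2)[of _ 0]) auto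
  then obtain k where "(\<integral>\<^sup>+\<omega>. ennreal ((?I \<omega> - ?S k \<omega>)\<^sup>2) \<partial>M) < 1" by (auto simp: eventually_sequentially)
  then have "sq_integrable M (\<lambda>\<omega>. ?I \<omega> - ?S k \<omega>)"
    unfolding sq_integrable_def by (auto intro!: integrableI_bounded intro: less_trans)
  from sq_integrable_add[OF this S_sq[of k]] have I_sq: "sq_integrable M ?I" by simp
  have "(\<lambda>k. ennreal (sq_norm M (\<lambda>\<omega>. ?S k \<omega> - ?I \<omega>))) \<longlonglongrightarrow> ennreal 0"
    using limit unfolding nn_integral_square[OF I_sq] by simp
  then have "(\<lambda>k. sq_norm M (\<lambda>\<omega>. ?S k \<omega> - ?I \<omega>)) \<longlonglongrightarrow> 0" by (rule tendsto_ennrealD) auto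
  then have "L2_tendsto M ?S ?I" using S_sq I_sq by (simp add: L2_tendsto_def)
  then show "AE \<omega> in M. ?I \<omega> = Z \<omega>" using Z by (rule L2_tendsto_unique)
qed

locale brownian = prob_space M for M :: "'a measure" +
  fixes W :: "'a \<Rightarrow> real \<Rightarrow> real"
  assumes BM: "standard_BM M W"
begin

lemma W_measurable: "t \<in> {0..1} \<Longrightarrow> (\<lambda>\<omega>. W \<omega> t) \<in> borel_measurable M"
  using BM by (simp add: standard_BM_def)

lemma W_0: "AE \<omega> in M. W \<omega> 0 = 0"
  using BM by (auto simp: standard_BM_def elim: eventually_mono)

lemma grid_increments:
  assumes t: "unit_grid k t"
  shows "indep_vars (\<lambda>_. borel) (\<lambda>i \<omega>. W \<omega> (t (Suc i)) - W \<omega> (t i)) {..<k}"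
    "i < k \<Longrightarrow> distributed M lborel (\<lambda>\<omega>. W \<omega> (t (Suc i)) - W \<omega> (t i)) (normal_density 0 (sqrt (t (Suc i) - t i)))"
  using BM t unfolding standard_BM_def unit_grid_def by blast+

lemma increment_moments:
  assumes "0 \<le> s" "s \<le> t" "t \<le> 1"
  shows "sq_integrable M (\<lambda>\<omega>. W \<omega> t - W \<omega> s)" "expectation (\<lambda>\<omega>. W \<omega> t - W \<omega> s) = 0"
    "sq_norm M (\<lambda>\<omega>. W \<omega> t - W \<omega> s) = t - s"
proof -
  have "sq_integrable M (\<lambda>\<omega>. W \<omega> t - W \<omega> s) \<and> expectation (\<lambda>\<omega>. W \<omega> t - W \<omega> s) = 0
    \<and> sq_norm M (\<lambda>\<omega>. W \<omega> t - W \<omega> s) = t - s"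
  proof (cases "s = t")
    case False
    then have "s < t" using assms by simp
    then have "distributed M lborel (\<lambda>\<omega>. W \<omega> t - W \<omega> s) (normal_density 0 (sqrt (t - s)))"
      using grid_increments(2)[of 1 "\<lambda>i. if i = 0 then s else t" 0] assms by (simp add: unit_grid_def)
    from distributed_normal_moments[OF this] \<open>s < t\<close> show ?thesis by simp
  qed (simp add: sq_integrable_zero)
  then show "sq_integrable M (\<lambda>\<omega>. W \<omega> t - W \<omega> s)" "expectation (\<lambda>\<omega>. W \<omega> t - W \<omega> s) = 0"
    "sq_norm M (\<lambda>\<omega>. W \<omega> t - W \<omega> s) = t - s" by auto
qed

lemma covariance_ordered:
  assumes "0 \<le> s" "s \<le> t" "t \<le> 1"
  shows "sq_inner M (\<lambda>\<omega>. W \<omega> s - W \<omega> 0) (\<lambda>\<omega>. W \<omega> t - W \<omega> 0) = s"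
proof (cases "s = 0 \<or> s = t")
  case True
  then show ?thesis using increment_moments(3)[of 0 s] assms by (auto simp: power2_eq_square)
next
  case False
  then have st: "0 < s" "s < t" using assms by auto
  let ?t = "\<lambda>i::nat. if i = 0 then 0 else if i = 1 then s else t"
  have grid: "unit_grid 2 ?t" using st assms by (auto simp: unit_grid_def less_2_cases_iff)
  note past = increment_moments[of 0 s] and future = increment_moments[of s t]
  have "sq_inner M (\<lambda>\<omega>. W \<omega> s - W \<omega> 0) (\<lambda>\<omega>. W \<omega> t - W \<omega> s) = 0"
    using sq_inner_indep_vars[OF grid_increments(1)[OF grid], of 0 1] past future st assms
    by (simp add: sq_integrable_imp_integrable)
  moreover have "sq_inner M (\<lambda>\<omega>. W \<omega> s - W \<omega> 0) (\<lambda>\<omega>. W \<omega> t - W \<omega> 0) =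
      (\<integral>\<omega>. (W \<omega> s - W \<omega> 0)\<^sup>2 + (W \<omega> s - W \<omega> 0) * (W \<omega> t - W \<omega> s) \<partial>M)"
    by (intro Bochner_Integration.integral_cong refl) (simp add: power2_eq_square algebra_simps)
  ultimately show ?thesis
    using past(1,3) future(1) st assms by (simp add: sq_integrable_square sq_integrable_mult)
qed

lemma covariance:
  assumes "s \<in> {0..1}" "t \<in> {0..1}"
  shows "sq_inner M (\<lambda>\<omega>. W \<omega> s - W \<omega> 0) (\<lambda>\<omega>. W \<omega> t - W \<omega> 0) = min s t"
  using covariance_ordered[of s t] covariance_ordered[of t s] assms
  by (cases "s \<le> t") (simp_all add: mult.commute)

lemma increment_covariance:
  assumes "0 \<le> a" "a \<le> b" "b \<le> 1" "0 \<le> c" "c \<le> d" "d \<le> 1"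
  shows "sq_inner M (\<lambda>\<omega>. W \<omega> b - W \<omega> a) (\<lambda>\<omega>. W \<omega> d - W \<omega> c) =
    sq_inner unit_leb (indicat_real {a..<b}) (indicat_real {c..<d})"
proof -
  let ?B = "\<lambda>t \<omega>. W \<omega> t - W \<omega> 0"
  have int: "integrable M (\<lambda>\<omega>. ?B s \<omega> * ?B t \<omega>)" if "s \<in> {0..1}" "t \<in> {0..1}" for s t
    using that by (intro sq_integrable_mult increment_moments(1)) auto
  have "sq_inner M (\<lambda>\<omega>. W \<omega> b - W \<omega> a) (\<lambda>\<omega>. W \<omega> d - W \<omega> c) =
     (\<integral>\<omega>. ?B b \<omega> * ?B d \<omega> - ?B b \<omega> * ?B c \<omega> - ?B a \<omega> * ?B d \<omega> + ?B a \<omega> * ?B c \<omega> \<partial>M)"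
    by (intro Bochner_Integration.integral_cong refl) (simp add: algebra_simps)
  also have "\<dots> = min b d - min b c - min a d + min a c"
    using assms int[of b d] int[of b c] int[of a d] int[of a c]
      covariance[of b d] covariance[of b c] covariance[of a d] covariance[of a c] by simp
  also have "\<dots> = max 0 (min b d - max a c)" using assms by (auto simp: min_def max_def)
  finally show ?thesis using assms by (simp only: sq_inner_indicator_Ico)
qed

lemma sq_integrable_step_integral:
  assumes "\<And>i. i \<in> I \<Longrightarrow> 0 \<le> a i \<and> a i \<le> b i \<and> b i \<le> 1"
  shows "sq_integrable M (\<lambda>\<omega>. \<Sum>i\<in>I. c i * (W \<omega> (b i) - W \<omega> (a i)))"
  by (intro sq_integrable_sum sq_integrable_cmult increment_moments(1)) (use assms in auto)

lemma step_integral_isometry: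
  assumes ab: "\<And>i. i \<in> I \<Longrightarrow> 0 \<le> a i \<and> a i \<le> b i \<and> b i \<le> 1"
  shows "sq_norm M (\<lambda>\<omega>. \<Sum>i\<in>I. c i * (W \<omega> (b i) - W \<omega> (a i))) =
    sq_norm unit_leb (\<lambda>x. \<Sum>i\<in>I. c i * indicat_real {a i..<b i} x)"
proof -
  have "sq_norm M (\<lambda>\<omega>. \<Sum>i\<in>I. c i * (W \<omega> (b i) - W \<omega> (a i))) =
      (\<Sum>i\<in>I. \<Sum>j\<in>I. c i * (c j * sq_inner M (\<lambda>\<omega>. W \<omega> (b j) - W \<omega> (a j)) (\<lambda>\<omega>. W \<omega> (b i) - W \<omega> (a i))))"
    using ab by (intro sq_norm_sum increment_moments(1)) auto
  also have "\<dots> = (\<Sum>i\<in>I. \<Sum>j\<in>I. c i * (c j * sq_inner unit_leb (indicat_real {a j..<b j}) (indicat_real {a i..<b i})))"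
    using ab by (intro sum.cong refl arg_cong2[where f="(*)"] increment_covariance) auto
  also have "\<dots> = sq_norm unit_leb (\<lambda>x. \<Sum>i\<in>I. c i * indicat_real {a i..<b i} x)"
    by (rule sq_norm_sum[symmetric]) (rule sq_integrable_indicator_Ico)
  finally show ?thesis .
qed

lemma sq_integrable_dyadic_sum: "sq_integrable M (\<lambda>\<omega>. dyadic_sum \<phi> (W \<omega>) k)"
  unfolding dyadic_sum_def by (rule sq_integrable_step_integral) (use dyadic_endpoints in auto)

lemma sq_norm_dyadic_sum: "sq_norm M (\<lambda>\<omega>. dyadic_sum \<phi> (W \<omega>) k) = sq_norm unit_leb (dyadic_step \<phi> k)"
  unfolding dyadic_sum_def dyadic_step_def dyadic_combination_def dyadic_interval_def
  by (rule step_integral_isometry) (use dyadic_endpoints in auto)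

lemma dyadic_sum_isometry:
  "sq_norm M (\<lambda>\<omega>. dyadic_sum \<phi> (W \<omega>) k - dyadic_sum \<phi> (W \<omega>) l) =
    sq_norm unit_leb (\<lambda>x. dyadic_step \<phi> k x - dyadic_step \<phi> l x)"
proof -
  let ?I = "{..<2^k::nat} <+> {..<2^l::nat}"
  let ?c = "case_sum (dyadic_coef \<phi> k) (\<lambda>m. - dyadic_coef \<phi> l m)"
  let ?a = "case_sum (\<lambda>m. real m / 2^k) (\<lambda>m. real m / 2^l)"
  let ?b = "case_sum (\<lambda>m. real (Suc m) / 2^k) (\<lambda>m. real (Suc m) / 2^l)"
  have "sq_norm M (\<lambda>\<omega>. \<Sum>i\<in>?I. ?c i * (W \<omega> (?b i) - W \<omega> (?a i))) =
      sq_norm unit_leb (\<lambda>x. \<Sum>i\<in>?I. ?c i * indicat_real {?a i..<?b i} x)"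
    using dyadic_endpoints by (intro step_integral_isometry) (auto simp del: of_nat_Suc)
  then show ?thesis
    by (simp add: sum.Plus dyadic_sum_def dyadic_step_def dyadic_combination_def dyadic_interval_def sum_negf
        del: of_nat_Suc sum_mult_indicator)
qed

lemma L2_tendsto_dyadic_sum:
  assumes \<phi>: "sq_integrable unit_leb \<phi>"
  shows "L2_tendsto M (\<lambda>k \<omega>. dyadic_sum \<phi> (W \<omega>) k) (\<lambda>\<omega>. wiener_int \<phi> (W \<omega>))"
  unfolding wiener_int_def
  using fast_L2_Cauchy_dyadic_subseq[OF \<phi>]
  by (intro L2_tendsto_lim_fast_subseq sq_integrable_dyadic_sum) (simp add: fast_L2_Cauchy_subseq_def dyadic_sum_isometry)

lemma expectation_dyadic_sum: "expectation (\<lambda>\<omega>. dyadic_sum \<phi> (W \<omega>) k) = 0"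
proof -
  have "sq_integrable M (\<lambda>\<omega>. W \<omega> (real (Suc m) / 2^k) - W \<omega> (real m / 2^k))"
    "expectation (\<lambda>\<omega>. W \<omega> (real (Suc m) / 2^k) - W \<omega> (real m / 2^k)) = 0" if "m < 2^k" for m
    using dyadic_endpoints[OF that] increment_moments(1,2)[of "real m / 2^k" "real (Suc m) / 2^k"] by auto
  then show ?thesis unfolding dyadic_sum_def
    by (subst Bochner_Integration.integral_sum) (auto simp: sq_integrable_imp_integrable simp del: of_nat_Suc)
qed

lemma expectation_wiener_int:
  assumes \<phi>: "sq_integrable unit_leb \<phi>"
  shows "expectation (\<lambda>\<omega>. wiener_int \<phi> (W \<omega>)) = 0"
  using L2_tendsto_inner[OF L2_tendsto_dyadic_sum[OF \<phi>] sq_integrable_const[of 1]]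
  by (simp add: expectation_dyadic_sum LIMSEQ_const_iff)

lemma sq_norm_wiener_int:
  assumes \<phi>: "sq_integrable unit_leb \<phi>"
  shows "sq_norm M (\<lambda>\<omega>. wiener_int \<phi> (W \<omega>)) = sq_norm unit_leb \<phi>"
  using L2_tendsto_sq_norm[OF L2_tendsto_dyadic_sum[OF \<phi>]] L2_tendsto_sq_norm[OF L2_tendsto_dyadic_step[OF \<phi>]]
  unfolding sq_norm_dyadic_sum by (rule LIMSEQ_unique)

lemma sq_integrable_wiener_int: "sq_integrable unit_leb \<phi> \<Longrightarrow> sq_integrable M (\<lambda>\<omega>. wiener_int \<phi> (W \<omega>))"
  by (rule L2_tendstoD(2)[OF L2_tendsto_dyadic_sum])

lemma wiener_int_combination_AE:
  assumes e: "\<And>j. j \<in> J \<Longrightarrow> sq_integrable unit_leb (e j)"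
  shows "AE \<omega> in M. wiener_int (\<lambda>x. \<Sum>j\<in>J. v j * e j x) (W \<omega>) = (\<Sum>j\<in>J. v j * wiener_int (e j) (W \<omega>))"
proof (rule L2_tendsto_unique)
  show "L2_tendsto M (\<lambda>k \<omega>. dyadic_sum (\<lambda>x. \<Sum>j\<in>J. v j * e j x) (W \<omega>) k)
      (\<lambda>\<omega>. wiener_int (\<lambda>x. \<Sum>j\<in>J. v j * e j x) (W \<omega>))"
    by (intro L2_tendsto_dyadic_sum sq_integrable_sum sq_integrable_cmult e)
  show "L2_tendsto M (\<lambda>k \<omega>. dyadic_sum (\<lambda>x. \<Sum>j\<in>J. v j * e j x) (W \<omega>) k)
      (\<lambda>\<omega>. \<Sum>j\<in>J. v j * wiener_int (e j) (W \<omega>))"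
    by (simp only: dyadic_sum_combination[OF e]) (intro L2_tendsto_sum L2_tendsto_cmult L2_tendsto_dyadic_sum e)
qed

lemma char_dyadic_sum:
  "char (distr M borel (\<lambda>\<omega>. dyadic_sum \<phi> (W \<omega>) k)) t = normal_char (sq_norm unit_leb (dyadic_step \<phi> k)) t"
proof -
  let ?t = "\<lambda>m::nat. real m / 2^k"
  have "char (distr M borel (\<lambda>\<omega>. \<Sum>m<2^k. dyadic_coef \<phi> k m * (W \<omega> (?t (Suc m)) - W \<omega> (?t m)))) t =
     normal_char (\<Sum>m<2^k. (dyadic_coef \<phi> k m)\<^sup>2 * (sqrt (?t (Suc m) - ?t m))\<^sup>2) t"
    using grid_increments[OF unit_grid_dyadic[of k]]
    by (intro char_sum_indep_normal) (auto simp: divide_strict_right_mono)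
  moreover have "(sqrt (?t (Suc m) - ?t m))\<^sup>2 = 1 / 2^k" for m
    by (simp add: diff_divide_distrib[symmetric])
  ultimately show ?thesis by (simp add: sq_norm_dyadic_step dyadic_sum_def del: of_nat_Suc)
qed

lemma char_wiener_int:
  assumes \<phi>: "sq_integrable unit_leb \<phi>"
  shows "char (distr M borel (\<lambda>\<omega>. wiener_int \<phi> (W \<omega>))) t = normal_char (sq_norm unit_leb \<phi>) t"
proof (rule LIMSEQ_unique[OF L2_tendsto_char[OF L2_tendsto_dyadic_sum[OF \<phi>]]])
  show "(\<lambda>k. char (distr M borel (\<lambda>\<omega>. dyadic_sum \<phi> (W \<omega>) k)) t) \<longlonglongrightarrow> normal_char (sq_norm unit_leb \<phi>) t"
    unfolding char_dyadic_sum normal_char_def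
    by (intro tendsto_intros L2_tendsto_sq_norm L2_tendsto_dyadic_step \<phi>) simp
qed

lemma prob_wiener_int_combination_ge:
  assumes J: "finite J" and e: "orthogonal_family unit_leb J e (\<lambda>_. 1)" and v: "L2_set v J > 0"
  shows "prob {\<omega> \<in> space M. x \<le> (\<Sum>j\<in>J. v j * wiener_int (e j) (W \<omega>))} = normal_tail (x / L2_set v J)"
proof -
  define \<psi> where "\<psi> u = (\<Sum>j\<in>J. v j * e j u)" for u
  note e_sq = orthogonal_familyD(1)[OF e]
  have \<psi>: "sq_integrable unit_leb \<psi>" unfolding \<psi>_def by (intro sq_integrable_sum sq_integrable_cmult e_sq)
  have norm: "sq_norm unit_leb \<psi> = (\<Sum>j\<in>J. (v j)\<^sup>2)"
    unfolding \<psi>_def by (simp add: sq_norm_orthogonal_sum[OF J e])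
  note [measurable] = sq_integrable_wiener_int[OF \<psi>, THEN sq_integrable_measurable]
    sq_integrable_wiener_int[OF e_sq, THEN sq_integrable_measurable]
  have combination: "AE \<omega> in M. wiener_int \<psi> (W \<omega>) = (\<Sum>j\<in>J. v j * wiener_int (e j) (W \<omega>))"
    unfolding \<psi>_def[abs_def] by (intro wiener_int_combination_AE e_sq)
  have "prob {\<omega> \<in> space M. x \<le> (\<Sum>j\<in>J. v j * wiener_int (e j) (W \<omega>))} = prob {\<omega> \<in> space M. x \<le> wiener_int \<psi> (W \<omega>)}"
    using combination by (intro finite_measure_eq_AE) auto
  also have "\<dots> = normal_tail (x / sqrt (sq_norm unit_leb \<psi>))"
    using v char_wiener_int[OF \<psi>] by (intro prob_ge_of_normal_char) (auto simp: norm L2_set_def)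
  finally show ?thesis by (simp add: norm L2_set_def)
qed

lemma L2_tendsto_dyadic_sum_obs_path:
  assumes \<phi>: "sq_integrable unit_leb \<phi>" and f: "sq_integrable unit_leb f" and g: "sq_integrable unit_leb g"
    and Y[measurable]: "Y \<in> measurable M (count_space UNIV)"
  shows "L2_tendsto M (\<lambda>k \<omega>. dyadic_sum \<phi> (obs_path f g W Y \<omega>) k)
    (\<lambda>\<omega>. (if Y \<omega> then l2_inner \<phi> f else l2_inner \<phi> g) + wiener_int \<phi> (W \<omega>))"
proof -
  have obs: "dyadic_sum \<phi> (obs_path f g W Y \<omega>) k = sq_inner unit_leb (dyadic_step \<phi> k) f * of_bool (Y \<omega>) +
      sq_inner unit_leb (dyadic_step \<phi> k) g * of_bool (\<not> Y \<omega>) + dyadic_sum \<phi> (W \<omega>) k" for k \<omega>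
  proof -
    have "dyadic_sum \<phi> (obs_path f g W Y \<omega>) k = dyadic_sum \<phi> (\<lambda>t. (if Y \<omega> then drift f else drift g) t + W \<omega> t) k"
      unfolding obs_path_def by (rule dyadic_sum_cong) simp
    also have "\<dots> = dyadic_sum \<phi> (if Y \<omega> then drift f else drift g) k + dyadic_sum \<phi> (W \<omega>) k"
      by (rule dyadic_sum_add)
    finally show ?thesis by (simp add: dyadic_sum_drift f g)
  qed
  have limit: "(if Y \<omega> then l2_inner \<phi> f else l2_inner \<phi> g) + wiener_int \<phi> (W \<omega>) =
      sq_inner unit_leb \<phi> f * of_bool (Y \<omega>) + sq_inner unit_leb \<phi> g * of_bool (\<not> Y \<omega>) + wiener_int \<phi> (W \<omega>)" for \<omega>
    by (simp add: l2_inner_eq \<phi> f g)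
  have label: "sq_integrable M (\<lambda>\<omega>. of_bool (Y \<omega>))" "sq_integrable M (\<lambda>\<omega>. of_bool (\<not> Y \<omega>))"
    by (rule sq_integrable_bounded[where K=1]; simp)+
  show ?thesis
    unfolding obs limit
    by (intro L2_tendsto_add L2_tendsto_mult_const L2_tendsto_inner L2_tendsto_dyadic_step L2_tendsto_dyadic_sum
        label \<phi> f g)
qed

end

section \<open>Total variation between shifted Brownian paths\<close>

subsection \<open>Reduction to a generating algebra\<close>

lemma (in finite_measure) measure_UN_diff_finite_UN_tendsto:
  fixes A :: "nat \<Rightarrow> 'a set"
  assumes A: "range A \<subseteq> sets M"
  shows "(\<lambda>n. measure M ((\<Union>i. A i) - (\<Union>i<n. A i))) \<longlonglongrightarrow> 0"
proof -
  have "(\<lambda>n. measure M ((\<Union>i. A i) - (\<Union>i<n. A i))) \<longlonglongrightarrow> measure M (\<Inter>n. (\<Union>i. A i) - (\<Union>i<n. A i))"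
  proof (rule finite_Lim_measure_decseq)
    show "range (\<lambda>n. (\<Union>i. A i) - (\<Union>i<n. A i)) \<subseteq> sets M" using A by auto
    show "decseq (\<lambda>n. (\<Union>i. A i) - (\<Union>i<n. A i))" by (rule decseq_SucI) auto
  qed
  moreover have "(\<Inter>n. (\<Union>i. A i) - (\<Union>i<n. A i)) = {}" by blast
  ultimately show ?thesis by (simp only: measure_empty)
qed

lemma (in finite_measure) measure_sym_diff_UN_le:
  fixes A :: "nat \<Rightarrow> 'a set"
  assumes A: "range A \<subseteq> sets M" and B: "range B \<subseteq> sets M"
  shows "measure M (sym_diff (\<Union>i. A i) (\<Union>i<n. B i)) \<le>
    measure M ((\<Union>i. A i) - (\<Union>i<n. A i)) + (\<Sum>i<n. measure M (sym_diff (A i) (B i)))"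
proof -
  have AB_sets: "A i \<in> sets M" "B i \<in> sets M" for i using A B by auto
  have "measure M (sym_diff (\<Union>i. A i) (\<Union>i<n. B i)) \<le>
      measure M (((\<Union>i. A i) - (\<Union>i<n. A i)) \<union> (\<Union>i<n. sym_diff (A i) (B i)))"
    using AB_sets by (intro finite_measure_mono) (blast, auto)
  also have "\<dots> \<le> measure M ((\<Union>i. A i) - (\<Union>i<n. A i)) + measure M (\<Union>i<n. sym_diff (A i) (B i))"
    using AB_sets by (intro measure_Un_le) auto
  also have "measure M (\<Union>i<n. sym_diff (A i) (B i)) \<le> (\<Sum>i<n. measure M (sym_diff (A i) (B i)))"
    using AB_sets by (intro finite_measure_subadditive_finite) auto
  finally show ?thesis by simp
qed

lemma UN_approximation:
  fixes A :: "nat \<Rightarrow> 'a set"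
  assumes I: "finite I" and N: "\<And>i. i \<in> I \<Longrightarrow> finite_measure (N i)" and A: "\<And>i. i \<in> I \<Longrightarrow> range A \<subseteq> sets (N i)"
    and \<A>: "\<And>i. i \<in> I \<Longrightarrow> \<A> \<subseteq> sets (N i)"
    and approx: "\<And>k e. e > 0 \<Longrightarrow> \<exists>B\<in>\<A>. \<forall>i\<in>I. measure (N i) (sym_diff (A k) B) < e" and e: "e > 0"
  shows "\<exists>B (n::nat). (\<forall>k. B k \<in> \<A>) \<and> (\<forall>i\<in>I. measure (N i) (sym_diff (\<Union>k. A k) (\<Union>k<n. B k)) < e)"
proof -
  have "\<forall>\<^sub>F n in sequentially. measure (N i) ((\<Union>i. A i) - (\<Union>i<n. A i)) < e / 2" if "i \<in> I" for i
    using order_tendstoD(2)[OF finite_measure.measure_UN_diff_finite_UN_tendsto[OF N A], of i "e / 2"] that e by simp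
  then have "\<forall>\<^sub>F n in sequentially. \<forall>i\<in>I. measure (N i) ((\<Union>i. A i) - (\<Union>i<n. A i)) < e / 2"
    using I by (simp add: eventually_ball_finite_distrib)
  then obtain n where n: "\<And>i. i \<in> I \<Longrightarrow> measure (N i) ((\<Union>i. A i) - (\<Union>i<n. A i)) < e / 2"
    by (auto simp: eventually_sequentially)
  define \<epsilon> where "\<epsilon> = e / (2 * real (Suc n))"
  have "\<epsilon> > 0" using e by (simp add: \<epsilon>_def)
  then have "\<forall>k. \<exists>B\<in>\<A>. \<forall>i\<in>I. measure (N i) (sym_diff (A k) B) < \<epsilon>"
    using approx by simp
  then obtain B where B: "\<And>k. B k \<in> \<A>" "\<And>k i. i \<in> I \<Longrightarrow> measure (N i) (sym_diff (A k) (B k)) < \<epsilon>"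
    unfolding bchoice_iff Bex_def by metis
  have "measure (N i) (sym_diff (\<Union>k. A k) (\<Union>k<n. B k)) < e" if i: "i \<in> I" for i
  proof -
    have "measure (N i) (sym_diff (\<Union>k. A k) (\<Union>k<n. B k)) \<le>
        measure (N i) ((\<Union>k. A k) - (\<Union>k<n. A k)) + (\<Sum>k<n. measure (N i) (sym_diff (A k) (B k)))"
      using B(1) \<A>[OF i] by (intro finite_measure.measure_sym_diff_UN_le N A i) auto
    also have "(\<Sum>k<n. measure (N i) (sym_diff (A k) (B k))) \<le> (\<Sum>k<n. \<epsilon>)"
      using B(2)[OF i] by (intro sum_mono less_imp_le)
    also have "\<dots> \<le> e / 2" using e by (simp add: \<epsilon>_def field_simps)
    finally show ?thesis using n[OF i] by simp
  qed
  with B(1) show ?thesis by (intro exI[of _ B] exI[of _ n]) auto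
qed

lemma sigma_sets_approximation:
  assumes alg: "algebra \<Omega> \<A>" and I: "finite I"
    and N: "\<And>i. i \<in> I \<Longrightarrow> finite_measure (N i)" "\<And>i. i \<in> I \<Longrightarrow> sets (N i) = sigma_sets \<Omega> \<A>"
    and A: "A \<in> sigma_sets \<Omega> \<A>" and e: "e > 0"
  shows "\<exists>B\<in>\<A>. \<forall>i\<in>I. measure (N i) (sym_diff A B) < e"
proof -
  interpret algebra \<Omega> \<A> by (rule alg)
  show ?thesis using A e
  proof (induction arbitrary: e rule: sigma_sets.induct)
    case (Basic A)
    then show ?case by (intro bexI[of _ A]) auto
  next
    case Empty
    then show ?case by (intro bexI[of _ "{}"]) auto
  next
    case (Compl A)
    then obtain B where B: "B \<in> \<A>" "\<forall>i\<in>I. measure (N i) (sym_diff A B) < e" by blast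
    have "sym_diff (\<Omega> - A) (\<Omega> - B) = sym_diff A B"
      using sets_into_space[OF B(1)] sigma_sets_into_sp[OF space_closed Compl.hyps] by blast
    then show ?case using B by (intro bexI[of _ "\<Omega> - B"]) auto
  next
    case (Union A)
    have subsets: "range A \<subseteq> sets (N i)" "\<A> \<subseteq> sets (N i)" if "i \<in> I" for i using Union.hyps N(2)[OF that] by auto
    have "\<exists>B (n::nat). (\<forall>k. B k \<in> \<A>) \<and> (\<forall>i\<in>I. measure (N i) (sym_diff (\<Union>k. A k) (\<Union>k<n. B k)) < e)"
      by (rule UN_approximation[OF I N(1) subsets Union.IH Union.prems])
    then obtain B and n :: nat where B: "\<forall>k. B k \<in> \<A>"
      and approx: "\<forall>i\<in>I. measure (N i) (sym_diff (\<Union>k. A k) (\<Union>k<n. B k)) < e" by (elim exE conjE)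
    have "(\<Union>k<n. B k) \<in> \<A>" using B by (intro finite_UN) auto
    then show ?case using approx by (intro bexI[of _ "\<Union>k<n. B k"]) auto
  qed
qed

lemma measure_diff_le_of_algebra:
  assumes alg: "algebra \<Omega> \<A>" and fin: "finite_measure P" "finite_measure Q"
    and sets: "sets P = sigma_sets \<Omega> \<A>" "sets Q = sigma_sets \<Omega> \<A>"
    and le_on_algebra: "\<And>B. B \<in> \<A> \<Longrightarrow> measure P B - measure Q B \<le> K" and A: "A \<in> sigma_sets \<Omega> \<A>"
  shows "measure P A - measure Q A \<le> K"
proof (rule field_le_epsilon)
  fix e :: real assume "e > 0"
  then have "\<exists>B\<in>\<A>. \<forall>b\<in>UNIV. measure (case_bool P Q b) (sym_diff A B) < e / 2"
    using fin sets by (intro sigma_sets_approximation[OF alg _ _ _ A]) (simp_all split: bool.split)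
  then obtain B where B: "B \<in> \<A>" and approx: "\<And>b. measure (case_bool P Q b) (sym_diff A B) < e / 2" by blast
  interpret P: finite_measure P by (rule fin)
  interpret Q: finite_measure Q by (rule fin)
  have AB_sets: "A \<in> sets P" "B \<in> sets P" "A \<in> sets Q" "B \<in> sets Q"
    using A sigma_sets.Basic[OF B] by (simp_all add: sets)
  then have sym_diff_sets: "sym_diff A B \<in> sets P" "sym_diff A B \<in> sets Q" by auto
  have "measure P A \<le> measure P (B \<union> sym_diff A B)" using AB_sets sym_diff_sets by (intro P.finite_measure_mono) blast+
  also have "\<dots> \<le> measure P B + measure P (sym_diff A B)" using AB_sets sym_diff_sets by (intro measure_Un_le)
  finally have P_le: "measure P A \<le> measure P B + measure P (sym_diff A B)" .
  have "measure Q B \<le> measure Q (A \<union> sym_diff A B)" using AB_sets sym_diff_sets by (intro Q.finite_measure_mono) blast+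
  also have "\<dots> \<le> measure Q A + measure Q (sym_diff A B)" using AB_sets sym_diff_sets by (intro measure_Un_le)
  finally show "measure P A - measure Q A \<le> K + e"
    using P_le le_on_algebra[OF B] approx[of True] approx[of False] by simp
qed

subsection \<open>Shifted Gaussian vectors\<close>

lemma density_PiM:
  fixes N :: "'i \<Rightarrow> 'b measure"
  assumes I: "finite I" and N: "\<And>i. i \<in> I \<Longrightarrow> prob_space (N i)"
    and L: "\<And>i. i \<in> I \<Longrightarrow> L i \<in> borel_measurable (N i)" and NL: "\<And>i. i \<in> I \<Longrightarrow> prob_space (density (N i) (L i))"
  shows "PiM I (\<lambda>i. density (N i) (L i)) = density (PiM I N) (\<lambda>x. \<Prod>i\<in>I. L i (x i))"
proof -
  let ?N = "\<lambda>i. if i \<in> I then N i else return (count_space UNIV) undefined"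
  let ?NL = "\<lambda>i. if i \<in> I then density (N i) (L i) else return (count_space UNIV) undefined"
  have "prob_space (?N i)" "prob_space (?NL i)" for i
    using N NL by (auto intro: prob_space_return)
  then interpret N: product_prob_space ?N I + NL: product_prob_space ?NL I
    by (auto intro!: product_prob_spaceI simp del: if_split)
  have [measurable]: "(\<lambda>x. \<Prod>i\<in>I. L i (x i)) \<in> borel_measurable (PiM I ?N)"
    using L by (intro borel_measurable_prod_ennreal measurable_compose[OF measurable_component_singleton]) auto
  have "density (PiM I ?N) (\<lambda>x. \<Prod>i\<in>I. L i (x i)) = PiM I ?NL"
  proof (rule NL.PiM_eqI[OF I])
    show "sets (density (PiM I ?N) (\<lambda>x. \<Prod>i\<in>I. L i (x i))) = sets (PiM I ?NL)"
      by (auto intro!: sets_PiM_cong)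
    fix A assume "\<And>i. i \<in> I \<Longrightarrow> A i \<in> sets (?NL i)"
    then have A: "A i \<in> sets (N i)" if "i \<in> I" for i using that by fastforce
    have "emeasure (density (PiM I ?N) (\<lambda>x. \<Prod>i\<in>I. L i (x i))) (Pi\<^sub>E I A) =
      (\<integral>\<^sup>+x. (\<Prod>i\<in>I. L i (x i)) * indicator (Pi\<^sub>E I A) x \<partial>PiM I ?N)"
      using I A by (intro emeasure_density sets_PiM_I_finite) auto
    also have "\<dots> = (\<integral>\<^sup>+x. (\<Prod>i\<in>I. L i (x i) * indicator (A i) (x i)) \<partial>PiM I ?N)"
    proof (rule nn_integral_cong)
      fix x assume "x \<in> space (PiM I ?N)"
      then have "x \<in> extensional I" by (auto simp: space_PiM PiE_def)
      then have "indicator (Pi\<^sub>E I A) x = (\<Prod>i\<in>I. indicator (A i) (x i) :: ennreal)"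
        using I by (auto simp: indicator_def PiE_def Pi_iff prod_zero_iff)
      then show "(\<Prod>i\<in>I. L i (x i)) * indicator (Pi\<^sub>E I A) x = (\<Prod>i\<in>I. L i (x i) * indicator (A i) (x i))"
        by (simp add: prod.distrib)
    qed
    also have "\<dots> = (\<Prod>i\<in>I. \<integral>\<^sup>+x. L i x * indicator (A i) x \<partial>?N i)"
      using I L A by (intro N.product_nn_integral_prod) auto
    also have "\<dots> = (\<Prod>i\<in>I. emeasure (?NL i) (A i))"
      using L A by (intro prod.cong refl) (simp add: emeasure_density)
    finally show "emeasure (density (PiM I ?N) (\<lambda>x. \<Prod>i\<in>I. L i (x i))) (Pi\<^sub>E I A) = (\<Prod>i\<in>I. emeasure (?NL i) (A i))" .
  qed
  moreover have "PiM I ?N = PiM I N" "PiM I ?NL = PiM I (\<lambda>i. density (N i) (L i))" by (auto intro!: PiM_cong)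
  ultimately show ?thesis by simp
qed

lemma density_normal_shift:
  assumes \<sigma>: "\<sigma> > 0"
  shows "density (density lborel (normal_density 0 \<sigma>)) (\<lambda>x. ennreal (exp (a * x / \<sigma>\<^sup>2 - a\<^sup>2 / (2 * \<sigma>\<^sup>2)))) =
    density lborel (normal_density a \<sigma>)"
proof -
  have "normal_density 0 \<sigma> x * exp (a * x / \<sigma>\<^sup>2 - a\<^sup>2 / (2 * \<sigma>\<^sup>2)) = normal_density a \<sigma> x" for x
  proof -
    have "- (x - a)\<^sup>2 / (2 * \<sigma>\<^sup>2) = - (x - 0)\<^sup>2 / (2 * \<sigma>\<^sup>2) + (a * x / \<sigma>\<^sup>2 - a\<^sup>2 / (2 * \<sigma>\<^sup>2))"
      using \<sigma> by (simp add: field_simps power2_eq_square)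
    then show ?thesis by (simp only: normal_density_def exp_add mult.assoc)
  qed
  then show ?thesis by (subst density_density_eq) (auto simp flip: ennreal_mult)
qed

lemma (in prob_space) distr_indep_normal:
  assumes indep: "indep_vars (\<lambda>_. borel) U I" and I: "I \<noteq> {}"
    and U: "\<And>i. i \<in> I \<Longrightarrow> distributed M lborel (U i) (normal_density (\<mu> i) (\<sigma> i))"
  shows "distr M (\<Pi>\<^sub>M i\<in>I. borel) (\<lambda>\<omega>. \<lambda>i\<in>I. U i \<omega>) = (\<Pi>\<^sub>M i\<in>I. density lborel (normal_density (\<mu> i) (\<sigma> i)))"
proof -
  have "U i \<in> borel_measurable M" if "i \<in> I" for i
    using distributed_measurable[OF U[OF that]] by simp
  then have "distr M (\<Pi>\<^sub>M i\<in>I. borel) (\<lambda>\<omega>. \<lambda>i\<in>I. U i \<omega>) = (\<Pi>\<^sub>M i\<in>I. distr M borel (U i))"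
    using indep I by (simp add: indep_vars_iff_distr_eq_PiM')
  also have "\<dots> = (\<Pi>\<^sub>M i\<in>I. density lborel (normal_density (\<mu> i) (\<sigma> i)))"
  proof (intro PiM_cong refl)
    fix i assume i: "i \<in> I"
    have "distr M borel (U i) = distr M lborel (U i)" by (intro distr_cong) auto
    then show "distr M borel (U i) = density lborel (normal_density (\<mu> i) (\<sigma> i))"
      using U[OF i] by (simp add: distributed_def)
  qed
  finally show ?thesis .
qed

lemma (in prob_space) gaussian_shift_density:
  assumes I: "finite I" "I \<noteq> {}" and indep: "indep_vars (\<lambda>_. borel) U I"
    and U: "\<And>i. i \<in> I \<Longrightarrow> distributed M lborel (U i) (normal_density 0 (\<sigma> i))" and \<sigma>: "\<And>i. i \<in> I \<Longrightarrow> \<sigma> i > 0"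
  shows "distr M (\<Pi>\<^sub>M i\<in>I. borel) (\<lambda>\<omega>. \<lambda>i\<in>I. U i \<omega> + a i) =
    density (distr M (\<Pi>\<^sub>M i\<in>I. borel) (\<lambda>\<omega>. \<lambda>i\<in>I. U i \<omega>))
      (\<lambda>x. ennreal (exp ((\<Sum>i\<in>I. a i * x i / (\<sigma> i)\<^sup>2) - (\<Sum>i\<in>I. (a i)\<^sup>2 / (\<sigma> i)\<^sup>2) / 2)))"
proof -
  let ?N = "\<lambda>i. density lborel (normal_density 0 (\<sigma> i))"
  let ?L = "\<lambda>i x. ennreal (exp (a i * x / (\<sigma> i)\<^sup>2 - (a i)\<^sup>2 / (2 * (\<sigma> i)\<^sup>2)))"
  have shifted: "distributed M lborel (\<lambda>\<omega>. U i \<omega> + a i) (normal_density (a i) (\<sigma> i))" if "i \<in> I" for i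
    using normal_density_affine[OF U[OF that] \<sigma>[OF that], of 1 "a i"] by (simp add: add.commute)
  have indep_shifted: "indep_vars (\<lambda>_. borel) (\<lambda>i \<omega>. U i \<omega> + a i) I"
    by (rule indep_vars_compose2[OF indep, of "\<lambda>i x. x + a i"]) auto
  have "distr M (\<Pi>\<^sub>M i\<in>I. borel) (\<lambda>\<omega>. \<lambda>i\<in>I. U i \<omega> + a i) = (\<Pi>\<^sub>M i\<in>I. density lborel (normal_density (a i) (\<sigma> i)))"
    by (rule distr_indep_normal[OF indep_shifted I(2) shifted])
  also have "\<dots> = (\<Pi>\<^sub>M i\<in>I. density (?N i) (?L i))"
    by (intro PiM_cong refl) (simp add: density_normal_shift \<sigma>)
  also have "\<dots> = density (PiM I ?N) (\<lambda>x. \<Prod>i\<in>I. ?L i (x i))"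
    using \<sigma> by (intro density_PiM I) (auto simp: density_normal_shift prob_space_normal_density)
  also have "(\<lambda>x. \<Prod>i\<in>I. ?L i (x i)) =
      (\<lambda>x. ennreal (exp ((\<Sum>i\<in>I. a i * x i / (\<sigma> i)\<^sup>2) - (\<Sum>i\<in>I. (a i)\<^sup>2 / (\<sigma> i)\<^sup>2) / 2)))"
    by (simp add: prod_ennreal I exp_sum[symmetric] sum_subtractf sum_divide_distrib mult.commute)
  finally show ?thesis by (simp only: distr_indep_normal[OF indep I(2) U])
qed

lemma (in prob_space) neyman_pearson:
  assumes l[measurable]: "l \<in> borel_measurable M" and l_nonneg: "\<And>x. 0 \<le> l x"
    and finite_density: "finite_measure (density M (\<lambda>x. ennreal (l x)))" and B[measurable]: "B \<in> events"
  defines "Q \<equiv> density M (\<lambda>x. ennreal (l x))" and "T \<equiv> {x \<in> space M. 1 \<le> l x}"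
  shows "measure Q B - prob B \<le> measure Q T - prob T"
proof -
  interpret Q: finite_measure Q using finite_density by (simp add: Q_def)
  have T[measurable]: "T \<in> events" unfolding T_def by measurable
  have "(\<integral>\<^sup>+x. ennreal (norm (l x)) \<partial>M) = (\<integral>\<^sup>+x. ennreal (l x) * indicator (space M) x \<partial>M)"
    by (intro nn_integral_cong) (simp add: l_nonneg)
  also have "\<dots> = emeasure Q (space M)" unfolding Q_def by (intro emeasure_density[symmetric]) auto
  also have "\<dots> < \<infinity>" by (simp add: less_top[symmetric])
  finally have l_int: "integrable M l" by (intro integrableI_bounded l)
  have integrable_on: "integrable M (\<lambda>x. l x * indicat_real A x)" if "A \<in> events" for A
    using integrable_mult_indicator[OF that l_int] by (simp add: mult.commute)
  have diff: "measure Q A - prob A = (\<integral>x. l x * indicat_real A x - indicat_real A x \<partial>M)" if A[measurable]: "A \<in> events" for A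
  proof -
    have "measure Q A = (\<integral>x. indicat_real A x \<partial>Q)" by (simp add: Q_def)
    also have "\<dots> = (\<integral>x. l x *\<^sub>R indicat_real A x \<partial>M)"
      unfolding Q_def by (intro integral_density) (auto simp: l_nonneg)
    finally show ?thesis using integrable_on[OF A] by (simp add: emeasure_eq_measure)
  qed
  have "measure Q B - prob B = (\<integral>x. l x * indicat_real B x - indicat_real B x \<partial>M)" by (rule diff[OF B])
  also have "\<dots> \<le> (\<integral>x. l x * indicat_real T x - indicat_real T x \<partial>M)"
  proof (rule integral_mono)
    show "l x * indicat_real B x - indicat_real B x \<le> l x * indicat_real T x - indicat_real T x" if "x \<in> space M" for x
      using that by (auto simp: T_def indicator_def)
  qed (use integrable_on[OF B] integrable_on[OF T] in \<open>auto simp: emeasure_eq_measure\<close>)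
  also have "\<dots> = measure Q T - prob T" by (rule diff[OF T, symmetric])
  finally show ?thesis .
qed

lemma (in prob_space) prob_indep_normal_combination_ge:
  assumes I: "finite I" and indep: "indep_vars (\<lambda>_. borel) U I"
    and U: "\<And>i. i \<in> I \<Longrightarrow> distributed M lborel (U i) (normal_density 0 (\<sigma> i))" and \<sigma>: "\<And>i. i \<in> I \<Longrightarrow> \<sigma> i > 0"
    and v: "(\<Sum>i\<in>I. (c i)\<^sup>2 * (\<sigma> i)\<^sup>2) = v" "v > 0"
  shows "prob {\<omega> \<in> space M. x \<le> (\<Sum>i\<in>I. c i * U i \<omega>)} = normal_tail (x / sqrt v)"
proof (rule prob_ge_of_normal_char[OF _ v(2)])
  show "(\<lambda>\<omega>. \<Sum>i\<in>I. c i * U i \<omega>) \<in> borel_measurable M"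
    using U[THEN distributed_measurable] by simp
qed (use char_sum_indep_normal[OF indep I U \<sigma>, of c] v(1) in simp)

lemma (in prob_space) gaussian_shift_tv:
  assumes I: "finite I" and indep: "indep_vars (\<lambda>_. borel) U I"
    and U: "\<And>i. i \<in> I \<Longrightarrow> distributed M lborel (U i) (normal_density 0 (\<sigma> i))" and \<sigma>: "\<And>i. i \<in> I \<Longrightarrow> \<sigma> i > 0"
    and B: "B \<in> sets (\<Pi>\<^sub>M i\<in>I. borel)" and v: "v = (\<Sum>i\<in>I. (a i)\<^sup>2 / (\<sigma> i)\<^sup>2)" "v > 0"
  shows "prob {\<omega>\<in>space M. (\<lambda>i\<in>I. U i \<omega> + a i) \<in> B} - prob {\<omega>\<in>space M. (\<lambda>i\<in>I. U i \<omega>) \<in> B}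
    \<le> 1 - 2 * normal_tail (sqrt v / 2)"
proof -
  let ?P = "\<Pi>\<^sub>M i\<in>I. (borel :: real measure)"
  have [measurable]: "U i \<in> borel_measurable M" if "i \<in> I" for i
    using distributed_measurable[OF U[OF that]] by simp
  define c where "c i = a i / (\<sigma> i)\<^sup>2" for i
  define l where "l x = exp ((\<Sum>i\<in>I. c i * x i) - v / 2)" for x
  define T where "T = {x \<in> space ?P. v / 2 \<le> (\<Sum>i\<in>I. c i * x i)}"
  define D where "D b = distr M ?P (\<lambda>\<omega>. \<lambda>i\<in>I. U i \<omega> + b i)" for b
  have vector_measurable: "(\<lambda>\<omega>. \<lambda>i\<in>I. U i \<omega> + b i) \<in> measurable M ?P" for b by measurable
  have measure_D: "measure (D b) A = prob {\<omega>\<in>space M. (\<lambda>i\<in>I. U i \<omega> + b i) \<in> A}" if "A \<in> sets ?P" for b A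
    unfolding D_def using vector_measurable that by (simp add: measure_distr vimage_def Int_def conj_commute)
  have [measurable]: "l \<in> borel_measurable ?P" "T \<in> sets ?P" unfolding l_def T_def by measurable
  have "I \<noteq> {}" using v by auto
  then have density_D: "D a = density (D (\<lambda>_. 0)) (\<lambda>x. ennreal (l x))"
    unfolding D_def l_def c_def v(1) using gaussian_shift_density[OF I _ indep U \<sigma>, of a] by simp
  interpret D: prob_space "D b" for b unfolding D_def by (rule prob_space_distr[OF vector_measurable])
  have "measure (D a) B - measure (D (\<lambda>_. 0)) B \<le> measure (D a) T - measure (D (\<lambda>_. 0)) T"
    using D.neyman_pearson[of l "\<lambda>_. 0" B] B D.finite_measure_axioms[of a] unfolding density_D[symmetric]
    by (simp add: l_def T_def D_def)
  moreover have "measure (D (\<lambda>_. 0)) T = normal_tail (sqrt v / 2)" and "measure (D a) T = 1 - normal_tail (sqrt v / 2)"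
  proof -
    have variance: "(\<Sum>i\<in>I. (c i)\<^sup>2 * (\<sigma> i)\<^sup>2) = v" and mean: "(\<Sum>i\<in>I. c i * a i) = v"
      unfolding v(1) c_def by (intro sum.cong refl; use \<sigma> in \<open>force simp: power2_eq_square field_simps\<close>)+
    have measure_T: "measure (D b) T = normal_tail ((v / 2 - (\<Sum>i\<in>I. c i * b i)) / sqrt v)" for b
    proof -
      have "measure (D b) T = prob {\<omega> \<in> space M. v / 2 - (\<Sum>i\<in>I. c i * b i) \<le> (\<Sum>i\<in>I. c i * U i \<omega>)}"
        unfolding measure_D[OF \<open>T \<in> sets ?P\<close>]
        by (intro arg_cong[where f=prob]) (auto simp: T_def space_PiM distrib_left sum.distrib)
      then show ?thesis by (simp only: prob_indep_normal_combination_ge[OF I indep U \<sigma> variance v(2)])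
    qed
    have half: "v / 2 / sqrt v = sqrt v / 2" using v(2) by (simp add: real_div_sqrt)
    then show "measure (D (\<lambda>_. 0)) T = normal_tail (sqrt v / 2)"
      by (simp only: measure_T mult_zero_right sum.neutral_const diff_zero)
    have "(v / 2 - v) / sqrt v = - (sqrt v / 2)" unfolding half[symmetric] by (simp add: field_simps)
    then show "measure (D a) T = 1 - normal_tail (sqrt v / 2)" by (simp only: measure_T mean normal_tail_minus)
  qed
  ultimately show ?thesis by (simp add: measure_D[OF B])
qed

lemma (in prob_space) gaussian_shifts_tv:
  assumes I: "finite I" and indep: "indep_vars (\<lambda>_. borel) U I"
    and U: "\<And>i. i \<in> I \<Longrightarrow> distributed M lborel (U i) (normal_density 0 (\<sigma> i))" and \<sigma>: "\<And>i. i \<in> I \<Longrightarrow> \<sigma> i > 0"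
    and B: "B \<in> sets (\<Pi>\<^sub>M i\<in>I. borel)"
  shows "prob {\<omega>\<in>space M. (\<lambda>i\<in>I. U i \<omega> + a i) \<in> B} - prob {\<omega>\<in>space M. (\<lambda>i\<in>I. U i \<omega> + b i) \<in> B}
    \<le> 1 - 2 * normal_tail (sqrt (\<Sum>i\<in>I. (a i - b i)\<^sup>2 / (\<sigma> i)\<^sup>2) / 2)"
proof (cases "(\<Sum>i\<in>I. (a i - b i)\<^sup>2 / (\<sigma> i)\<^sup>2) = 0")
  case True
  then have "\<forall>i\<in>I. (a i - b i)\<^sup>2 / (\<sigma> i)\<^sup>2 = 0"
    using I by (subst (asm) sum_nonneg_eq_0_iff) auto
  then have "a i = b i" if "i \<in> I" for i using that \<sigma>[OF that] by auto
  then have "(\<lambda>i\<in>I. U i \<omega> + a i) = (\<lambda>i\<in>I. U i \<omega> + b i)" for \<omega> by (intro restrict_ext) auto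
  then show ?thesis using True by (simp add: normal_tail_0)
next
  case False
  then have v: "(\<Sum>i\<in>I. (a i - b i)\<^sup>2 / (\<sigma> i)\<^sup>2) > 0" by (simp add: sum_nonneg order.strict_iff_order)
  let ?P = "\<Pi>\<^sub>M i\<in>I. (borel :: real measure)"
  define B' where "B' = (\<lambda>y. \<lambda>i\<in>I. y i + b i) -` B \<inter> space ?P"
  have "(\<lambda>y. \<lambda>i\<in>I. y i + b i) \<in> measurable ?P ?P"
    by (intro measurable_restrict borel_measurable_add measurable_component_singleton) auto
  then have B': "B' \<in> sets ?P" unfolding B'_def using B by (rule measurable_sets)
  have "(\<lambda>i\<in>I. U i \<omega> + (a i - b i)) \<in> B' \<longleftrightarrow> (\<lambda>i\<in>I. U i \<omega> + a i) \<in> B"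
    "(\<lambda>i\<in>I. U i \<omega>) \<in> B' \<longleftrightarrow> (\<lambda>i\<in>I. U i \<omega> + b i) \<in> B" for \<omega>
    by (auto simp: B'_def space_PiM restrict_def cong: if_cong)
  then show ?thesis using gaussian_shift_tv[OF I indep U \<sigma> B' refl v] by simp
qed

subsection \<open>Paths with a drift\<close>

definition shift_path :: "(real \<Rightarrow> real) \<Rightarrow> (real \<Rightarrow> real) \<Rightarrow> real \<Rightarrow> real" where
  "shift_path h x = restrict (\<lambda>t. drift h t + x t) {0..1}"

lemma shift_path_measurable [measurable]: "shift_path h \<in> measurable traj_space traj_space"
  unfolding shift_path_def traj_space_def
  by (intro measurable_restrict borel_measurable_add measurable_component_singleton) auto

lemma shift_path_restrict: "shift_path h (restrict x {0..1}) = shift_path h x"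
  unfolding shift_path_def by (intro restrict_ext) auto

lemma shift_path_grid:
  assumes h: "sq_integrable unit_leb h" and t: "unit_grid k t" "t 0 = 0" and x: "x 0 = 0" and m: "m \<le> k"
  shows "shift_path h x (t m) = (\<Sum>i<m. (x (t (Suc i)) - x (t i)) + (drift h (t (Suc i)) - drift h (t i)))"
proof -
  have "(\<Sum>i<m. (x (t (Suc i)) - x (t i)) + (drift h (t (Suc i)) - drift h (t i))) =
      (x (t m) - x (t 0)) + (drift h (t m) - drift h (t 0))"
    by (simp only: sum.distrib sum_lessThan_telescope[of "\<lambda>i. x (t i)"] sum_lessThan_telescope[of "\<lambda>i. drift h (t i)"])
  then show ?thesis using unit_grid_mem[OF t(1) m] by (simp add: shift_path_def t(2) x drift_0[OF h])
qed

lemma restrict_shift_path_eq_increments: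
  assumes h: "sq_integrable unit_leb h" and t: "unit_grid k t" "t 0 = 0" and x: "x 0 = 0"
    and index: "\<And>u. u \<in> J \<Longrightarrow> index u \<le> k" "\<And>u. u \<in> J \<Longrightarrow> t (index u) = u"
  shows "restrict (shift_path h x) J =
    (\<lambda>u\<in>J. \<Sum>i<index u. (\<lambda>i\<in>{..<k}. (x (t (Suc i)) - x (t i)) + (drift h (t (Suc i)) - drift h (t i))) i)"
proof (rule restrict_ext)
  fix u assume u: "u \<in> J"
  then show "shift_path h x u = (\<Sum>i<index u. (\<lambda>i\<in>{..<k}. (x (t (Suc i)) - x (t i)) + (drift h (t (Suc i)) - drift h (t i))) i)"
    using shift_path_grid[where x=x, OF h t x index(1)[OF u]] index[OF u] by (auto intro!: sum.cong)
qed

lemma finite_subset_unit_grid: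
  assumes J: "finite J" "J \<subseteq> {0..1}"
  obtains k t where "unit_grid k t" "t 0 = 0" "J \<subseteq> t ` {..k}"
proof -
  have "\<exists>l. set l = A \<and> sorted_wrt (<) l" if "finite A" for A :: "real set"
    using that by (intro exI[of _ "sorted_list_of_set A"]) simp
  then obtain l where l: "set l = insert 0 J" "sorted_wrt (<) l" using J(1) by (meson finite.insertI)
  define k where "k = length l - 1"
  have length: "length l = Suc k" using l(1) by (cases l) (auto simp: k_def)
  have mono: "l ! i < l ! j" if "i < j" "j < Suc k" for i j
    using sorted_wrt_nth_less[OF l(2)] that length by simp
  have mem: "l ! i \<in> {0..1}" if "i < Suc k" for i
    using nth_mem[of i l] that J by (auto simp: length l(1))
  have image: "insert 0 J = (!) l ` {..k}"
    using l(1) length by (auto simp: set_conv_nth less_Suc_eq_le)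
  then obtain i where i: "i \<le> k" "l ! i = 0" by (metis atMost_iff image_iff insertI1)
  then have "i = 0" using mono[of 0 i] mem[of 0] by (cases i) auto
  then show thesis using image mono mem[of k] i by (intro that[of k "(!) l"]) (auto simp: unit_grid_def)
qed

context brownian
begin

lemma restrict_W_measurable: "J \<subseteq> {0..1} \<Longrightarrow> (\<lambda>\<omega>. restrict (W \<omega>) J) \<in> measurable M (\<Pi>\<^sub>M t\<in>J. borel)"
  by (intro measurable_restrict W_measurable) auto

lemma shift_path_W_measurable: "(\<lambda>\<omega>. shift_path h (W \<omega>)) \<in> measurable M traj_space"
  unfolding shift_path_def traj_space_def by (intro measurable_restrict borel_measurable_add W_measurable) auto

lemma cylinder_event_increments:
  assumes J: "finite J" "J \<subseteq> {0..1}" and A: "A \<in> sets (\<Pi>\<^sub>M t\<in>J. borel)"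
  obtains k t B where "unit_grid k t" "B \<in> sets (\<Pi>\<^sub>M i\<in>{..<k}. borel)"
    "\<And>h. sq_integrable unit_leb h \<Longrightarrow> prob {\<omega>\<in>space M. restrict (shift_path h (W \<omega>)) J \<in> A} =
      prob {\<omega>\<in>space M. (\<lambda>i\<in>{..<k}. (W \<omega> (t (Suc i)) - W \<omega> (t i)) + (drift h (t (Suc i)) - drift h (t i))) \<in> B}"
proof -
  obtain k t where t: "unit_grid k t" "t 0 = 0" "J \<subseteq> t ` {..k}" using finite_subset_unit_grid[OF J] .
  then have "\<forall>x\<in>J. \<exists>i\<le>k. t i = x" by auto
  then obtain index where index: "\<And>x. x \<in> J \<Longrightarrow> index x \<le> k" "\<And>x. x \<in> J \<Longrightarrow> t (index x) = x" by metis
  let ?P = "\<Pi>\<^sub>M i\<in>{..<k}. (borel :: real measure)"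
  define reading where "reading y = (\<lambda>x\<in>J. \<Sum>i<index x. y i)" for y :: "nat \<Rightarrow> real"
  define inc where "inc h \<omega> = (\<lambda>i\<in>{..<k}. (W \<omega> (t (Suc i)) - W \<omega> (t i)) + (drift h (t (Suc i)) - drift h (t i)))" for h \<omega>
  have reading: "reading \<in> measurable ?P (\<Pi>\<^sub>M t\<in>J. borel)"
    unfolding reading_def using index(1)
    by (intro measurable_restrict borel_measurable_sum measurable_component_singleton) (force intro: less_le_trans)
  have inc: "inc h \<in> measurable M ?P" for h
    unfolding inc_def using unit_grid_mem[OF t(1)]
    by (intro measurable_restrict borel_measurable_add borel_measurable_diff W_measurable borel_measurable_const) auto
  define B where "B = reading -` A \<inter> space ?P"
  have B: "B \<in> sets ?P" unfolding B_def using reading A by (rule measurable_sets)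
  have path_eq: "AE \<omega> in M. restrict (shift_path h (W \<omega>)) J = reading (inc h \<omega>)" if h: "sq_integrable unit_leb h" for h
    using W_0
    by eventually_elim (simp only: reading_def inc_def restrict_shift_path_eq_increments[where index=index, OF h t(1,2) _ index])
  have "prob {\<omega>\<in>space M. restrict (shift_path h (W \<omega>)) J \<in> A} = prob {\<omega>\<in>space M. inc h \<omega> \<in> B}"
    if h: "sq_integrable unit_leb h" for h
  proof (rule finite_measure_eq_AE)
    show "AE \<omega> in M. (\<omega> \<in> {\<omega>\<in>space M. restrict (shift_path h (W \<omega>)) J \<in> A}) = (\<omega> \<in> {\<omega>\<in>space M. inc h \<omega> \<in> B})"
      using path_eq[OF h] AE_space by eventually_elim (use measurable_space[OF inc] in \<open>auto simp: B_def\<close>)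
    have "(\<lambda>\<omega>. restrict (shift_path h (W \<omega>)) J) \<in> measurable M (\<Pi>\<^sub>M t\<in>J. borel)"
      using measurable_compose[OF shift_path_W_measurable[of h, unfolded traj_space_def] measurable_restrict_subset[OF J(2)]]
      by simp
    from measurable_sets[OF this A] measurable_sets[OF inc B, of h]
    show "{\<omega>\<in>space M. restrict (shift_path h (W \<omega>)) J \<in> A} \<in> events" "{\<omega>\<in>space M. inc h \<omega> \<in> B} \<in> events"
      by (simp_all add: vimage_def Int_def conj_commute)
  qed
  then show thesis unfolding inc_def by (rule that[OF t(1) B])
qed

lemma cylinder_tv:
  assumes f: "sq_integrable unit_leb f" and g: "sq_integrable unit_leb g"
    and J: "finite J" "J \<subseteq> {0..1}" and A: "A \<in> sets (\<Pi>\<^sub>M t\<in>J. borel)"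
  shows "prob {\<omega>\<in>space M. restrict (shift_path f (W \<omega>)) J \<in> A} - prob {\<omega>\<in>space M. restrict (shift_path g (W \<omega>)) J \<in> A}
    \<le> 1 - 2 * normal_tail (sqrt (sq_norm unit_leb (\<lambda>x. f x - g x)) / 2)"
proof -
  obtain k t B where t: "unit_grid k t" and B: "B \<in> sets (\<Pi>\<^sub>M i\<in>{..<k}. borel)"
    and increments: "\<And>h. sq_integrable unit_leb h \<Longrightarrow> prob {\<omega>\<in>space M. restrict (shift_path h (W \<omega>)) J \<in> A} =
      prob {\<omega>\<in>space M. (\<lambda>i\<in>{..<k}. (W \<omega> (t (Suc i)) - W \<omega> (t i)) + (drift h (t (Suc i)) - drift h (t i))) \<in> B}"
    by (rule cylinder_event_increments[OF J A]) (rule that)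
  let ?\<sigma> = "\<lambda>i. sqrt (t (Suc i) - t i)"
  let ?inc = "\<lambda>h i. drift h (t (Suc i)) - drift h (t i)"
  have pos: "t i < t (Suc i)" if "i < k" for i using t that by (simp add: unit_grid_def)
  have "prob {\<omega>\<in>space M. restrict (shift_path f (W \<omega>)) J \<in> A} - prob {\<omega>\<in>space M. restrict (shift_path g (W \<omega>)) J \<in> A}
    \<le> 1 - 2 * normal_tail (sqrt (\<Sum>i<k. (?inc f i - ?inc g i)\<^sup>2 / (?\<sigma> i)\<^sup>2) / 2)"
    unfolding increments[OF f] increments[OF g]
    by (intro gaussian_shifts_tv[OF finite_lessThan grid_increments(1)[OF t]] grid_increments(2)[OF t] B) (auto simp: pos)
  also have "(\<Sum>i<k. (?inc f i - ?inc g i)\<^sup>2 / (?\<sigma> i)\<^sup>2) = (\<Sum>i<k. (?inc (\<lambda>x. f x - g x) i)\<^sup>2 / (t (Suc i) - t i))"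
    using unit_grid_mem[OF t] pos by (intro sum.cong refl) (simp add: drift_minus[OF f g] algebra_simps less_imp_le)
  also have "1 - 2 * normal_tail (sqrt \<dots> / 2) \<le> 1 - 2 * normal_tail (sqrt (sq_norm unit_leb (\<lambda>x. f x - g x)) / 2)"
    using sum_sq_drift_increments_le[OF sq_integrable_diff[OF f g] t] normal_tail_antimono by simp
  finally show ?thesis .
qed

lemma projective_family_path: "projective_family {0..1} (\<lambda>J. distr M (\<Pi>\<^sub>M t\<in>J. borel) (\<lambda>\<omega>. restrict (W \<omega>) J)) (\<lambda>_. borel)"
proof (rule projective_family.intro)
  show "distr M (\<Pi>\<^sub>M t\<in>J. borel) (\<lambda>\<omega>. restrict (W \<omega>) J) =
      distr (distr M (\<Pi>\<^sub>M t\<in>H. borel) (\<lambda>\<omega>. restrict (W \<omega>) H)) (\<Pi>\<^sub>M t\<in>J. borel) (\<lambda>x. restrict x J)"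
    if "J \<subseteq> H" "H \<subseteq> {0..1}" for J H
    using that by (subst distr_distr)
      (auto intro!: restrict_W_measurable measurable_restrict_subset distr_cong simp: Int_absorb1)
  show "prob_space (distr M (\<Pi>\<^sub>M t\<in>J. borel) (\<lambda>\<omega>. restrict (W \<omega>) J))" if "J \<subseteq> {0..1}" for J
    using that by (intro prob_space_distr restrict_W_measurable)
qed

lemma path_tv:
  assumes f: "sq_integrable unit_leb f" and g: "sq_integrable unit_leb g" and A: "A \<in> sets traj_space"
  shows "prob {\<omega>\<in>space M. shift_path f (W \<omega>) \<in> A} - prob {\<omega>\<in>space M. shift_path g (W \<omega>) \<in> A}
    \<le> 1 - 2 * normal_tail (sqrt (sq_norm unit_leb (\<lambda>x. f x - g x)) / 2)" (is "_ \<le> ?K")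
proof -
  interpret cylinders: projective_family "{0..1}" "\<lambda>J. distr M (\<Pi>\<^sub>M t\<in>J. borel) (\<lambda>\<omega>. restrict (W \<omega>) J)" "\<lambda>_. borel"
    by (rule projective_family_path)
  have sets: "sets traj_space = sigma_sets (space traj_space) cylinders.generator"
    unfolding traj_space_def by (rule cylinders.sets_PiM_generator)
  define law where "law h = distr M traj_space (\<lambda>\<omega>. shift_path h (W \<omega>))" for h
  have measure_law: "measure (law h) B = prob {\<omega>\<in>space M. shift_path h (W \<omega>) \<in> B}" if "B \<in> sets traj_space" for h B
    unfolding law_def using that shift_path_W_measurable[of h] by (simp add: measure_distr vimage_def Int_def conj_commute)
  have "measure (law f) A - measure (law g) A \<le> ?K"
  proof (rule measure_diff_le_of_algebra)
    show "algebra (space traj_space) cylinders.generator"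
      unfolding traj_space_def by (rule cylinders.algebra_generator)
    show "finite_measure (law f)" "finite_measure (law g)"
      unfolding law_def by (intro prob_space.finite_measure prob_space_distr shift_path_W_measurable)+
    show "measure (law f) B - measure (law g) B \<le> ?K" if "B \<in> cylinders.generator" for B
      using that
    proof cases
      case (1 J X)
      have "B \<in> sets traj_space" unfolding sets using that by (rule sigma_sets.Basic)
      moreover have "shift_path h x \<in> B \<longleftrightarrow> restrict (shift_path h x) J \<in> X" for h x
        unfolding 1 prod_emb_iff by (auto simp: shift_path_def)
      ultimately show ?thesis using cylinder_tv[OF f g 1(2-4)] by (simp add: measure_law)
    qed
  qed (use A sets in \<open>auto simp: law_def\<close>)
  then show ?thesis by (simp only: measure_law[OF A])
qed

end

section \<open>Truncation bias and the geometry of the plug-in rule\<close>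

locale L2_basis =
  fixes \<phi> :: "nat \<Rightarrow> real \<Rightarrow> real"
  assumes basis: "orthonormal_basis_L2 \<phi>"
begin

lemma sq_integrable_basis: "j \<ge> 1 \<Longrightarrow> sq_integrable unit_leb (\<phi> j)"
  using basis by (auto simp: orthonormal_basis_L2_def L2_01_iff)

lemma orthogonal_family_basis: "orthogonal_family unit_leb {1..} \<phi> (\<lambda>_. 1)"
proof -
  have "sq_inner unit_leb (\<phi> i) (\<phi> j) = (if i = j then 1 else 0)" if "i \<ge> 1" "j \<ge> 1" for i j
    using basis that unfolding orthonormal_basis_L2_def l2_inner_eq[OF sq_integrable_basis sq_integrable_basis, OF that, symmetric]
    by blast
  then show ?thesis by (simp add: orthogonal_family_def sq_integrable_basis)
qed

lemma basis_total:
  assumes h: "sq_integrable unit_leb h" and "\<And>j. j \<ge> 1 \<Longrightarrow> sq_inner unit_leb (\<phi> j) h = 0"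
  shows "sq_norm unit_leb h = 0"
proof -
  have "l2_norm h = 0"
    using basis assms sq_integrable_basis by (auto simp: orthonormal_basis_L2_def L2_01_iff l2_inner_eq)
  then show ?thesis by (simp add: l2_norm_eq[OF h])
qed

lemma coef_diff_Parseval:
  assumes f: "sq_integrable unit_leb f" and g: "sq_integrable unit_leb g"
  shows "(\<lambda>d. \<Sum>j=1..d. (l2_inner (\<phi> j) f - l2_inner (\<phi> j) g)\<^sup>2) \<longlonglongrightarrow> sq_norm unit_leb (\<lambda>x. f x - g x)"
proof -
  have "sq_inner unit_leb (\<phi> j) (\<lambda>x. f x - g x) = l2_inner (\<phi> j) f - l2_inner (\<phi> j) g" if "j \<ge> 1" for j
    using sq_integrable_mult[OF sq_integrable_basis[OF that] f] sq_integrable_mult[OF sq_integrable_basis[OF that] g]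
    by (simp add: l2_inner_eq[OF sq_integrable_basis[OF that]] f g right_diff_distrib)
  then show ?thesis
    using unit_leb.Parseval_identity[OF orthogonal_family_basis sq_integrable_diff[OF f g] basis_total] by simp
qed

lemma sum_sq_coef_diff_le:
  assumes f: "sq_integrable unit_leb f" and g: "sq_integrable unit_leb g"
  shows "(\<Sum>j=1..d. (l2_inner (\<phi> j) f - l2_inner (\<phi> j) g)\<^sup>2) \<le> sq_norm unit_leb (\<lambda>x. f x - g x)"
  by (rule incseq_le[OF incseq_SucI coef_diff_Parseval[OF f g]]) simp

lemma sobolev_class_sum_le:
  assumes h: "h \<in> sobolev_class \<phi> s R" and J: "finite J" "J \<subseteq> {1..}"
  shows "(\<Sum>j\<in>J. (l2_inner (\<phi> j) h)\<^sup>2 * real j powr (2 * s)) \<le> R\<^sup>2"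
proof -
  have "(\<Sum>j\<in>J. (l2_inner (\<phi> j) h)\<^sup>2 * real j powr (2 * s)) \<le> (\<Sum>\<^sub>\<infinity>j\<in>{1..}. (l2_inner (\<phi> j) h)\<^sup>2 * real j powr (2 * s))"
    using h J by (intro finite_sum_le_infsum) (auto simp: sobolev_class_def)
  then show ?thesis using h by (simp add: sobolev_class_def)
qed

lemma sobolev_class_sq_integrable: "h \<in> sobolev_class \<phi> s R \<Longrightarrow> sq_integrable unit_leb h"
  by (simp add: sobolev_class_def L2_01_iff)

lemma sobolev_coef_diff_tail_le:
  assumes f: "f \<in> sobolev_class \<phi> s R" and g: "g \<in> sobolev_class \<phi> s R" and s: "s > 0"
  shows "(\<Sum>j=Suc d..K. (l2_inner (\<phi> j) f - l2_inner (\<phi> j) g)\<^sup>2) \<le> 4 * R\<^sup>2 * real (Suc d) powr (- 2 * s)"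
proof -
  let ?c = "\<lambda>h j. l2_inner (\<phi> j) h"
  let ?m = "real (Suc d) powr (2 * s)"
  have "?m * (\<Sum>j=Suc d..K. (?c f j - ?c g j)\<^sup>2) \<le>
      (\<Sum>j=Suc d..K. 2 * ((?c f j)\<^sup>2 * real j powr (2 * s)) + 2 * ((?c g j)\<^sup>2 * real j powr (2 * s)))"
    unfolding sum_distrib_left
  proof (rule sum_mono)
    fix j assume j: "j \<in> {Suc d..K}"
    have "?m \<le> real j powr (2 * s)" using j s by (intro powr_mono2) auto
    then have "?m * (?c f j - ?c g j)\<^sup>2 \<le> real j powr (2 * s) * (2 * (?c f j)\<^sup>2 + 2 * (?c g j)\<^sup>2)"
      using square_add_le[of "?c f j" "- ?c g j"] by (intro mult_mono) auto
    then show "?m * (?c f j - ?c g j)\<^sup>2 \<le> 2 * ((?c f j)\<^sup>2 * real j powr (2 * s)) + 2 * ((?c g j)\<^sup>2 * real j powr (2 * s))"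
      by (simp add: algebra_simps)
  qed
  also have "\<dots> \<le> 2 * R\<^sup>2 + 2 * R\<^sup>2"
    unfolding sum.distrib sum_distrib_left[symmetric]
    by (intro add_mono mult_left_mono sobolev_class_sum_le f g) auto
  finally have "(\<Sum>j=Suc d..K. (?c f j - ?c g j)\<^sup>2) \<le> 4 * R\<^sup>2 / ?m"
    by (simp add: pos_le_divide_eq mult.commute)
  then show ?thesis by (simp add: powr_minus divide_inverse)
qed

lemma sobolev_bias_le:
  assumes f: "f \<in> sobolev_class \<phi> s R" and g: "g \<in> sobolev_class \<phi> s R" and s: "s > 0"
  shows "sq_norm unit_leb (\<lambda>x. f x - g x) - (\<Sum>j=1..d. (l2_inner (\<phi> j) f - l2_inner (\<phi> j) g)\<^sup>2)
    \<le> 4 * R\<^sup>2 * real (Suc d) powr (- 2 * s)"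
proof (rule LIMSEQ_le_const2)
  let ?S = "\<lambda>K. \<Sum>j=1..K. (l2_inner (\<phi> j) f - l2_inner (\<phi> j) g)\<^sup>2"
  show "(\<lambda>K. ?S K - ?S d) \<longlonglongrightarrow> sq_norm unit_leb (\<lambda>x. f x - g x) - ?S d"
    by (intro tendsto_diff tendsto_const coef_diff_Parseval sobolev_class_sq_integrable[OF f] sobolev_class_sq_integrable[OF g])
  have "?S K - ?S d = (\<Sum>j=Suc d..K. (l2_inner (\<phi> j) f - l2_inner (\<phi> j) g)\<^sup>2)" if "K \<ge> d" for K
  proof -
    have split: "{1..K} = {1..d} \<union> {Suc d..K}" using that by auto
    show ?thesis unfolding split by (subst sum.union_disjoint) auto
  qed
  then have "?S K - ?S d \<le> 4 * R\<^sup>2 * real (Suc d) powr (- 2 * s)" if "K \<ge> d" for K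
    using sobolev_coef_diff_tail_le[OF f g s] that by simp
  then show "\<exists>N. \<forall>K\<ge>N. ?S K - ?S d \<le> 4 * R\<^sup>2 * real (Suc d) powr (- 2 * s)" by blast
qed

end

subsection \<open>Components along the estimated direction\<close>

text \<open>The component along the zero vector is \<open>0\<close>.\<close>

definition component_along :: "'i set \<Rightarrow> ('i \<Rightarrow> real) \<Rightarrow> ('i \<Rightarrow> real) \<Rightarrow> real" where
  "component_along J v y = (\<Sum>j\<in>J. v j * y j) / L2_set v J"

lemma component_along_add: "component_along J v x + component_along J v y = component_along J v (\<lambda>j. x j + y j)"
  by (simp add: component_along_def distrib_left sum.distrib add_divide_distrib)

lemma component_along_diff: "component_along J v x - component_along J v y = component_along J v (\<lambda>j. x j - y j)"
  by (simp add: component_along_def right_diff_distrib sum_subtractf diff_divide_distrib)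

lemma L2_set_power2: "(L2_set x J)\<^sup>2 = (\<Sum>j\<in>J. (x j)\<^sup>2)"
  by (simp add: L2_set_def sum_nonneg)

lemma L2_set_uminus: "L2_set (\<lambda>j. - x j) J = L2_set x J"
  by (simp add: L2_set_def)

lemma L2_set_triangle_ineq_diff: "L2_set (\<lambda>j. x j - y j) J \<le> L2_set x J + L2_set y J"
  using L2_set_triangle_ineq[of x "\<lambda>j. - y j" J] by (simp add: L2_set_uminus)

lemma abs_component_along_le: "\<bar>component_along J v y\<bar> \<le> L2_set y J"
proof (cases "L2_set v J = 0")
  case False
  then have "L2_set v J > 0" by (simp add: order.strict_iff_order)
  moreover have "\<bar>\<Sum>j\<in>J. v j * y j\<bar> \<le> L2_set v J * L2_set y J"
    using sum_abs[of "\<lambda>j. v j * y j" J] L2_set_mult_ineq[of v y J] by (simp add: abs_mult)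
  ultimately show ?thesis by (simp add: component_along_def abs_divide divide_le_eq mult.commute)
qed (simp add: component_along_def)

text \<open>With \<open>p\<close> the component of \<open>u\<close> along \<open>v\<close>, Pythagoras gives \<open>\<parallel>v - u\<parallel>\<^sup>2 = (\<parallel>v\<parallel> - p)\<^sup>2 + (\<parallel>u\<parallel>\<^sup>2 - p\<^sup>2)\<close>.\<close>

lemma component_along_deficit:
  assumes J: "finite J"
  shows "L2_set u J * (L2_set u J - component_along J v u) \<le> 2 * (L2_set (\<lambda>j. v j - u j) J)\<^sup>2"
proof -
  let ?D = "L2_set u J" and ?V = "L2_set v J" and ?w = "(L2_set (\<lambda>j. v j - u j) J)\<^sup>2"
  define p where "p = component_along J v u"
  have p_le: "\<bar>p\<bar> \<le> ?D" unfolding p_def by (rule abs_component_along_le)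
  have "p * ?V = (\<Sum>j\<in>J. v j * u j)"
    using J by (cases "?V = 0") (simp_all add: p_def component_along_def L2_set_eq_0_iff)
  then have "?w = ?V\<^sup>2 - 2 * (p * ?V) + ?D\<^sup>2"
    unfolding L2_set_power2 by (simp add: power2_diff sum.distrib sum_subtractf sum_distrib_left mult.assoc)
  then have pythagoras: "?w = (?V - p)\<^sup>2 + (?D\<^sup>2 - p\<^sup>2)" by (simp add: power2_diff)
  have "?D * (?D - p) \<le> 2 * ?w"
  proof (cases "p \<ge> 0")
    case True
    have "p * p \<le> ?D * p" using p_le True by (intro mult_right_mono) auto
    then have "?D * (?D - p) \<le> ?D\<^sup>2 - p\<^sup>2" by (simp add: power2_eq_square algebra_simps)
    also have "\<dots> \<le> 2 * ?w" using pythagoras zero_le_power2[of "?V - p"]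
      zero_le_power2[of "L2_set (\<lambda>j. v j - u j) J"] by linarith
    finally show ?thesis .
  next
    case False
    then have "p\<^sup>2 \<le> (?V - p)\<^sup>2" by (subst abs_le_square_iff[symmetric]) (use L2_set_nonneg[of v J] in linarith)
    then have "?D\<^sup>2 \<le> ?w" using pythagoras by simp
    moreover have "?D * (?D - p) \<le> ?D * (2 * ?D)" using p_le by (intro mult_left_mono) auto
    ultimately show ?thesis by (simp add: power2_eq_square)
  qed
  then show ?thesis by (simp add: p_def)
qed

definition nearest_centroid :: "'i set \<Rightarrow> ('i \<Rightarrow> real) \<Rightarrow> ('i \<Rightarrow> real) \<Rightarrow> ('i \<Rightarrow> real) \<Rightarrow> bool" where
  "nearest_centroid J \<theta> \<mu> z \<longleftrightarrow> L2_set (\<lambda>j. z j - \<theta> j) J \<le> L2_set (\<lambda>j. z j - \<mu> j) J"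

lemma nearest_centroid_iff:
  "nearest_centroid J \<theta> \<mu> z \<longleftrightarrow> 0 \<le> (\<Sum>j\<in>J. (\<theta> j - \<mu> j) * (z j - (\<theta> j + \<mu> j) / 2))"
proof -
  have "nearest_centroid J \<theta> \<mu> z \<longleftrightarrow> 0 \<le> (\<Sum>j\<in>J. (z j - \<mu> j)\<^sup>2) - (\<Sum>j\<in>J. (z j - \<theta> j)\<^sup>2)"
    by (simp add: nearest_centroid_def L2_set_def)
  also have "(\<Sum>j\<in>J. (z j - \<mu> j)\<^sup>2) - (\<Sum>j\<in>J. (z j - \<theta> j)\<^sup>2) = 2 * (\<Sum>j\<in>J. (\<theta> j - \<mu> j) * (z j - (\<theta> j + \<mu> j) / 2))"
    unfolding sum_subtractf[symmetric] sum_distrib_left by (intro sum.cong refl) (simp add: power2_eq_square field_simps)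
  finally show ?thesis by simp
qed

text \<open>\<open>signed_margin J \<theta>' \<mu>' c\<close> is the signed distance of \<open>c\<close> from the decision boundary of the rule with centroids
  \<open>\<theta>'\<close> and \<open>\<mu>'\<close>, positive on the side of \<open>\<theta>'\<close>.\<close>

definition signed_margin :: "'i set \<Rightarrow> ('i \<Rightarrow> real) \<Rightarrow> ('i \<Rightarrow> real) \<Rightarrow> ('i \<Rightarrow> real) \<Rightarrow> real" where
  "signed_margin J \<theta>' \<mu>' c = component_along J (\<lambda>j. \<theta>' j - \<mu>' j) (\<lambda>j. c j - (\<theta>' j + \<mu>' j) / 2)"

lemma signed_margin_diff:
  "signed_margin J \<theta>' \<mu>' \<theta> - signed_margin J \<theta>' \<mu>' \<mu> = component_along J (\<lambda>j. \<theta>' j - \<mu>' j) (\<lambda>j. \<theta> j - \<mu> j)"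
  by (simp add: signed_margin_def component_along_diff)

lemma abs_signed_margin_sum_le:
  "\<bar>signed_margin J \<theta>' \<mu>' \<theta> + signed_margin J \<theta>' \<mu>' \<mu>\<bar> \<le> L2_set (\<lambda>j. \<theta>' j - \<theta> j) J + L2_set (\<lambda>j. \<mu>' j - \<mu> j) J"
proof -
  have "(\<lambda>j. \<theta> j - (\<theta>' j + \<mu>' j) / 2 + (\<mu> j - (\<theta>' j + \<mu>' j) / 2)) = (\<lambda>j. - ((\<theta>' j - \<theta> j) + (\<mu>' j - \<mu> j)))"
    by (auto simp: field_simps)
  then have "\<bar>signed_margin J \<theta>' \<mu>' \<theta> + signed_margin J \<theta>' \<mu>' \<mu>\<bar> \<le> L2_set (\<lambda>j. - ((\<theta>' j - \<theta> j) + (\<mu>' j - \<mu> j))) J"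
    unfolding signed_margin_def component_along_add by (simp only: abs_component_along_le)
  also have "\<dots> \<le> L2_set (\<lambda>j. \<theta>' j - \<theta> j) J + L2_set (\<lambda>j. \<mu>' j - \<mu> j) J"
    unfolding L2_set_uminus by (rule L2_set_triangle_ineq)
  finally show ?thesis .
qed

context brownian
begin

lemma plugin_error_eq:
  fixes \<theta> \<mu> \<theta>' \<mu>' :: "'i \<Rightarrow> real"
  assumes J: "finite J" and e: "orthogonal_family unit_leb J e (\<lambda>_. 1)"
  defines "H \<equiv> \<lambda>c \<omega>. nearest_centroid J \<theta>' \<mu>' (\<lambda>j. c j + wiener_int (e j) (W \<omega>))"
  shows "(prob {\<omega> \<in> space M. \<not> H \<theta> \<omega>} + prob {\<omega> \<in> space M. H \<mu> \<omega>}) / 2 =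
    (normal_tail (signed_margin J \<theta>' \<mu>' \<theta>) + normal_tail (- signed_margin J \<theta>' \<mu>' \<mu>)) / 2"
proof -
  define v where "v j = \<theta>' j - \<mu>' j" for j
  define b where "b j = (\<theta>' j + \<mu>' j) / 2" for j
  let ?X = "\<lambda>\<omega>. \<Sum>j\<in>J. v j * wiener_int (e j) (W \<omega>)"
  note [measurable] = sq_integrable_wiener_int[OF orthogonal_familyD(1)[OF e], THEN sq_integrable_measurable]
  have H: "H c \<omega> \<longleftrightarrow> - (\<Sum>j\<in>J. v j * (c j - b j)) \<le> ?X \<omega>" for c \<omega>
    unfolding H_def nearest_centroid_iff v_def[symmetric] b_def[symmetric]
    by (simp add: distrib_left right_diff_distrib sum.distrib sum_subtractf algebra_simps)
  show ?thesis
  proof (cases "L2_set v J = 0")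
    case True
    then have "\<And>j. j \<in> J \<Longrightarrow> v j = 0" using J by (simp add: L2_set_eq_0_iff)
    then have "H c \<omega>" for c \<omega> by (simp add: H)
    moreover have "signed_margin J \<theta>' \<mu>' c = 0" for c
      using True by (simp add: signed_margin_def component_along_def v_def[abs_def])
    ultimately show ?thesis by (simp add: prob_space normal_tail_0)
  next
    case False
    then have pos: "L2_set v J > 0" by (simp add: order.strict_iff_order)
    have prob_H: "prob {\<omega> \<in> space M. H c \<omega>} = normal_tail (- signed_margin J \<theta>' \<mu>' c)" for c
      unfolding H prob_wiener_int_combination_ge[OF J e pos]
      by (simp add: signed_margin_def component_along_def v_def[abs_def] b_def)
    have "prob {\<omega> \<in> space M. \<not> H \<theta> \<omega>} = 1 - prob {\<omega> \<in> space M. H \<theta> \<omega>}"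
      unfolding H by (rule prob_neg) measurable
    then show ?thesis by (simp add: prob_H normal_tail_minus)
  qed
qed

lemma plugin_error_le:
  fixes \<theta> \<mu> \<theta>' \<mu>' :: "'i \<Rightarrow> real"
  assumes J: "finite J" and e: "orthogonal_family unit_leb J e (\<lambda>_. 1)"
    and bias: "\<delta>\<^sup>2 - (\<Sum>j\<in>J. (\<theta> j - \<mu> j)\<^sup>2) \<le> 4 * \<rho>\<^sup>2" and coef_le: "(\<Sum>j\<in>J. (\<theta> j - \<mu> j)\<^sup>2) \<le> \<delta>\<^sup>2"
    and \<delta>: "0 \<le> \<delta>" and \<rho>: "\<rho> > 0"
  defines "H \<equiv> \<lambda>c \<omega>. nearest_centroid J \<theta>' \<mu>' (\<lambda>j. c j + wiener_int (e j) (W \<omega>))"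
  shows "(prob {\<omega> \<in> space M. \<not> H \<theta> \<omega>} + prob {\<omega> \<in> space M. H \<mu> \<omega>}) / 2 \<le> normal_tail (\<delta> / 2) +
    100 * ((\<rho>\<^sup>2 + 2 * ((\<Sum>j\<in>J. (\<theta>' j - \<theta> j)\<^sup>2) + (\<Sum>j\<in>J. (\<mu>' j - \<mu> j)\<^sup>2))) / max \<delta> \<rho>)"
proof -
  define D where "D = L2_set (\<lambda>j. \<theta> j - \<mu> j) J"
  define E where "E = L2_set (\<lambda>j. \<theta>' j - \<theta> j) J + L2_set (\<lambda>j. \<mu>' j - \<mu> j) J"
  define a where "a = signed_margin J \<theta>' \<mu>' \<theta>"
  define a' where "a' = - signed_margin J \<theta>' \<mu>' \<mu>"
  have sum: "a + a' = component_along J (\<lambda>j. \<theta>' j - \<mu>' j) (\<lambda>j. \<theta> j - \<mu> j)"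
    using signed_margin_diff[of J \<theta>' \<mu>' \<theta> \<mu>] by (simp add: a_def a'_def)
  have "(\<lambda>j. (\<theta>' j - \<mu>' j) - (\<theta> j - \<mu> j)) = (\<lambda>j. (\<theta>' j - \<theta> j) - (\<mu>' j - \<mu> j))" by auto
  then have "L2_set (\<lambda>j. (\<theta>' j - \<mu>' j) - (\<theta> j - \<mu> j)) J \<le> E"
    unfolding E_def using L2_set_triangle_ineq_diff[of "\<lambda>j. \<theta>' j - \<theta> j" "\<lambda>j. \<mu>' j - \<mu> j" J] by simp
  then have "2 * (L2_set (\<lambda>j. (\<theta>' j - \<mu>' j) - (\<theta> j - \<mu> j)) J)\<^sup>2 \<le> 2 * E\<^sup>2"
    by (intro mult_left_mono power_mono) auto
  with component_along_deficit[OF J] have deficit: "D * (D - (a + a')) \<le> 2 * E\<^sup>2"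
    unfolding sum D_def by (rule order_trans)
  have "(normal_tail a + normal_tail a') / 2 \<le> normal_tail (\<delta> / 2) + 100 * ((\<rho>\<^sup>2 + E\<^sup>2) / max \<delta> \<rho>)"
  proof (rule normal_tail_average_excess_le[OF _ _ _ _ deficit \<rho>])
    show "\<bar>a - a'\<bar> \<le> E" unfolding a_def a'_def E_def using abs_signed_margin_sum_le by simp
    show "\<bar>a + a'\<bar> \<le> D" unfolding sum D_def by (rule abs_component_along_le)
    show "D \<le> \<delta>" using coef_le \<delta> unfolding D_def L2_set_power2[symmetric] by (rule power2_le_imp_le)
    show "\<delta>\<^sup>2 - D\<^sup>2 \<le> 4 * \<rho>\<^sup>2" using bias by (simp add: D_def L2_set_power2)
  qed
  also have "\<dots> \<le> normal_tail (\<delta> / 2) +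
    100 * ((\<rho>\<^sup>2 + 2 * ((\<Sum>j\<in>J. (\<theta>' j - \<theta> j)\<^sup>2) + (\<Sum>j\<in>J. (\<mu>' j - \<mu> j)\<^sup>2))) / max \<delta> \<rho>)"
  proof (intro mult_left_mono divide_right_mono add_left_mono)
    show "E\<^sup>2 \<le> 2 * ((\<Sum>j\<in>J. (\<theta>' j - \<theta> j)\<^sup>2) + (\<Sum>j\<in>J. (\<mu>' j - \<mu> j)\<^sup>2))"
      unfolding E_def L2_set_power2[symmetric] using square_add_le by simp
  qed (use \<rho> in auto)
  finally show ?thesis unfolding H_def plugin_error_eq[OF J e] a_def a'_def .
qed

end

section \<open>The experiment and conditioning on the sample\<close>

context prob_space
begin

lemma indep_var_prob_section:
  assumes indep: "indep_var S X T Y" and E: "E \<in> sets (S \<Otimes>\<^sub>M T)"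
  shows "ennreal (prob {\<omega> \<in> space M. (X \<omega>, Y \<omega>) \<in> E}) = (\<integral>\<^sup>+\<omega>'. ennreal (prob {\<omega> \<in> space M. (X \<omega>', Y \<omega>) \<in> E}) \<partial>M)"
proof -
  have X: "X \<in> measurable M S" and Y: "Y \<in> measurable M T" using indep by (auto simp: indep_var_eq)
  interpret Y: prob_space "distr M T Y" by (rule prob_space_distr[OF Y])
  have "ennreal (prob {\<omega> \<in> space M. (X \<omega>, Y \<omega>) \<in> E}) = emeasure M ((\<lambda>\<omega>. (X \<omega>, Y \<omega>)) -` E \<inter> space M)"
    unfolding emeasure_eq_measure[symmetric] by (intro arg_cong[where f="emeasure M"]) auto
  also have "\<dots> = emeasure (distr M (S \<Otimes>\<^sub>M T) (\<lambda>\<omega>. (X \<omega>, Y \<omega>))) E"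
    using X Y E by (subst emeasure_distr) auto
  also have "\<dots> = emeasure (distr M S X \<Otimes>\<^sub>M distr M T Y) E"
    using indep by (simp add: indep_var_distribution_eq)
  also have "\<dots> = (\<integral>\<^sup>+x. emeasure (distr M T Y) (Pair x -` E) \<partial>distr M S X)"
    using E by (intro Y.emeasure_pair_measure_alt) simp
  also have "\<dots> = (\<integral>\<^sup>+\<omega>'. emeasure (distr M T Y) (Pair (X \<omega>') -` E) \<partial>M)"
    using E by (intro nn_integral_distr X Y.measurable_emeasure_Pair) simp
  also have "\<dots> = (\<integral>\<^sup>+\<omega>'. ennreal (prob {\<omega> \<in> space M. (X \<omega>', Y \<omega>) \<in> E}) \<partial>M)"
  proof (rule nn_integral_cong)
    fix \<omega>'
    have "Y -` (Pair (X \<omega>') -` E) \<inter> space M = {\<omega> \<in> space M. (X \<omega>', Y \<omega>) \<in> E}" by auto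
    then show "emeasure (distr M T Y) (Pair (X \<omega>') -` E) = ennreal (prob {\<omega> \<in> space M. (X \<omega>', Y \<omega>) \<in> E})"
      by (simp add: emeasure_distr[OF Y sets_Pair1[OF E]] emeasure_eq_measure)
  qed
  finally show ?thesis .
qed

text \<open>The library's \<open>indep_var\<close> needs both variables to have the same type, so independence of variables of
  different types is stated for the generated sigma-algebras and used through real-valued functions.\<close>

lemma indep_set_vimage_imp_indep_var:
  fixes q :: "'b \<Rightarrow> real" and p :: "'c \<Rightarrow> real"
  assumes indep: "indep_set {X -` A \<inter> space M | A. A \<in> sets S} {Y -` B \<inter> space M | B. B \<in> sets T}"
    and X: "X \<in> measurable M S" and Y: "Y \<in> measurable M T"
    and q: "q \<in> borel_measurable S" and p: "p \<in> borel_measurable T"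
  shows "indep_var borel (\<lambda>\<omega>. q (X \<omega>)) borel (\<lambda>\<omega>. p (Y \<omega>))"
proof -
  have sigma: "sigma_sets (space M) {h -` A \<inter> space M | A. A \<in> sets borel} = {h -` A \<inter> space M | A. A \<in> sets borel}"
    for h :: "'a \<Rightarrow> real"
    unfolding sets_vimage_algebra[symmetric] by (rule sets_vimage_algebra2) simp
  have vimage_subset: "{(\<lambda>\<omega>. h (Z \<omega>)) -` A \<inter> space M | A. A \<in> sets borel} \<subseteq> {Z -` A \<inter> space M | A. A \<in> sets N}"
    if "Z \<in> measurable M N" "h \<in> borel_measurable N" for h :: "'d \<Rightarrow> real" and Z N
  proof safe
    fix A :: "real set" assume "A \<in> sets borel"
    then have "h -` A \<inter> space N \<in> sets N" using that by measurable
    moreover have "(\<lambda>\<omega>. h (Z \<omega>)) -` A \<inter> space M = Z -` (h -` A \<inter> space N) \<inter> space M"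
      using measurable_space[OF that(1)] by auto
    ultimately show "\<exists>B. (\<lambda>\<omega>. h (Z \<omega>)) -` A \<inter> space M = Z -` B \<inter> space M \<and> B \<in> sets N" by (intro exI conjI)
  qed
  show ?thesis
    unfolding indep_var_eq sigma
  proof (intro conjI)
    show "indep_set {(\<lambda>\<omega>. q (X \<omega>)) -` A \<inter> space M |A. A \<in> sets borel} {(\<lambda>\<omega>. p (Y \<omega>)) -` A \<inter> space M |A. A \<in> sets borel}"
      using indep unfolding indep_set_def
    proof (rule indep_sets_mono_sets)
      fix i :: bool
      show "case_bool {(\<lambda>\<omega>. q (X \<omega>)) -` A \<inter> space M |A. A \<in> sets borel} {(\<lambda>\<omega>. p (Y \<omega>)) -` A \<inter> space M |A. A \<in> sets borel} i \<subseteq>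
        case_bool {X -` A \<inter> space M |A. A \<in> sets S} {Y -` B \<inter> space M |B. B \<in> sets T} i"
        using vimage_subset[OF X q] vimage_subset[OF Y p] by (cases i) (simp_all only: bool.case)
    qed
  qed (use X Y q p in measurable)
qed

end

abbreviation datum_space :: "((real \<Rightarrow> real) \<times> bool) measure" where
  "datum_space \<equiv> traj_space \<Otimes>\<^sub>M count_space UNIV"

locale bm_experiment = prob_space M + L2_basis \<phi>
  for M :: "'a measure" and \<phi> +
  fixes n :: nat and W :: "nat \<Rightarrow> 'a \<Rightarrow> real \<Rightarrow> real" and Y :: "nat \<Rightarrow> 'a \<Rightarrow> bool" and f g :: "real \<Rightarrow> real"
  assumes model: "bm_model M n W Y"
    and f: "sq_integrable unit_leb f" and g: "sq_integrable unit_leb g"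
begin

definition driving_path :: "nat \<Rightarrow> 'a \<Rightarrow> real \<Rightarrow> real" where "driving_path i \<omega> = restrict (W i \<omega>) {0..1}"

definition datum :: "nat \<Rightarrow> 'a \<Rightarrow> (real \<Rightarrow> real) \<times> bool" where "datum i \<omega> = (driving_path i \<omega>, Y i \<omega>)"

definition sample :: "'a \<Rightarrow> nat \<Rightarrow> (real \<Rightarrow> real) \<times> bool" where "sample \<omega> = (\<lambda>i\<in>{1..n}. datum i \<omega>)"

lemma brownian_W: "i \<le> n \<Longrightarrow> brownian M (W i)"
  using model by (auto simp: bm_model_def brownian_def brownian_axioms_def)

lemma Y_measurable: "i \<le> n \<Longrightarrow> Y i \<in> measurable M (count_space UNIV)"
  using model by (auto simp: bm_model_def)

lemma driving_path_measurable: "i \<le> n \<Longrightarrow> driving_path i \<in> measurable M traj_space"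
  unfolding driving_path_def traj_space_def by (intro brownian.restrict_W_measurable brownian_W order_refl)

lemma datum_measurable: "i \<le> n \<Longrightarrow> datum i \<in> measurable M datum_space"
  unfolding datum_def using driving_path_measurable Y_measurable by measurable

lemma sample_measurable: "sample \<in> measurable M (\<Pi>\<^sub>M i\<in>{1..n}. datum_space)"
  unfolding sample_def by (intro measurable_restrict datum_measurable) auto

lemma indep_data: "indep_vars (\<lambda>_. datum_space) datum {..n}"
  using model unfolding bm_model_def datum_def[abs_def] driving_path_def by (elim conjE)

lemma indep_path_label:
  assumes "i \<le> n"
  shows "indep_set {driving_path i -` A \<inter> space M | A. A \<in> sets traj_space}
    {Y i -` B \<inter> space M | B. B \<in> sets (count_space UNIV)}"
  using model assms unfolding bm_model_def indep_set_def driving_path_def[abs_def] by (elim conjE) (drule spec[of _ i], simp)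

lemma prob_label: "i \<le> n \<Longrightarrow> prob {\<omega> \<in> space M. Y i \<omega> = k} = 1/2"
proof -
  assume i: "i \<le> n"
  note [measurable] = Y_measurable[OF i]
  have half: "prob {\<omega> \<in> space M. Y i \<omega>} = 1/2" using model i by (auto simp: bm_model_def)
  have "prob {\<omega> \<in> space M. \<not> Y i \<omega>} = 1 - prob {\<omega> \<in> space M. Y i \<omega>}" by (rule prob_neg) measurable
  then show ?thesis using half by (cases k) simp_all
qed

lemma expectation_label: "i \<le> n \<Longrightarrow> expectation (\<lambda>\<omega>. of_bool (Y i \<omega> = k) :: real) = 1/2"
proof -
  assume i: "i \<le> n"
  note [measurable] = Y_measurable[OF i]
  have "expectation (\<lambda>\<omega>. of_bool (Y i \<omega> = k) :: real) = expectation (indicat_real {\<omega> \<in> space M. Y i \<omega> = k})"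
    by (intro Bochner_Integration.integral_cong refl) (simp add: indicator_def)
  also have "\<dots> = prob {\<omega> \<in> space M. Y i \<omega> = k}" by simp
  also have "\<dots> = 1/2" by (rule prob_label[OF i])
  finally show ?thesis .
qed

lemma prob_path_label_split:
  assumes i: "i \<le> n" and A: "A1 \<in> sets traj_space" "A0 \<in> sets traj_space"
  shows "prob {\<omega> \<in> space M. if Y i \<omega> then driving_path i \<omega> \<in> A1 else driving_path i \<omega> \<in> A0} =
    (prob {\<omega> \<in> space M. driving_path i \<omega> \<in> A1} + prob {\<omega> \<in> space M. driving_path i \<omega> \<in> A0}) / 2"
proof -
  note [measurable] = Y_measurable[OF i] driving_path_measurable[OF i] A
  have indep: "prob {\<omega> \<in> space M. driving_path i \<omega> \<in> A \<and> Y i \<omega> = k} = prob {\<omega> \<in> space M. driving_path i \<omega> \<in> A} / 2"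
    if "A \<in> sets traj_space" for A k
  proof -
    have "prob ((driving_path i -` A \<inter> space M) \<inter> (Y i -` {k} \<inter> space M))
      = prob (driving_path i -` A \<inter> space M) * prob (Y i -` {k} \<inter> space M)"
      using that by (intro indep_setD[OF indep_path_label[OF i]]) auto
    moreover have "(driving_path i -` A \<inter> space M) \<inter> (Y i -` {k} \<inter> space M)
      = {\<omega> \<in> space M. driving_path i \<omega> \<in> A \<and> Y i \<omega> = k}"
      "driving_path i -` A \<inter> space M = {\<omega> \<in> space M. driving_path i \<omega> \<in> A}" "Y i -` {k} \<inter> space M = {\<omega> \<in> space M. Y i \<omega> = k}"
      by auto
    ultimately show ?thesis using prob_label[OF i, of k] by simp
  qed
  have "prob {\<omega> \<in> space M. if Y i \<omega> then driving_path i \<omega> \<in> A1 else driving_path i \<omega> \<in> A0} =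
    prob ({\<omega> \<in> space M. driving_path i \<omega> \<in> A1 \<and> Y i \<omega> = True} \<union> {\<omega> \<in> space M. driving_path i \<omega> \<in> A0 \<and> Y i \<omega> = False})"
    by (intro arg_cong[where f=prob]) auto
  also have "\<dots> = prob {\<omega> \<in> space M. driving_path i \<omega> \<in> A1 \<and> Y i \<omega> = True}
    + prob {\<omega> \<in> space M. driving_path i \<omega> \<in> A0 \<and> Y i \<omega> = False}"
    by (rule finite_measure_Union) auto
  finally show ?thesis by (simp only: indep A add_divide_distrib)
qed

text \<open>Fubini for the sample and the new observation, with \<open>\<omega>'\<close> as an independent copy of \<open>\<omega>\<close> carrying the sample.\<close>

lemma error_prob_conditional:
  assumes K[measurable]: "K \<in> measurable ((\<Pi>\<^sub>M i\<in>{1..n}. datum_space) \<Otimes>\<^sub>M datum_space) (count_space UNIV)"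
  shows "ennreal (prob {\<omega> \<in> space M. K (sample \<omega>, datum 0 \<omega>) \<noteq> Y 0 \<omega>}) =
    (\<integral>\<^sup>+\<omega>'. ennreal ((prob {\<omega> \<in> space M. \<not> K (sample \<omega>', (driving_path 0 \<omega>, True))} +
      prob {\<omega> \<in> space M. K (sample \<omega>', (driving_path 0 \<omega>, False))}) / 2) \<partial>M)"
proof -
  let ?S = "\<Pi>\<^sub>M i\<in>{1..n}. datum_space" and ?V = "\<Pi>\<^sub>M i\<in>{0::nat}. datum_space"
  let ?v = "\<lambda>\<omega>. \<lambda>i\<in>{0::nat}. datum i \<omega>"
  define E where "E = {x \<in> space (?S \<Otimes>\<^sub>M ?V). K (fst x, snd x 0) \<noteq> snd (snd x 0)}"
  have [measurable]: "(\<lambda>x. snd x 0) \<in> measurable (?S \<Otimes>\<^sub>M ?V) datum_space"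
    by (rule measurable_compose[OF measurable_snd measurable_component_singleton]) simp
  have E: "E \<in> sets (?S \<Otimes>\<^sub>M ?V)" unfolding E_def by measurable
  have v: "?v \<in> measurable M ?V" by (intro measurable_restrict datum_measurable) auto
  have E_iff: "(sample \<omega>', ?v \<omega>) \<in> E \<longleftrightarrow> K (sample \<omega>', datum 0 \<omega>) \<noteq> Y 0 \<omega>" if "\<omega> \<in> space M" "\<omega>' \<in> space M" for \<omega> \<omega>'
    using measurable_space[OF sample_measurable that(2)] measurable_space[OF v that(1)]
    by (simp add: E_def space_pair_measure datum_def)
  have "indep_var ?S sample ?V ?v"
    unfolding sample_def[abs_def] by (rule indep_var_restrict[OF indep_data]) auto
  from indep_var_prob_section[OF this E]
  have "ennreal (prob {\<omega> \<in> space M. K (sample \<omega>, datum 0 \<omega>) \<noteq> Y 0 \<omega>}) =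
      (\<integral>\<^sup>+\<omega>'. ennreal (prob {\<omega> \<in> space M. K (sample \<omega>', datum 0 \<omega>) \<noteq> Y 0 \<omega>}) \<partial>M)"
    by (simp add: E_iff cong: nn_integral_cong conj_cong)
  also have "\<dots> = (\<integral>\<^sup>+\<omega>'. ennreal ((prob {\<omega> \<in> space M. \<not> K (sample \<omega>', (driving_path 0 \<omega>, True))} +
      prob {\<omega> \<in> space M. K (sample \<omega>', (driving_path 0 \<omega>, False))}) / 2) \<partial>M)"
  proof (rule nn_integral_cong)
    fix \<omega>' assume "\<omega>' \<in> space M"
    then have s: "sample \<omega>' \<in> space ?S" by (rule measurable_space[OF sample_measurable])
    have [measurable]: "(\<lambda>x. K (sample \<omega>', (x, k))) \<in> measurable traj_space (count_space UNIV)" for k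
      using s by measurable
    let ?A1 = "{x \<in> space traj_space. \<not> K (sample \<omega>', (x, True))}"
      and ?A0 = "{x \<in> space traj_space. K (sample \<omega>', (x, False))}"
    have path_space: "driving_path 0 \<omega> \<in> space traj_space" if "\<omega> \<in> space M" for \<omega>
      using that by (intro measurable_space[OF driving_path_measurable]) auto
    have "{\<omega> \<in> space M. K (sample \<omega>', datum 0 \<omega>) \<noteq> Y 0 \<omega>} =
        {\<omega> \<in> space M. if Y 0 \<omega> then driving_path 0 \<omega> \<in> ?A1 else driving_path 0 \<omega> \<in> ?A0}"
      using path_space by (auto simp: datum_def)
    then show "ennreal (prob {\<omega> \<in> space M. K (sample \<omega>', datum 0 \<omega>) \<noteq> Y 0 \<omega>}) =
      ennreal ((prob {\<omega> \<in> space M. \<not> K (sample \<omega>', (driving_path 0 \<omega>, True))}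
        + prob {\<omega> \<in> space M. K (sample \<omega>', (driving_path 0 \<omega>, False))}) / 2)"
      using prob_path_label_split[of 0 ?A1 ?A0] path_space by (simp cong: conj_cong)
  qed
  finally show ?thesis .
qed

subsection \<open>The Bayes risk\<close>

definition observation :: "(real \<Rightarrow> real) \<times> bool \<Rightarrow> real \<Rightarrow> real" where
  "observation v = shift_path (if snd v then f else g) (fst v)"

lemma observation_measurable [measurable]: "observation \<in> measurable datum_space traj_space"
proof -
  have "observation = (\<lambda>v. if snd v then shift_path f (fst v) else shift_path g (fst v))"
    by (auto simp: observation_def)
  then show ?thesis by simp
qed

lemma obs_path_eq: "obs_path f g (W i) (Y i) \<omega> = observation (datum i \<omega>)"
  unfolding observation_def datum_def driving_path_def fst_conv snd_conv shift_path_restrict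
  by (simp add: shift_path_def obs_path_def)

definition observed_sample :: "(nat \<Rightarrow> (real \<Rightarrow> real) \<times> bool) \<Rightarrow> nat \<Rightarrow> (real \<Rightarrow> real) \<times> bool" where
  "observed_sample s = (\<lambda>i\<in>{1..n}. (observation (s i), snd (s i)))"

lemma observed_sample_measurable [measurable]:
  "observed_sample \<in> measurable (\<Pi>\<^sub>M i\<in>{1..n}. datum_space) (\<Pi>\<^sub>M i\<in>{1..n}. datum_space)"
  unfolding observed_sample_def
proof (intro measurable_restrict)
  fix i assume "i \<in> {1..n}"
  then have [measurable]: "(\<lambda>s. s i) \<in> measurable (\<Pi>\<^sub>M i\<in>{1..n}. datum_space) datum_space"
    by (rule measurable_component_singleton)
  show "(\<lambda>s. (observation (s i), snd (s i))) \<in> measurable (\<Pi>\<^sub>M i\<in>{1..n}. datum_space) datum_space"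
    by measurable
qed

lemma sample_data_eq:
  "sample_data n (\<lambda>i. obs_path f g (W i) (Y i)) Y \<omega> = (observed_sample (sample \<omega>), observation (datum 0 \<omega>))"
  unfolding sample_data_def obs_path_eq observed_sample_def sample_def by (auto simp: fun_eq_iff datum_def)

lemma normal_tail_le_error_prob:
  assumes \<Phi>[measurable]: "\<Phi> \<in> measurable (classifier_space n) (count_space UNIV)"
  shows "normal_tail (sqrt (sq_norm unit_leb (\<lambda>x. f x - g x)) / 2) \<le>
    prob {\<omega> \<in> space M. \<Phi> (sample_data n (\<lambda>i. obs_path f g (W i) (Y i)) Y \<omega>) \<noteq> Y 0 \<omega>}" (is "?Q \<le> ?risk")
proof -
  interpret B: brownian M "W 0" by (rule brownian_W) simp
  let ?S = "\<Pi>\<^sub>M i\<in>{1..n}. datum_space"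
  define K where "K x = \<Phi> (observed_sample (fst x), observation (snd x))" for x
  have K: "K \<in> measurable (?S \<Otimes>\<^sub>M datum_space) (count_space UNIV)"
    unfolding K_def by (rule measurable_compose[OF _ \<Phi>], unfold classifier_space_def) measurable
  have risk: "?risk = prob {\<omega> \<in> space M. K (sample \<omega>, datum 0 \<omega>) \<noteq> Y 0 \<omega>}" by (simp add: K_def sample_data_eq)
  have "ennreal ?Q = (\<integral>\<^sup>+\<omega>'. ennreal ?Q \<partial>M)" by (simp add: emeasure_space_1)
  also have "\<dots> \<le> ennreal ?risk"
    unfolding risk error_prob_conditional[OF K]
  proof (intro nn_integral_mono ennreal_leI)
    fix \<omega>' assume "\<omega>' \<in> space M"
    then have "observed_sample (sample \<omega>') \<in> space ?S"
      by (intro measurable_space[OF observed_sample_measurable] measurable_space[OF sample_measurable])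
    then have [measurable]: "(\<lambda>x. \<Phi> (observed_sample (sample \<omega>'), x)) \<in> measurable traj_space (count_space UNIV)"
      by (intro measurable_compose[OF measurable_Pair1' \<Phi>[unfolded classifier_space_def]])
    define A where "A = {x \<in> space traj_space. \<Phi> (observed_sample (sample \<omega>'), x)}"
    have A: "A \<in> sets traj_space" unfolding A_def by measurable
    have shift_A: "shift_path h (W 0 \<omega>) \<in> A \<longleftrightarrow> \<Phi> (observed_sample (sample \<omega>'), shift_path h (W 0 \<omega>))" if "\<omega> \<in> space M" for h \<omega>
      using measurable_space[OF B.shift_path_W_measurable that] by (simp add: A_def)
    have "prob {\<omega> \<in> space M. \<not> K (sample \<omega>', (driving_path 0 \<omega>, True))} = prob {\<omega> \<in> space M. \<not> shift_path f (W 0 \<omega>) \<in> A}"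
      and "prob {\<omega> \<in> space M. K (sample \<omega>', (driving_path 0 \<omega>, False))} = prob {\<omega> \<in> space M. shift_path g (W 0 \<omega>) \<in> A}"
      by (auto simp: K_def observation_def driving_path_def shift_path_restrict shift_A cong: conj_cong)
    moreover have "prob {\<omega> \<in> space M. \<not> shift_path f (W 0 \<omega>) \<in> A} = 1 - prob {\<omega> \<in> space M. shift_path f (W 0 \<omega>) \<in> A}"
      using measurable_sets[OF B.shift_path_W_measurable A] by (intro prob_neg) (simp add: vimage_def Int_def conj_commute)
    ultimately show "?Q \<le> (prob {\<omega> \<in> space M. \<not> K (sample \<omega>', (driving_path 0 \<omega>, True))}
      + prob {\<omega> \<in> space M. K (sample \<omega>', (driving_path 0 \<omega>, False))}) / 2"
      using B.path_tv[OF f g A] by simp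
  qed
  finally show ?thesis by simp
qed

lemma normal_tail_le_opt_risk:
  "normal_tail (sqrt (sq_norm unit_leb (\<lambda>x. f x - g x)) / 2) \<le> opt_risk M n (\<lambda>i. obs_path f g (W i) (Y i)) Y"
  unfolding opt_risk_def
proof (rule cINF_greatest)
  have "(\<lambda>_. True) \<in> measurable (classifier_space n) (count_space UNIV)" by simp
  then show "measurable (classifier_space n) (count_space (UNIV :: bool set)) \<noteq> {}" by blast
qed (rule normal_tail_le_error_prob)

end

section \<open>The risk of the classifier\<close>

subsection \<open>Class means\<close>

definition class_size :: "nat \<Rightarrow> (nat \<Rightarrow> bool) \<Rightarrow> bool \<Rightarrow> real" where
  "class_size n y k = (\<Sum>i=1..n. of_bool (y i = k))"

definition class_sum :: "nat \<Rightarrow> (nat \<Rightarrow> bool) \<Rightarrow> bool \<Rightarrow> (nat \<Rightarrow> real) \<Rightarrow> real" where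
  "class_sum n y k z = (\<Sum>i=1..n. of_bool (y i = k) * z i)"

text \<open>Since \<open>x / 0 = 0\<close>, the mean of an empty class is \<open>0\<close>, as in the definition of the classifier.\<close>

definition class_mean :: "nat \<Rightarrow> (nat \<Rightarrow> bool) \<Rightarrow> bool \<Rightarrow> (nat \<Rightarrow> real) \<Rightarrow> real" where
  "class_mean n y k z = class_sum n y k z / class_size n y k"

lemma class_size_True_add_False: "class_size n y True + class_size n y False = real n"
  by (simp add: class_size_def of_bool_not_iff sum_subtractf del: sum_of_bool_eq)

lemma class_mean_cong:
  "(\<And>i. i \<in> {1..n} \<Longrightarrow> y i = y' i) \<Longrightarrow> (\<And>i. i \<in> {1..n} \<Longrightarrow> z i = z' i) \<Longrightarrow> class_mean n y k z = class_mean n y' k z'"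
  unfolding class_mean_def class_sum_def class_size_def by (intro arg_cong2[where f="(/)"] sum.cong refl) auto

lemma class_mean_shift:
  assumes "class_size n y k \<noteq> 0" "\<And>i. i \<in> {1..n} \<Longrightarrow> y i = k \<Longrightarrow> z i = c + x i"
  shows "class_mean n y k z - c = class_mean n y k x"
proof -
  have "class_sum n y k z = (\<Sum>i=1..n. c * of_bool (y i = k) + of_bool (y i = k) * x i)"
    unfolding class_sum_def using assms(2) by (intro sum.cong refl) auto
  also have "\<dots> = c * class_size n y k + class_sum n y k x"
    by (simp add: class_size_def class_sum_def sum.distrib sum_distrib_left)
  finally show ?thesis using assms(1) by (simp add: class_mean_def field_simps)
qed

lemma class_mean_sq_le:
  assumes "real n / 4 \<le> class_size n y k" "n > 0"
  shows "(class_mean n y k x)\<^sup>2 \<le> 16 / (real n)\<^sup>2 * (class_sum n y k x)\<^sup>2"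
proof -
  have size_pos: "0 < class_size n y k" using assms by linarith
  have "(real n / 4)\<^sup>2 \<le> (class_size n y k)\<^sup>2" using assms(1) by (intro power_mono) auto
  then have "(class_sum n y k x)\<^sup>2 / (class_size n y k)\<^sup>2 \<le> (class_sum n y k x)\<^sup>2 / (real n / 4)\<^sup>2"
    using assms(2) size_pos by (intro divide_left_mono) auto
  then show ?thesis by (simp add: class_mean_def power_divide mult.commute)
qed

lemma hat_Phi_iff:
  "hat_Phi d n Y Z \<omega> \<longleftrightarrow> nearest_centroid {1..d} (\<lambda>j. class_mean n (\<lambda>i. Y i \<omega>) True (\<lambda>i. Z i j \<omega>))
    (\<lambda>j. class_mean n (\<lambda>i. Y i \<omega>) False (\<lambda>i. Z i j \<omega>)) (\<lambda>j. Z 0 j \<omega>)"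
proof -
  have mean: "(if card {i \<in> {1..n}. P i} > 0 then (\<Sum>i\<in>{i \<in> {1..n}. P i}. z i) / real (card {i \<in> {1..n}. P i}) else 0) =
    (\<Sum>i=1..n. of_bool (P i) * z i) / (\<Sum>i=1..n. of_bool (P i))" for P and z :: "nat \<Rightarrow> real"
    by (auto simp: sum_of_bool_mult_eq sum_of_bool_eq Int_def)
  show ?thesis
    unfolding hat_Phi_def Let_def mean nearest_centroid_def class_mean_def class_sum_def class_size_def by simp
qed

context bm_experiment
begin

subsection \<open>Estimation errors and unbalanced samples\<close>

lemma sq_norm_sum_data_le:
  assumes h: "h \<in> borel_measurable datum_space" and sq: "\<And>i. i \<in> {1..n} \<Longrightarrow> sq_integrable M (\<lambda>\<omega>. h (datum i \<omega>))"
    and mean: "\<And>i. i \<in> {1..n} \<Longrightarrow> expectation (\<lambda>\<omega>. h (datum i \<omega>)) = 0"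
    and sq_norm_le: "\<And>i. i \<in> {1..n} \<Longrightarrow> sq_norm M (\<lambda>\<omega>. h (datum i \<omega>)) \<le> v"
  shows "sq_norm M (\<lambda>\<omega>. \<Sum>i=1..n. h (datum i \<omega>)) \<le> real n * v"
proof -
  have "indep_vars (\<lambda>_. borel) (\<lambda>i \<omega>. h (datum i \<omega>)) {..n}" by (rule indep_vars_compose2[OF indep_data h])
  then have "indep_vars (\<lambda>_. borel) (\<lambda>i \<omega>. h (datum i \<omega>)) {1..n}" by (rule indep_vars_subset) auto
  then have "orthogonal_family M {1..n} (\<lambda>i \<omega>. h (datum i \<omega>)) (\<lambda>i. sq_norm M (\<lambda>\<omega>. h (datum i \<omega>)))"
    by (rule orthogonal_family_indep_vars[OF _ sq mean])
  from sq_norm_orthogonal_sum[OF _ this, of "\<lambda>_. 1"]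
  have "sq_norm M (\<lambda>\<omega>. \<Sum>i=1..n. h (datum i \<omega>)) = (\<Sum>i=1..n. sq_norm M (\<lambda>\<omega>. h (datum i \<omega>)))" by simp
  also have "\<dots> \<le> real n * v" using sum_bounded_above[of "{1..n}", OF sq_norm_le] by simp
  finally show ?thesis .
qed

definition noise :: "nat \<Rightarrow> nat \<Rightarrow> 'a \<Rightarrow> real" where "noise i j \<omega> = wiener_int (\<phi> j) (driving_path i \<omega>)"

lemma noise_eq: "noise i j = (\<lambda>\<omega>. wiener_int (\<phi> j) (W i \<omega>))"
  by (simp add: noise_def[abs_def] driving_path_def wiener_int_restrict)

lemma sq_integrable_noise: "i \<le> n \<Longrightarrow> j \<ge> 1 \<Longrightarrow> sq_integrable M (noise i j)"
  unfolding noise_eq by (intro brownian.sq_integrable_wiener_int brownian_W sq_integrable_basis)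

lemma sq_norm_noise: "i \<le> n \<Longrightarrow> j \<ge> 1 \<Longrightarrow> sq_norm M (noise i j) = 1"
  using brownian.sq_norm_wiener_int[OF brownian_W sq_integrable_basis, of i j]
    orthogonal_familyD(2)[OF orthogonal_family_basis, of j j]
  by (simp add: noise_eq power2_eq_square)

lemma sq_integrable_class_noise:
  assumes "i \<le> n" "j \<ge> 1"
  shows "sq_integrable M (\<lambda>\<omega>. of_bool (Y i \<omega> = k) * noise i j \<omega>)"
proof -
  note [measurable] = Y_measurable[OF assms(1)] sq_integrable_measurable[OF sq_integrable_noise[OF assms]]
  have "integrable M (\<lambda>\<omega>. (of_bool (Y i \<omega> = k) * noise i j \<omega>)\<^sup>2)"
    by (rule Bochner_Integration.integrable_bound[OF sq_integrable_square[OF sq_integrable_noise[OF assms]]])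
      (auto intro!: AE_I2)
  then show ?thesis unfolding sq_integrable_def by simp
qed

lemma sq_norm_class_noise_le:
  assumes "i \<le> n" "j \<ge> 1"
  shows "sq_norm M (\<lambda>\<omega>. of_bool (Y i \<omega> = k) * noise i j \<omega>) \<le> 1"
proof -
  have "sq_norm M (\<lambda>\<omega>. of_bool (Y i \<omega> = k) * noise i j \<omega>) \<le> sq_norm M (noise i j)"
    by (intro integral_mono sq_integrable_square sq_integrable_class_noise sq_integrable_noise assms) simp
  then show ?thesis unfolding sq_norm_noise[OF assms] .
qed

lemma expectation_class_noise:
  assumes "i \<le> n" "j \<ge> 1"
  shows "expectation (\<lambda>\<omega>. of_bool (Y i \<omega> = k) * noise i j \<omega>) = 0"
proof -
  have "indep_var borel (\<lambda>\<omega>. wiener_int (\<phi> j) (driving_path i \<omega>)) borel (\<lambda>\<omega>. of_bool (Y i \<omega> = k) :: real)"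
    by (rule indep_set_vimage_imp_indep_var[OF indep_path_label driving_path_measurable Y_measurable]) (use assms in simp_all)
  then have "indep_var borel (noise i j) borel (\<lambda>\<omega>. of_bool (Y i \<omega> = k) :: real)" by (simp add: noise_def[abs_def])
  moreover have "sq_integrable M (\<lambda>\<omega>. of_bool (Y i \<omega> = k))"
    using Y_measurable[OF assms(1)] by (intro sq_integrable_bounded[where K=1]) auto
  ultimately have "expectation (\<lambda>\<omega>. noise i j \<omega> * of_bool (Y i \<omega> = k))
    = expectation (noise i j) * expectation (\<lambda>\<omega>. of_bool (Y i \<omega> = k))"
    using sq_integrable_noise[OF assms] by (intro indep_var_lebesgue_integral sq_integrable_imp_integrable)
  moreover have "expectation (noise i j) = 0"
    unfolding noise_eq using assms by (intro brownian.expectation_wiener_int brownian_W sq_integrable_basis)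
  ultimately show ?thesis by (simp add: mult.commute)
qed

abbreviation labels :: "'a \<Rightarrow> nat \<Rightarrow> bool" where "labels \<omega> \<equiv> \<lambda>i. Y i \<omega>"

lemma sq_integrable_class_noise_sum:
  "j \<ge> 1 \<Longrightarrow> sq_integrable M (\<lambda>\<omega>. class_sum n (labels \<omega>) k (\<lambda>i. noise i j \<omega>))"
  unfolding class_sum_def by (intro sq_integrable_sum sq_integrable_class_noise) auto

lemma sq_norm_class_noise_sum_le:
  assumes j: "j \<ge> 1"
  shows "sq_norm M (\<lambda>\<omega>. class_sum n (labels \<omega>) k (\<lambda>i. noise i j \<omega>)) \<le> real n"
proof -
  let ?h = "\<lambda>v :: (real \<Rightarrow> real) \<times> bool. of_bool (snd v = k) * wiener_int (\<phi> j) (fst v)"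
  have h: "?h (datum i \<omega>) = of_bool (Y i \<omega> = k) * noise i j \<omega>" for i \<omega> by (simp add: datum_def noise_def)
  have "sq_norm M (\<lambda>\<omega>. \<Sum>i=1..n. ?h (datum i \<omega>)) \<le> real n * 1"
  proof (rule sq_norm_sum_data_le)
    show "?h \<in> borel_measurable datum_space" by measurable
  qed (use j in \<open>simp_all only: h sq_integrable_class_noise expectation_class_noise sq_norm_class_noise_le atLeastAtMost_iff\<close>)
  then show ?thesis by (simp only: h class_sum_def mult_1_right)
qed

definition unbalanced :: "'a set" where
  "unbalanced = {\<omega> \<in> space M. class_size n (labels \<omega>) True < real n / 4 \<or> class_size n (labels \<omega>) False < real n / 4}"

lemma class_size_measurable [measurable]: "(\<lambda>\<omega>. class_size n (labels \<omega>) k) \<in> borel_measurable M"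
proof -
  have [measurable]: "Y i \<in> measurable M (count_space UNIV)" if "i \<in> {1..n}" for i using that by (intro Y_measurable) simp
  show ?thesis unfolding class_size_def by measurable
qed

lemma unbalanced_events [measurable]: "unbalanced \<in> events"
  unfolding unbalanced_def by measurable

lemma sq_integrable_class_size: "sq_integrable M (\<lambda>\<omega>. class_size n (labels \<omega>) k - c)"
  unfolding class_size_def using Y_measurable
  by (intro sq_integrable_diff sq_integrable_const sq_integrable_sum sq_integrable_bounded[where K=1]) auto

lemma sq_norm_centered_class_size_le: "sq_norm M (\<lambda>\<omega>. class_size n (labels \<omega>) True - real n / 2) \<le> real n / 4"
proof -
  let ?h = "\<lambda>v :: (real \<Rightarrow> real) \<times> bool. of_bool (snd v) - 1/2 :: real"
  have "class_size n (labels \<omega>) True - real n / 2 = (\<Sum>i=1..n. ?h (datum i \<omega>))" for \<omega>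
    by (simp add: datum_def class_size_def sum_subtractf)
  moreover have "sq_norm M (\<lambda>\<omega>. \<Sum>i=1..n. ?h (datum i \<omega>)) \<le> real n * (1/4)"
  proof (rule sq_norm_sum_data_le)
    fix i assume i: "i \<in> {1..n}"
    have [measurable]: "datum i \<in> measurable M datum_space" using i by (intro datum_measurable) simp
    show "sq_integrable M (\<lambda>\<omega>. ?h (datum i \<omega>))" by (rule sq_integrable_bounded[where K=1]) auto
    have square: "(?h v)\<^sup>2 = 1/4" for v by (cases "snd v") (simp_all add: power2_eq_square)
    show "sq_norm M (\<lambda>\<omega>. ?h (datum i \<omega>)) \<le> 1/4" by (simp add: square prob_space)
    have "integrable M (\<lambda>\<omega>. of_bool (Y i \<omega> = True) :: real)"
      using Y_measurable[of i] i by (intro sq_integrable_imp_integrable sq_integrable_bounded[where K=1]) auto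
    then have "expectation (\<lambda>\<omega>. of_bool (Y i \<omega> = True) - 1/2 :: real) = 0"
      using expectation_label[of i True] i by (subst Bochner_Integration.integral_diff) (auto simp: prob_space)
    then show "expectation (\<lambda>\<omega>. ?h (datum i \<omega>)) = 0" by (simp add: datum_def)
  qed measurable
  ultimately show ?thesis by simp
qed

lemma prob_unbalanced_le:
  assumes n: "n > 0"
  shows "prob unbalanced \<le> 4 / real n"
proof -
  let ?S = "\<lambda>\<omega>. class_size n (labels \<omega>) True - real n / 2"
  have "prob unbalanced \<le> prob {\<omega> \<in> space M. real n / 4 \<le> \<bar>?S \<omega>\<bar>}"
  proof (rule finite_measure_mono)
    show "unbalanced \<subseteq> {\<omega> \<in> space M. real n / 4 \<le> \<bar>?S \<omega>\<bar>}"
    proof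
      fix \<omega> assume "\<omega> \<in> unbalanced"
      then show "\<omega> \<in> {\<omega> \<in> space M. real n / 4 \<le> \<bar>?S \<omega>\<bar>}"
        using class_size_True_add_False[of n "labels \<omega>"] by (auto simp: unbalanced_def)
    qed
  qed measurable
  also have "\<dots> \<le> sq_norm M ?S / (real n / 4)\<^sup>2"
    using n sq_integrable_square[OF sq_integrable_class_size] by (intro second_moment_method) auto
  also have "\<dots> \<le> (real n / 4) / (real n / 4)\<^sup>2"
    by (intro divide_right_mono sq_norm_centered_class_size_le) simp
  also have "\<dots> = 4 / real n" using n by (simp add: power2_eq_square)
  finally show ?thesis .
qed

subsection \<open>The averaged risk of the plug-in rule\<close>

definition coef :: "nat \<Rightarrow> (real \<Rightarrow> real) \<times> bool \<Rightarrow> real" where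
  "coef j v = (if snd v then l2_inner (\<phi> j) f else l2_inner (\<phi> j) g) + wiener_int (\<phi> j) (fst v)"

definition centroid :: "(nat \<Rightarrow> (real \<Rightarrow> real) \<times> bool) \<Rightarrow> bool \<Rightarrow> nat \<Rightarrow> real" where
  "centroid x k j = class_mean n (\<lambda>i. snd (x i)) k (\<lambda>i. coef j (x i))"

definition plugin :: "nat \<Rightarrow> (nat \<Rightarrow> (real \<Rightarrow> real) \<times> bool) \<times> (real \<Rightarrow> real) \<times> bool \<Rightarrow> bool" where
  "plugin d x = nearest_centroid {1..d} (centroid (fst x) True) (centroid (fst x) False) (\<lambda>j. coef j (snd x))"

lemma plugin_measurable:
  "plugin d \<in> measurable ((\<Pi>\<^sub>M i\<in>{1..n}. datum_space) \<Otimes>\<^sub>M datum_space) (count_space UNIV)"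
proof -
  let ?S = "(\<Pi>\<^sub>M i\<in>{1..n}. datum_space) \<Otimes>\<^sub>M datum_space"
  have coef[measurable]: "coef j \<in> borel_measurable datum_space" for j unfolding coef_def[abs_def] by measurable
  have [measurable]: "(\<lambda>x. fst x i) \<in> measurable ?S datum_space" if "i \<in> {1..n}" for i
    by (rule measurable_compose[OF measurable_fst measurable_component_singleton[OF that]])
  have [measurable]: "(\<lambda>x. centroid (fst x) k j) \<in> borel_measurable ?S" for k j
    unfolding centroid_def class_mean_def class_sum_def class_size_def by measurable
  show ?thesis unfolding plugin_def nearest_centroid_def L2_set_def by measurable
qed

lemma centroid_sample: "centroid (sample \<omega>) k j = class_mean n (labels \<omega>) k (\<lambda>i. coef j (datum i \<omega>))"
  unfolding centroid_def by (intro class_mean_cong) (simp_all add: sample_def datum_def)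

definition estimation_energy :: "nat \<Rightarrow> bool \<Rightarrow> 'a \<Rightarrow> real" where
  "estimation_energy d k \<omega> = 16 / (real n)\<^sup>2 * (\<Sum>j=1..d. (class_sum n (labels \<omega>) k (\<lambda>i. noise i j \<omega>))\<^sup>2)"

lemma estimation_energy_nonneg: "0 \<le> estimation_energy d k \<omega>"
  by (simp add: estimation_energy_def sum_nonneg)

lemma integrable_estimation_energy: "integrable M (estimation_energy d k)"
  unfolding estimation_energy_def
  by (intro integrable_mult_right Bochner_Integration.integrable_sum sq_integrable_square sq_integrable_class_noise_sum) simp

lemma expectation_estimation_energy_le: "expectation (estimation_energy d k) \<le> 16 * (real d / real n)"
proof -
  have "expectation (estimation_energy d k) =
      16 / (real n)\<^sup>2 * (\<Sum>j=1..d. sq_norm M (\<lambda>\<omega>. class_sum n (labels \<omega>) k (\<lambda>i. noise i j \<omega>)))"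
    unfolding estimation_energy_def
    by (simp add: sq_integrable_square sq_integrable_class_noise_sum Bochner_Integration.integral_sum)
  also have "\<dots> \<le> 16 / (real n)\<^sup>2 * (\<Sum>j=1..d. real n)"
    by (intro mult_left_mono sum_mono sq_norm_class_noise_sum_le) auto
  also have "\<dots> = 16 * (real d / real n)" by (simp add: power2_eq_square)
  finally show ?thesis .
qed

lemma centroid_error_le:
  assumes \<omega>: "\<omega> \<in> space M - unbalanced" and n: "n > 0"
  shows "(\<Sum>j=1..d. (centroid (sample \<omega>) k j - l2_inner (\<phi> j) (if k then f else g))\<^sup>2) \<le> estimation_energy d k \<omega>"
  unfolding estimation_energy_def sum_distrib_left
proof (rule sum_mono)
  fix j
  have size: "real n / 4 \<le> class_size n (labels \<omega>) k" using \<omega> by (cases k) (auto simp: unbalanced_def not_less)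
  then have "class_size n (labels \<omega>) k \<noteq> 0" using n by auto
  then have "centroid (sample \<omega>) k j - l2_inner (\<phi> j) (if k then f else g) = class_mean n (labels \<omega>) k (\<lambda>i. noise i j \<omega>)"
    unfolding centroid_sample by (rule class_mean_shift) (auto simp: coef_def datum_def noise_def)
  then show "(centroid (sample \<omega>) k j - l2_inner (\<phi> j) (if k then f else g))\<^sup>2 \<le>
      16 / (real n)\<^sup>2 * (class_sum n (labels \<omega>) k (\<lambda>i. noise i j \<omega>))\<^sup>2"
    using class_mean_sq_le[OF size n] by simp
qed

context
  fixes d :: nat and \<delta> \<rho> :: real
  assumes n: "n > 0" and \<delta>: "0 \<le> \<delta>" and \<rho>: "\<rho> > 0"
    and bias: "\<delta>\<^sup>2 - (\<Sum>j=1..d. (l2_inner (\<phi> j) f - l2_inner (\<phi> j) g)\<^sup>2) \<le> 4 * \<rho>\<^sup>2"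
    and coef_le: "(\<Sum>j=1..d. (l2_inner (\<phi> j) f - l2_inner (\<phi> j) g)\<^sup>2) \<le> \<delta>\<^sup>2"
begin

definition excess_bound :: "'a \<Rightarrow> real" where
  "excess_bound \<omega> = indicat_real unbalanced \<omega> +
    100 * ((\<rho>\<^sup>2 + 2 * (estimation_energy d True \<omega> + estimation_energy d False \<omega>)) / max \<delta> \<rho>)"

lemma excess_bound_ge_indicator: "indicat_real unbalanced \<omega> \<le> excess_bound \<omega>"
  unfolding excess_bound_def using \<rho> estimation_energy_nonneg[of d _ \<omega>] by simp

lemma plugin_conditional_error_le:
  assumes \<omega>': "\<omega>' \<in> space M"
  shows "(prob {\<omega> \<in> space M. \<not> plugin d (sample \<omega>', (driving_path 0 \<omega>, True))} +
    prob {\<omega> \<in> space M. plugin d (sample \<omega>', (driving_path 0 \<omega>, False))}) / 2 \<le> normal_tail (\<delta> / 2) + excess_bound \<omega>'"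
    (is "(prob ?A1 + prob ?A0) / 2 \<le> _")
proof (cases "\<omega>' \<in> unbalanced")
  case True
  then have "1 \<le> normal_tail (\<delta> / 2) + excess_bound \<omega>'"
    using excess_bound_ge_indicator[of \<omega>'] normal_tail_nonneg[of "\<delta> / 2"] by simp
  moreover have "(prob ?A1 + prob ?A0) / 2 \<le> (1 + 1) / 2" by (intro divide_right_mono add_mono prob_le_1) simp
  ultimately show ?thesis by simp
next
  case False
  interpret W0: brownian M "W 0" by (rule brownian_W) simp
  let ?\<theta> = "centroid (sample \<omega>') True" and ?\<mu> = "centroid (sample \<omega>') False"
  let ?e1 = "\<Sum>j=1..d. (?\<theta> j - l2_inner (\<phi> j) f)\<^sup>2" and ?e0 = "\<Sum>j=1..d. (?\<mu> j - l2_inner (\<phi> j) g)\<^sup>2"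
  have "orthogonal_family unit_leb {1..d} \<phi> (\<lambda>_. 1)"
    by (rule orthogonal_family_subset[OF orthogonal_family_basis]) auto
  from W0.plugin_error_le[OF _ this bias coef_le \<delta> \<rho>, of ?\<theta> ?\<mu>]
  have "(prob ?A1 + prob ?A0) / 2 \<le> normal_tail (\<delta> / 2) + 100 * ((\<rho>\<^sup>2 + 2 * (?e1 + ?e0)) / max \<delta> \<rho>)"
    by (simp add: plugin_def coef_def driving_path_def wiener_int_restrict)
  also have "\<dots> \<le> normal_tail (\<delta> / 2) + excess_bound \<omega>'"
  proof -
    have "?e1 \<le> estimation_energy d True \<omega>'" "?e0 \<le> estimation_energy d False \<omega>'"
      using centroid_error_le[OF _ n, of \<omega>' True d] centroid_error_le[OF _ n, of \<omega>' False d] False \<omega>' by simp_all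
    then show ?thesis
      using False \<rho> unfolding excess_bound_def
      by (simp add: divide_right_mono add_mono)
  qed
  finally show ?thesis .
qed

lemma integrable_excess_bound: "integrable M excess_bound"
  unfolding excess_bound_def[abs_def]
  by (intro Bochner_Integration.integrable_add integrable_mult_right integrable_divide integrable_const
      integrable_estimation_energy) (simp add: emeasure_eq_measure)

lemma expectation_excess_bound_le:
  assumes d: "real d / real n \<le> \<rho>\<^sup>2" and max_le: "max \<delta> \<rho> \<le> 2 * (real n * \<rho>\<^sup>2)"
  shows "expectation excess_bound \<le> 6508 * (\<rho>\<^sup>2 / max \<delta> \<rho>)"
proof -
  have max_pos: "max \<delta> \<rho> > 0" using \<rho> by simp
  have energy: "expectation (estimation_energy d k) \<le> 16 * \<rho>\<^sup>2" for k
    using expectation_estimation_energy_le[of d k] d by simp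
  have "expectation excess_bound = prob unbalanced +
      100 * ((\<rho>\<^sup>2 + 2 * (expectation (estimation_energy d True) + expectation (estimation_energy d False))) / max \<delta> \<rho>)"
    unfolding excess_bound_def[abs_def] using integrable_estimation_energy
    by (simp add: prob_space emeasure_eq_measure)
  also have "\<dots> \<le> 8 * (\<rho>\<^sup>2 / max \<delta> \<rho>) + 100 * ((\<rho>\<^sup>2 + 2 * (16 * \<rho>\<^sup>2 + 16 * \<rho>\<^sup>2)) / max \<delta> \<rho>)"
  proof (intro add_mono order_refl mult_left_mono divide_right_mono energy)
    have "prob unbalanced \<le> 4 / real n" by (rule prob_unbalanced_le[OF n])
    also have "\<dots> \<le> 8 * (\<rho>\<^sup>2 / max \<delta> \<rho>)" using max_le n max_pos by (simp add: field_simps)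
    finally show "prob unbalanced \<le> 8 * (\<rho>\<^sup>2 / max \<delta> \<rho>)" .
  qed (use max_pos in auto)
  also have "\<dots> = 6508 * (\<rho>\<^sup>2 / max \<delta> \<rho>)" using max_pos by (simp add: field_simps)
  finally show ?thesis .
qed

lemma plugin_risk_le: "prob {\<omega> \<in> space M. plugin d (sample \<omega>, datum 0 \<omega>) \<noteq> Y 0 \<omega>}
  \<le> normal_tail (\<delta> / 2) + expectation excess_bound"
proof -
  let ?B = "\<lambda>\<omega>. normal_tail (\<delta> / 2) + excess_bound \<omega>"
  have nonneg: "0 \<le> ?B \<omega>" for \<omega>
    using normal_tail_nonneg[of "\<delta> / 2"] order_trans[OF indicator_pos_le excess_bound_ge_indicator[of \<omega>]] by simp
  have "ennreal (prob {\<omega> \<in> space M. plugin d (sample \<omega>, datum 0 \<omega>) \<noteq> Y 0 \<omega>}) \<le> (\<integral>\<^sup>+\<omega>. ennreal (?B \<omega>) \<partial>M)"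
    unfolding error_prob_conditional[OF plugin_measurable]
    by (intro nn_integral_mono ennreal_leI plugin_conditional_error_le)
  also have "\<dots> = ennreal (expectation ?B)"
    using nonneg integrable_excess_bound by (intro nn_integral_eq_integral) auto
  finally have "prob {\<omega> \<in> space M. plugin d (sample \<omega>, datum 0 \<omega>) \<noteq> Y 0 \<omega>} \<le> expectation ?B"
    using Bochner_Integration.integral_nonneg[of M ?B] nonneg by (simp only: ennreal_le_iff)
  then show ?thesis using integrable_excess_bound by (simp add: prob_space)
qed

end

subsection \<open>The classifier as a plug-in rule\<close>

abbreviation fourier :: "nat \<Rightarrow> nat \<Rightarrow> 'a \<Rightarrow> real" where
  "fourier i j \<equiv> stoch_int M (\<phi> j) (obs_path f g (W i) (Y i))"

lemma fourier_measurable: "i \<le> n \<Longrightarrow> j \<ge> 1 \<Longrightarrow> fourier i j \<in> borel_measurable M"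
  by (intro stoch_int_eq_L2_limit(1)[OF brownian.L2_tendsto_dyadic_sum_obs_path[OF brownian_W]]
    sq_integrable_basis f g Y_measurable)

lemma fourier_AE: "i \<le> n \<Longrightarrow> j \<ge> 1 \<Longrightarrow> AE \<omega> in M. fourier i j \<omega> = coef j (datum i \<omega>)"
  using stoch_int_eq_L2_limit(2)[OF brownian.L2_tendsto_dyadic_sum_obs_path[OF brownian_W
    sq_integrable_basis f g Y_measurable]]
  by (simp add: coef_def datum_def driving_path_def wiener_int_restrict)

lemma hat_Phi_AE_plugin: "AE \<omega> in M. hat_Phi d n Y fourier \<omega> \<longleftrightarrow> plugin d (sample \<omega>, datum 0 \<omega>)"
proof -
  have "AE \<omega> in M. \<forall>i\<in>{..n}. \<forall>j\<in>{1..d}. fourier i j \<omega> = coef j (datum i \<omega>)"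
    using fourier_AE by (intro AE_finite_allI) auto
  then show ?thesis
  proof eventually_elim
    fix \<omega> assume fourier_eq: "\<forall>i\<in>{..n}. \<forall>j\<in>{1..d}. fourier i j \<omega> = coef j (datum i \<omega>)"
    then have "class_mean n (labels \<omega>) k (\<lambda>i. fourier i j \<omega>) = centroid (sample \<omega>) k j" if "j \<in> {1..d}" for k j
      unfolding centroid_sample using that by (intro class_mean_cong) auto
    with fourier_eq show "hat_Phi d n Y fourier \<omega> \<longleftrightarrow> plugin d (sample \<omega>, datum 0 \<omega>)"
      unfolding hat_Phi_iff plugin_def nearest_centroid_def fst_conv snd_conv
      by (intro arg_cong2[where f="(\<le>)"] L2_set_cong) auto
  qed
qed

lemma hat_Phi_measurable: "hat_Phi d n Y fourier \<in> measurable M (count_space UNIV)"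
proof -
  have [measurable]: "fourier i j \<in> borel_measurable M" if "i \<in> {0..n}" "j \<in> {1..d}" for i j
    using that by (intro fourier_measurable) auto
  have [measurable]: "fourier 0 j \<in> borel_measurable M" if "j \<in> {1..d}" for j
    using that by (intro fourier_measurable) auto
  have [measurable]: "Y i \<in> measurable M (count_space UNIV)" if "i \<in> {1..n}" for i
    using that by (intro Y_measurable) simp
  have [measurable]: "(\<lambda>\<omega>. class_mean n (labels \<omega>) k (\<lambda>i. fourier i j \<omega>)) \<in> borel_measurable M" if "j \<in> {1..d}" for k j
    unfolding class_mean_def class_sum_def class_size_def using that by measurable
  show ?thesis unfolding hat_Phi_iff[abs_def] nearest_centroid_def L2_set_def by measurable
qed

lemma hat_Phi_risk_eq_plugin_risk:
  "prob {\<omega> \<in> space M. hat_Phi d n Y fourier \<omega> \<noteq> Y 0 \<omega>} = prob {\<omega> \<in> space M. plugin d (sample \<omega>, datum 0 \<omega>) \<noteq> Y 0 \<omega>}"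
proof (rule finite_measure_eq_AE)
  note [measurable] = hat_Phi_measurable plugin_measurable sample_measurable datum_measurable[of 0, simplified]
    Y_measurable[of 0, simplified]
  show "{\<omega> \<in> space M. hat_Phi d n Y fourier \<omega> \<noteq> Y 0 \<omega>} \<in> events" by measurable
  show "{\<omega> \<in> space M. plugin d (sample \<omega>, datum 0 \<omega>) \<noteq> Y 0 \<omega>} \<in> events" by measurable
  show "AE \<omega> in M. \<omega> \<in> {\<omega> \<in> space M. hat_Phi d n Y fourier \<omega> \<noteq> Y 0 \<omega>} \<longleftrightarrow>
      \<omega> \<in> {\<omega> \<in> space M. plugin d (sample \<omega>, datum 0 \<omega>) \<noteq> Y 0 \<omega>}"
    using hat_Phi_AE_plugin by eventually_elim auto
qed

end

section \<open>The rate of convergence\<close>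

definition rate :: "real \<Rightarrow> real \<Rightarrow> nat \<Rightarrow> real" where
  "rate s R n = R powr (1 / (2 * s + 1)) * real n powr (- s / (2 * s + 1))"

definition cutoff :: "real \<Rightarrow> real \<Rightarrow> nat \<Rightarrow> real" where
  "cutoff s R n = (R\<^sup>2 * real n) powr (1 / (2 * s + 1))"

lemma rate_pos: "R > 0 \<Longrightarrow> n > 0 \<Longrightarrow> rate s R n > 0"
  by (simp add: rate_def)

lemma rate_power2:
  assumes "R > 0" "n > 0"
  shows "(rate s R n)\<^sup>2 = R powr (2 / (2 * s + 1)) * real n powr (- (2 * s) / (2 * s + 1))"
  unfolding rate_def power_mult_distrib using assms by (simp add: powr_powr mult.commute flip: powr_realpow)

context
  fixes s R :: real and n :: nat
  assumes s: "s > 0" and R: "R > 0" and n: "n > 0"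
begin

lemma cutoff_eq_rate: "cutoff s R n = real n * (rate s R n)\<^sup>2"
proof -
  define q where "q = 2 * s + 1"
  have q: "q > 1" using s by (simp add: q_def)
  have "(R\<^sup>2) powr (1 / q) = R powr (2 / q)" using powr_powr[of R 2 "1 / q"] R by simp
  then have "cutoff s R n = R powr (2 / q) * real n powr (1 / q)"
    unfolding cutoff_def q_def[symmetric] by (simp add: powr_mult)
  also have "1 / q = 1 + - (2 * s) / q" using q by (simp add: q_def field_simps)
  also have "real n powr (1 + - (2 * s) / q) = real n * real n powr (- (2 * s) / q)"
    unfolding powr_add using n by simp
  finally show ?thesis unfolding rate_power2[OF R n] q_def[symmetric] by simp
qed

lemma cutoff_bias_le:
  assumes cutoff: "1 \<le> cutoff s R n"
  shows "R\<^sup>2 * real (Suc (nat \<lfloor>cutoff s R n\<rfloor>)) powr (- 2 * s) \<le> (rate s R n)\<^sup>2"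
proof -
  let ?B = "cutoff s R n"
  have "?B \<le> real (Suc (nat \<lfloor>?B\<rfloor>))" using cutoff by linarith
  then have "real (Suc (nat \<lfloor>?B\<rfloor>)) powr (- 2 * s) \<le> ?B powr (- 2 * s)"
    using cutoff s by (intro powr_mono2') auto
  then have "R\<^sup>2 * real (Suc (nat \<lfloor>?B\<rfloor>)) powr (- 2 * s) \<le> R\<^sup>2 * ?B powr (1 - (2 * s + 1))"
    by (intro mult_left_mono) auto
  also have "?B powr (1 - (2 * s + 1)) = ?B / ?B powr (2 * s + 1)" unfolding powr_diff using cutoff by simp
  also have "?B powr (2 * s + 1) = R\<^sup>2 * real n" unfolding cutoff_def using R n s by (simp add: powr_powr)
  also have "R\<^sup>2 * (?B / (R\<^sup>2 * real n)) = (rate s R n)\<^sup>2" unfolding cutoff_eq_rate using R n by simp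
  finally show ?thesis .
qed

lemma cutoff_ge:
  assumes "max 1 (R powr (2 * s + 1)) \<le> R\<^sup>2 * real n"
  shows "1 \<le> cutoff s R n" "R \<le> cutoff s R n"
proof -
  show "1 \<le> cutoff s R n" unfolding cutoff_def using assms s by (intro ge_one_powr_ge_zero) auto
  have "R = (R powr (2 * s + 1)) powr (1 / (2 * s + 1))" using R s by (simp add: powr_powr)
  also have "\<dots> \<le> cutoff s R n" unfolding cutoff_def using assms s by (intro powr_mono2) auto
  finally show "R \<le> cutoff s R n" .
qed

lemma rate_le_cutoff:
  assumes "1 \<le> cutoff s R n"
  shows "rate s R n \<le> cutoff s R n"
proof (cases "rate s R n \<le> 1")
  case False
  have "rate s R n * 1 \<le> rate s R n * rate s R n" using False by (intro mult_left_mono) auto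
  also have "\<dots> \<le> real n * (rate s R n)\<^sup>2" using n by (simp add: power2_eq_square mult_le_cancel_right1)
  finally show ?thesis by (simp add: cutoff_eq_rate)
qed (use assms in simp)

end

lemma (in bm_experiment) excess_risk_le:
  assumes s: "s > 0" and R: "R > 0" and n: "n > 0" and n_ge: "max 1 (R powr (2 * s + 1)) \<le> R\<^sup>2 * real n"
    and f_class: "f \<in> sobolev_class \<phi> s R" and g_class: "g \<in> sobolev_class \<phi> s R"
  shows "prob {\<omega> \<in> space M. hat_Phi (nat \<lfloor>cutoff s R n\<rfloor>) n Y fourier \<omega> \<noteq> Y 0 \<omega>}
    - opt_risk M n (\<lambda>i. obs_path f g (W i) (Y i)) Y
    \<le> 6508 * ((rate s R n)\<^sup>2 / max (l2_norm (\<lambda>t. f t - g t)) (rate s R n))"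
proof -
  define d where "d = nat \<lfloor>cutoff s R n\<rfloor>"
  define \<delta> where "\<delta> = l2_norm (\<lambda>t. f t - g t)"
  define \<rho> where "\<rho> = rate s R n"
  have \<rho>: "\<rho> > 0" unfolding \<rho>_def by (rule rate_pos[OF R n])
  have \<delta>_eq: "\<delta> = sqrt (sq_norm unit_leb (\<lambda>t. f t - g t))"
    unfolding \<delta>_def by (intro l2_norm_eq sq_integrable_diff f g)
  then have \<delta>_sq: "\<delta>\<^sup>2 = sq_norm unit_leb (\<lambda>t. f t - g t)" and \<delta>: "0 \<le> \<delta>" by simp_all
  note cutoff = cutoff_ge[OF s R n n_ge] and cutoff_rate = cutoff_eq_rate[OF s R n]
  have bias: "\<delta>\<^sup>2 - (\<Sum>j=1..d. (l2_inner (\<phi> j) f - l2_inner (\<phi> j) g)\<^sup>2) \<le> 4 * \<rho>\<^sup>2"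
    using sobolev_bias_le[OF f_class g_class s, of d] cutoff_bias_le[OF s R n cutoff(1)]
    unfolding \<delta>_sq \<rho>_def d_def by linarith
  have coef_le: "(\<Sum>j=1..d. (l2_inner (\<phi> j) f - l2_inner (\<phi> j) g)\<^sup>2) \<le> \<delta>\<^sup>2"
    unfolding \<delta>_sq by (rule sum_sq_coef_diff_le[OF f g])
  have d: "real d / real n \<le> \<rho>\<^sup>2"
    using cutoff(1) n cutoff_rate unfolding d_def \<rho>_def by (simp add: pos_divide_le_eq mult.commute)
  have "\<delta>\<^sup>2 \<le> (2 * R)\<^sup>2"
    using sobolev_bias_le[OF f_class g_class s, of 0] by (simp add: \<delta>_sq power_mult_distrib)
  then have "\<delta> \<le> 2 * R" using R by (intro power2_le_imp_le[of \<delta>]) auto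
  then have "max \<delta> \<rho> \<le> 2 * (real n * \<rho>\<^sup>2)"
    using rate_le_cutoff[OF s R n cutoff(1)] cutoff unfolding \<rho>_def cutoff_rate[symmetric] by simp
  from expectation_excess_bound_le[OF n \<delta> \<rho> bias coef_le d this] plugin_risk_le[OF n \<delta> \<rho> bias coef_le]
  show ?thesis
    using normal_tail_le_opt_risk unfolding hat_Phi_risk_eq_plugin_risk
      \<delta>_def[symmetric] \<rho>_def[symmetric] d_def[symmetric] \<delta>_eq[symmetric]
    by linarith
qed

lemma excess_rate_le_log_rate:
  fixes \<rho> \<delta> \<Delta> L :: real
  assumes \<rho>: "\<rho> > 0" and L: "1 \<le> L" and \<Delta>: "\<Delta> \<le> \<delta>"
  shows "\<rho>\<^sup>2 / max \<delta> \<rho> \<le> (if \<Delta> < \<rho> * L then \<rho> * L else \<rho>\<^sup>2 * L\<^sup>2 / \<Delta>)"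
proof (cases "\<Delta> < \<rho> * L")
  case True
  have "\<rho>\<^sup>2 / max \<delta> \<rho> \<le> \<rho>\<^sup>2 / \<rho>" using \<rho> by (intro divide_left_mono) auto
  also have "\<dots> = \<rho> * 1" using \<rho> by (simp add: power2_eq_square)
  also have "\<dots> \<le> \<rho> * L" using \<rho> L by (intro mult_left_mono) auto
  finally show ?thesis using True by simp
next
  case False
  have "0 < \<rho> * L" using \<rho> L by simp
  then have \<Delta>_pos: "\<Delta> > 0" using False by simp
  then have "\<rho>\<^sup>2 / max \<delta> \<rho> \<le> \<rho>\<^sup>2 * 1\<^sup>2 / \<Delta>" using \<Delta> \<rho> by (simp add: divide_left_mono)
  also have "\<dots> \<le> \<rho>\<^sup>2 * L\<^sup>2 / \<Delta>" using \<Delta>_pos L by (intro divide_right_mono mult_left_mono power_mono) auto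
  finally show ?thesis using False by simp
qed

text \<open>This sample size makes \<open>n \<rho>\<^sup>2 = (R\<^sup>2 n)\<^bsup>1/(2s+1)\<^esup>\<close> at least \<open>max 1 R\<close>; as \<open>\<parallel>f - g\<parallel> \<le> 2 R\<close>, the
  probability \<open>4/n\<close> of an unbalanced sample is then of order \<open>\<rho>\<^sup>2 / max \<parallel>f - g\<parallel> \<rho>\<close>.\<close>

definition min_sample_size :: "real \<Rightarrow> real \<Rightarrow> nat" where
  "min_sample_size s R = max 86 (nat \<lceil>max 1 (R powr (2 * s + 1)) / R\<^sup>2\<rceil>)"

lemma (in bm_experiment) excess_risk_le_log_rate:
  assumes s: "s > 0" and R: "R > 0" and n: "n \<ge> min_sample_size s R"
    and f_class: "f \<in> sobolev_class \<phi> s R" and g_class: "g \<in> sobolev_class \<phi> s R" and \<Delta>: "\<Delta> \<le> l2_norm (\<lambda>t. f t - g t)"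
  shows "prob {\<omega> \<in> space M. hat_Phi (nat \<lfloor>cutoff s R n\<rfloor>) n Y fourier \<omega> \<noteq> Y 0 \<omega>}
    - opt_risk M n (\<lambda>i. obs_path f g (W i) (Y i)) Y
    \<le> (if \<Delta> < rate s R n * ln (real n) then 6508 * (rate s R n * ln (real n))
        else 6508 / \<Delta> * (rate s R n)\<^sup>2 * (ln (real n))\<^sup>2)"
proof -
  have n_pos: "n > 0" and "exp 1 \<le> real n" and "max 1 (R powr (2 * s + 1)) / R\<^sup>2 \<le> real n"
    using n exp_le unfolding min_sample_size_def by linarith+
  then have ln_n: "1 \<le> ln (real n)" and n_ge: "max 1 (R powr (2 * s + 1)) \<le> R\<^sup>2 * real n"
    using R by (simp_all add: ln_ge_iff pos_divide_le_eq mult.commute)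
  note excess_risk_le[OF s R n_pos n_ge f_class g_class]
  also have "6508 * ((rate s R n)\<^sup>2 / max (l2_norm (\<lambda>t. f t - g t)) (rate s R n)) \<le>
    6508 * (if \<Delta> < rate s R n * ln (real n) then rate s R n * ln (real n) else (rate s R n)\<^sup>2 * (ln (real n))\<^sup>2 / \<Delta>)"
    by (intro mult_left_mono excess_rate_le_log_rate rate_pos R n_pos ln_n \<Delta>) simp
  finally show ?thesis by (simp split: if_splits)
qed

theorem theorem1:
  shows "\<exists>c::real. c > 0 \<and> (\<exists>N :: real \<Rightarrow> real \<Rightarrow> nat. \<forall>s::real. \<forall>R::real. s > 0 \<and> R > 0 \<longrightarrow>
    N s R \<ge> 86 \<and>
    (\<forall>n::nat. \<forall>\<Delta>::real. n \<ge> N s R \<and> \<Delta> \<ge> 0 \<longrightarrow>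
      (\<forall>(M::'a measure) W Y \<phi> f g.
        orthonormal_basis_L2 \<phi> \<and> bm_model M n W Y \<and>
        f \<in> sobolev_class \<phi> s R \<and> g \<in> sobolev_class \<phi> s R \<and>
        l2_norm (\<lambda>t. f t - g t) \<ge> \<Delta> \<longrightarrow>
        (let X = (\<lambda>i. obs_path f g (W i) (Y i));
             Z = (\<lambda>i j. stoch_int M (\<phi> j) (X i));
             d = nat (floor ((R^2 * real n) powr (1 / (2 * s + 1))));
             r = R powr (1 / (2 * s + 1)) * real n powr (- s / (2 * s + 1)) * ln (real n)
         in measure M {\<omega> \<in> space M. hat_Phi d n Y Z \<omega> \<noteq> Y 0 \<omega>} - opt_risk M n X Y
            \<le> (if \<Delta> < r then c * r
                else c / \<Delta> * R powr (2 / (2 * s + 1)) * real n powr (- (2 * s) / (2 * s + 1)) * (ln (real n))^2)))))"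
    (is "\<exists>c. _ \<and> (\<exists>N. \<forall>s R. _ \<longrightarrow> _ \<and> (\<forall>n \<Delta>. _ \<longrightarrow> (\<forall>M W Y \<phi> f g. _ \<longrightarrow> ?bound c s R n \<Delta> M W Y \<phi> f g)))")
proof (intro exI[of _ "6508 :: real"] exI[of _ min_sample_size] conjI allI impI; (elim conjE)?)
  fix s R \<Delta> :: real and n :: nat and M :: "'a measure" and W Y \<phi> f g
  assume s: "s > 0" and R: "R > 0" and n: "n \<ge> min_sample_size s R"
    and basis: "orthonormal_basis_L2 \<phi>" and model: "bm_model M n W Y"
    and f_class: "f \<in> sobolev_class \<phi> s R" and g_class: "g \<in> sobolev_class \<phi> s R"
    and \<Delta>: "l2_norm (\<lambda>t. f t - g t) \<ge> \<Delta>"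
  interpret L2_basis \<phi> by unfold_locales (rule basis)
  interpret prob_space M using model by (simp add: bm_model_def)
  interpret bm_experiment M \<phi> n W Y f g
    by unfold_locales (intro model sobolev_class_sq_integrable[OF f_class] sobolev_class_sq_integrable[OF g_class])+
  have "n > 0" using n by (simp add: min_sample_size_def)
  from excess_risk_le_log_rate[OF s R n f_class g_class \<Delta>] show "?bound 6508 s R n \<Delta> M W Y \<phi> f g"
    unfolding rate_power2[OF R \<open>n > 0\<close>] unfolding rate_def cutoff_def Let_def by (simp only: mult.assoc)
qed (simp_all add: min_sample_size_def)

end
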